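(* Let $G$ be a connected claw-free graph of order $n$. If $\sigma_{6}(G)\geq n-5$, then $G$ has a spanning tree with at most two branch vertices.
   Context: All graphs are finite and simple (no loops, no multiple edges). The order of a graph $G$ is $|G| = |V(G)|$. A graph is claw-free if it contains no induced subgraph isomorphic to $K_{1,3}$. For a vertex $v$ of $G$, $\deg_G(v)$ denotes the degree of $v$ in $G$. For an integer $k\geq 2$, $$\sigma_k(G)=\min\left\{ \sum_{x\in S}\deg_{G}(x) : S\subseteq V(G) \text{ is an independent set of } G,\ |S|=k\right\},$$ with the usual convention that $\sigma_k(G)=+\infty$ if $G$ has no independent set of $k$ vertices. A branch vertex of a tree is a vertex whose degree in the tree is at least three. *)

theory Defs
  imports "Graph_Theory.Graph_Theory" "HOL-Library.Extended_Nat"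
begin

text \<open>
  A finite simple graph is a \<^locale>\<open>pair_graph\<close>: a finite vertex set with a symmetric irreflexive
  arc relation, an undirected edge \<open>uv\<close> being the two arcs \<open>(u,v)\<close> and \<open>(v,u)\<close>.  The degree of a
  vertex is therefore its out-degree.
\<close>

abbreviation deg :: "'a pair_pre_digraph \<Rightarrow> 'a \<Rightarrow> nat" where
  "deg G v \<equiv> out_degree (with_proj G) v"

lemma (in pair_graph) deg_eq_card_neighbours: "deg G v = card {w. (v, w) \<in> parcs G}"
proof -
  have "{e \<in> parcs G. fst e = v} = Pair v ` {w. (v, w) \<in> parcs G}" by force
  then show ?thesis
    by (simp add: out_degree_def out_arcs_def card_image inj_on_def)
qed

definition claw_free :: "'a pair_pre_digraph \<Rightarrow> bool" where
  "claw_free G \<longleftrightarrow> \<not> (\<exists>H. induced_subgraph H (with_proj G) \<and> K\<^bsub>1,3\<^esub> H)"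

definition independent_set :: "'a pair_pre_digraph \<Rightarrow> 'a set \<Rightarrow> bool" where
  "independent_set G S \<longleftrightarrow> S \<subseteq> pverts G \<and> (\<forall>u\<in>S. \<forall>v\<in>S. (u, v) \<notin> parcs G)"

text \<open>The infimum in \<^typ>\<open>enat\<close> is attained if the index set is nonempty, and is \<open>\<infinity>\<close> otherwise.\<close>

definition sigma :: "nat \<Rightarrow> 'a pair_pre_digraph \<Rightarrow> enat" where
  "sigma k G = (INF S \<in> {S. independent_set G S \<and> card S = k}. enat (\<Sum>x\<in>S. deg G x))"

text \<open>
  The notions \<^const>\<open>forest\<close>, \<^const>\<open>tree\<close> and \<^const>\<open>spanning_tree\<close> of the library forbid directed
  cycles only, and count \<open>u, v, u\<close> as a cycle.  They do not describe undirected trees, neither for a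
  symmetric digraph nor for an orientation of a graph.  The directed cycles of length at least three
  of a symmetric digraph are exactly the cycles of the undirected graph.
\<close>

definition undirected_tree :: "'a pair_pre_digraph \<Rightarrow> bool" where
  "undirected_tree T \<longleftrightarrow> pair_graph T \<and> connected (with_proj T) \<and>
     \<not> (\<exists>p. pre_digraph.cycle (with_proj T) p \<and> 3 \<le> length p)"

definition undirected_spanning_tree :: "'a pair_pre_digraph \<Rightarrow> 'a pair_pre_digraph \<Rightarrow> bool" where
  "undirected_spanning_tree T G \<longleftrightarrow> undirected_tree T \<and> spanning (with_proj T) (with_proj G)"

definition branch_vertices :: "'a pair_pre_digraph \<Rightarrow> 'a set" where
  "branch_vertices T = {v \<in> pverts T. 3 \<le> deg T v}"

end

theory Submission
  imports Defs
begin

text \<open>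
  Take a spanning tree that minimizes the excess, the sum of \<open>val v - 2\<close> over its branch vertices.  A leaf
  \<open>x\<close> and a neighbour \<open>v\<close> of \<open>x\<close> block the tree edge at \<open>v\<close> that leads to \<open>x\<close>; claw-freeness and edge
  exchanges show that no edge is blocked twice, so the degree sum of the leaves is at most \<open>n - 1\<close>
  minus the number of unblocked edges.  Every branch vertex is incident with many unblocked edges,
  which settles the case of excess at least four, where there are at least six leaves.

  Excess at most two yields at most two branch vertices.  If the excess is three and there are three branch
  vertices \<open>s\<close>, \<open>b\<close>, \<open>c\<close>, in this order along a path of the tree, choose the tree such that
  lexicographically the two legs at \<open>s\<close>, then the path from \<open>s\<close> to \<open>b\<close>, then the two legs at \<open>c\<close> are
  as large as possible.  The five leaves and \<open>s\<close> are independent.  The two legs at \<open>s\<close> form a path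
  even without \<open>s\<close>, and \<open>s\<close> can be inserted into it at a place such that for every neighbour of \<open>s\<close> the
  tree edge towards \<open>s\<close> is unblocked.  Five more unblocked edges are found at \<open>b\<close> and \<open>c\<close>, so the six
  independent vertices have degree sum at most \<open>n - 6\<close>.
\<close>

section \<open>Connected spanning subgraphs and spanning trees\<close>

text \<open>The contradiction needs six independent vertices of degree sum at most n - 6, so five of
  the n - 1 tree edges must stay unblocked. A tree of excess e has e + 2 leaves and at least e + 1
  unblocked edges, which suffices from e = 4 on. For e = 3 there are only five leaves. The sixth
  vertex \<open>s\<close> is a branch vertex, and its degree has to be paid for separately: by one
  unblocked edge for each neighbour of \<open>s\<close>, besides five others. All these edges are
  taken towards \<open>s\<close> and named by their far end, so that counting edges becomes counting
  vertices. The obstacle is a neighbour of \<open>s\<close> on one leg that is adjacent to the leaf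
  of the other leg. The exchange lemmas do not exclude it, and this is why the place of
  \<open>s\<close> between the two legs has to be varied.\<close>

definition val :: "'a rel \<Rightarrow> 'a \<Rightarrow> nat" where
  "val T v = card (T `` {v})"

definition del_edge :: "'a rel \<Rightarrow> 'a \<Rightarrow> 'a \<Rightarrow> 'a rel" where
  "del_edge T a b = T - {(a, b), (b, a)}"

text \<open>For an edge \<open>ab\<close> of a tree \<open>T\<close> this is the component of
  \<open>T\<close> minus \<open>ab\<close> that contains \<open>a\<close>. Tree paths are described
  by these components.\<close>

definition side :: "'a rel \<Rightarrow> 'a \<Rightarrow> 'a \<Rightarrow> 'a set" where
  "side T a b = {v. (a, v) \<in> (del_edge T a b)\<^sup>*}"

definition swap_edge :: "'a rel \<Rightarrow> 'a \<Rightarrow> 'a \<Rightarrow> 'a \<Rightarrow> 'a \<Rightarrow> 'a rel" where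
  "swap_edge T v w x y = del_edge T v w \<union> {(x, y), (y, x)}"

lemma sym_del_edge: "sym T \<Longrightarrow> sym (del_edge T a b)"
  by (auto simp: del_edge_def sym_def)

lemma del_edge_commute: "del_edge T a b = del_edge T b a"
  by (auto simp: del_edge_def)

lemma self_in_side [simp]: "a \<in> side T a b"
  by (simp add: side_def)

lemma side_step:
  assumes "v \<in> side T a b" "(v, w) \<in> T"
  shows "w \<in> side T a b \<or> v = a \<and> w = b \<or> v = b \<and> w = a"
proof (cases "(v, w) \<in> del_edge T a b")
  case True
  then show ?thesis using assms by (auto simp: side_def intro: rtrancl_into_rtrancl)
next
  case False
  then show ?thesis using assms by (auto simp: del_edge_def)
qed

lemma side_subset:
  assumes "a \<in> D" "\<And>v w. v \<in> D \<Longrightarrow> (v, w) \<in> T \<Longrightarrow> w \<in> D \<or> v = a \<and> w = b"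
  shows "side T a b \<subseteq> D"
proof
  fix v assume "v \<in> side T a b"
  then have "(a, v) \<in> (del_edge T a b)\<^sup>*" by (simp add: side_def)
  then show "v \<in> D"
    by induction (use assms in \<open>auto simp: del_edge_def\<close>)
qed

locale fin_graph =
  fixes V :: "'a set" and E :: "'a rel"
  assumes finV: "finite V" and neV: "V \<noteq> {}" and EV: "E \<subseteq> V \<times> V"
    and symE: "sym E" and irrE: "(v, v) \<notin> E"
begin

lemma E_sym: "(u, v) \<in> E \<Longrightarrow> (v, u) \<in> E"
  using symE by (auto simp: sym_def)

lemma E_verts: "(u, v) \<in> E \<Longrightarrow> u \<in> V \<and> v \<in> V"
  using EV by auto

lemma finE: "finite E"
  using finite_subset[OF EV] finV by simp

definition conn_span :: "'a rel \<Rightarrow> bool" where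
  "conn_span T \<longleftrightarrow> T \<subseteq> E \<and> sym T \<and> (\<forall>u\<in>V. \<forall>v\<in>V. (u, v) \<in> T\<^sup>*)"

definition excess :: "'a rel \<Rightarrow> nat" where
  "excess T = (\<Sum>v\<in>V. val T v - 2)"

definition branches :: "'a rel \<Rightarrow> 'a set" where
  "branches T = {v \<in> V. 3 \<le> val T v}"

definition leaves :: "'a rel \<Rightarrow> 'a set" where
  "leaves T = {v \<in> V. val T v = 1}"

text \<open>Both arcs of an edge are stored, so the bound means at most n - 1 edges. For a connected
  spanning subgraph this characterizes trees, and an edge exchange preserves it by mere
  counting.\<close>

definition span_tree :: "'a rel \<Rightarrow> bool" where
  "span_tree T \<longleftrightarrow> conn_span T \<and> card T \<le> 2 * (card V - 1)"

text \<open>The competitors are all connected spanning subgraphs, so an exchange contradicts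
  optimality without a proof that its result is acyclic.\<close>

definition opt_tree :: "'a rel \<Rightarrow> bool" where
  "opt_tree T \<longleftrightarrow> span_tree T \<and> (\<forall>T'. conn_span T' \<longrightarrow> excess T \<le> excess T')"

lemma conn_spanD:
  assumes "conn_span T"
  shows "T \<subseteq> E" "sym T" "\<And>u v. (u, v) \<in> T \<Longrightarrow> (v, u) \<in> T" "\<And>u v. (u, v) \<in> T \<Longrightarrow> u \<in> V \<and> v \<in> V"
    "\<And>v. (v, v) \<notin> T" "finite T" "\<And>u v. u \<in> V \<Longrightarrow> v \<in> V \<Longrightarrow> (u, v) \<in> T\<^sup>*"
  using assms EV irrE finite_subset[OF _ finE, of T] by (auto simp: conn_span_def sym_def)

lemma finite_nbrs: "conn_span T \<Longrightarrow> finite (T `` {v})"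
  using conn_spanD(6) by (simp add: finite_Image)

lemma val_mono: "conn_span T \<Longrightarrow> T0 \<subseteq> T \<Longrightarrow> val T0 v \<le> val T v"
  unfolding val_def by (intro card_mono finite_nbrs) auto

lemma excess_mono: "conn_span T \<Longrightarrow> T0 \<subseteq> T \<Longrightarrow> excess T0 \<le> excess T"
  unfolding excess_def by (intro sum_mono diff_le_mono val_mono)

text \<open>\<open>d\<close> is the distance to the root \<open>r\<close>, and \<open>par v\<close>
  is the second vertex of a shortest walk from \<open>v\<close> to \<open>r\<close>.\<close>

lemma ex_parent:
  assumes T: "conn_span T" and r: "r \<in> V"
  obtains par and d :: "'a \<Rightarrow> nat"
  where "\<And>v. v \<in> V - {r} \<Longrightarrow> (v, par v) \<in> T \<and> d (par v) < d v"
proof -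
  define d where "d v = (LEAST n. (v, r) \<in> T ^^ n)" for v
  have dd: "(v, r) \<in> T ^^ d v" if "v \<in> V" for v
  proof -
    have "(v, r) \<in> T\<^sup>*" using that r conn_spanD(7)[OF T] by blast
    then obtain n where "(v, r) \<in> T ^^ n" using rtrancl_imp_relpow by blast
    then show ?thesis unfolding d_def by (rule LeastI)
  qed
  have "\<exists>w. (v, w) \<in> T \<and> d w < d v" if v: "v \<in> V - {r}" for v
  proof -
    have *: "(v, r) \<in> T ^^ d v" using dd v by blast
    then have "d v \<noteq> 0" using v by (intro notI) simp
    then obtain m where m: "d v = Suc m" using not0_implies_Suc by blast
    then obtain w where w: "(v, w) \<in> T" "(w, r) \<in> T ^^ m"
      using * relpow_Suc_D2 by metis
    then have "d w \<le> m" unfolding d_def by (intro Least_le)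
    then show ?thesis using w m by auto
  qed
  then show ?thesis using that by metis
qed

text \<open>The edges to parents suffice: descending along \<open>d\<close> reaches the root from
  every vertex, and there are at most n - 1 such edges.\<close>

lemma conn_span_contains_tree:
  assumes T: "conn_span T"
  obtains T0 where "T0 \<subseteq> T" "span_tree T0"
proof -
  obtain r where r: "r \<in> V" using neV by blast
  obtain par and d :: "'a \<Rightarrow> nat"
    where par: "\<And>v. v \<in> V - {r} \<Longrightarrow> (v, par v) \<in> T \<and> d (par v) < d v"
    using ex_parent[OF T r] by metis
  let ?A = "(\<lambda>v. (v, par v)) ` (V - {r})" and ?B = "(\<lambda>v. (par v, v)) ` (V - {r})"
  define T0 where "T0 = ?A \<union> ?B"
  have sub: "T0 \<subseteq> T" using par conn_spanD(3)[OF T] by (auto simp: T0_def)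
  have sym0: "sym T0" by (auto simp: T0_def sym_def)
  have reach: "(v, r) \<in> T0\<^sup>*" if "v \<in> V" for v
    using that
  proof (induction "d v" arbitrary: v rule: less_induct)
    case less
    show ?case
    proof (cases "v = r")
      case False
      then have "(v, par v) \<in> T \<and> d (par v) < d v" using par less.prems by auto
      moreover have "par v \<in> V" using calculation conn_spanD(4)[OF T] by blast
      moreover have "(v, par v) \<in> T0" using False less.prems by (auto simp: T0_def)
      ultimately show ?thesis using less.hyps[of "par v"] by (meson converse_rtrancl_into_rtrancl)
    qed simp
  qed
  have "(u, v) \<in> T0\<^sup>*" if "u \<in> V" "v \<in> V" for u v
    using reach[OF that(1)] reach[OF that(2)] sym_rtrancl[OF sym0]
    by (meson rtrancl_trans symD)
  then have "conn_span T0"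
    using sub sym0 conn_spanD(1)[OF T] by (auto simp: conn_span_def)
  moreover have "card T0 \<le> 2 * (card V - 1)"
  proof -
    have "card T0 \<le> card ?A + card ?B" unfolding T0_def by (rule card_Un_le)
    also have "\<dots> \<le> card (V - {r}) + card (V - {r})"
      by (intro add_mono card_image_le) (use finV in auto)
    also have "\<dots> = 2 * (card V - 1)" using r finV by simp
    finally show ?thesis .
  qed
  ultimately show ?thesis using that sub by (auto simp: span_tree_def)
qed

text \<open>As \<open>d\<close> decreases towards the parent, no arc to a parent is the reverse of
  another one. So these arcs and their reverses are 2(n - 1) distinct arcs.\<close>

lemma card_conn_span_ge:
  assumes T: "conn_span T"
  shows "2 * (card V - 1) \<le> card T"
proof -
  obtain r where r: "r \<in> V" using neV by blast
  obtain par and d :: "'a \<Rightarrow> nat"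
    where par: "\<And>v. v \<in> V - {r} \<Longrightarrow> (v, par v) \<in> T \<and> d (par v) < d v"
    using ex_parent[OF T r] by metis
  let ?A = "(\<lambda>v. (v, par v)) ` (V - {r})" and ?B = "(\<lambda>v. (par v, v)) ` (V - {r})"
  have disj: "?A \<inter> ?B = {}"
  proof (rule ccontr)
    assume "?A \<inter> ?B \<noteq> {}"
    then obtain u v where "u \<in> V - {r}" "v \<in> V - {r}" "u = par v" "par u = v" by auto
    then show False using par[of u] par[of v] by simp
  qed
  have "2 * (card V - 1) = card ?A + card ?B"
    using r finV by (simp add: card_image inj_on_def)
  also have "\<dots> = card (?A \<union> ?B)" using disj finV by (simp add: card_Un_disjoint)
  also have "\<dots> \<le> card T"
    using par conn_spanD(3,6)[OF T] by (intro card_mono) auto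
  finally show ?thesis .
qed

lemma span_treeD: "span_tree T \<Longrightarrow> conn_span T" "span_tree T \<Longrightarrow> card T = 2 * (card V - 1)"
  using card_conn_span_ge by (auto simp: span_tree_def intro: antisym)

lemma opt_treeD: "opt_tree T \<Longrightarrow> span_tree T" "opt_tree T \<Longrightarrow> conn_span T"
    "opt_tree T \<Longrightarrow> conn_span T' \<Longrightarrow> excess T \<le> excess T'"
  by (auto simp: opt_tree_def span_tree_def)

text \<open>Passing from a minimizer to a spanning tree inside it only removes edges and hence does
  not increase the excess.\<close>

lemma ex_opt_tree:
  assumes "conn_span E"
  obtains T where "opt_tree T"
proof -
  obtain T where T: "conn_span T" "\<And>T'. conn_span T' \<Longrightarrow> excess T \<le> excess T'"
    using ex_has_least_nat[of conn_span E excess] assms by blast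
  obtain T0 where T0: "T0 \<subseteq> T" "span_tree T0" using conn_span_contains_tree[OF T(1)] .
  have "excess T0 \<le> excess T" using T0 T(1) excess_mono by blast
  then have "opt_tree T0" using T0 T(2) by (fastforce simp: opt_tree_def)
  then show ?thesis by (rule that)
qed

text \<open>After the deletion there are fewer arcs than connectedness requires.\<close>

lemma bridge:
  assumes T: "span_tree T" and ab: "(a, b) \<in> T"
  shows "\<not> conn_span (del_edge T a b)"
proof
  assume "conn_span (del_edge T a b)"
  then have "2 * (card V - 1) \<le> card (del_edge T a b)" by (rule card_conn_span_ge)
  moreover have "del_edge T a b \<subset> T" using ab by (auto simp: del_edge_def)
  then have "card (del_edge T a b) < card T"
    using conn_spanD(6) span_treeD(1)[OF T] by (intro psubset_card_mono) auto
  ultimately show False using span_treeD(2)[OF T] by simp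
qed

section \<open>Components of a spanning tree minus an edge\<close>

lemma side_in_V:
  assumes "conn_span T" "a \<in> V" shows "side T a b \<subseteq> V"
proof
  fix v assume "v \<in> side T a b"
  then have "(a, v) \<in> (del_edge T a b)\<^sup>*" by (simp add: side_def)
  then show "v \<in> V"
    by induction (use assms conn_spanD(4)[OF assms(1)] in \<open>auto simp: del_edge_def\<close>)
qed

lemma in_one_side:
  assumes T: "conn_span T" and ab: "(a, b) \<in> T" and v: "v \<in> V"
  shows "v \<in> side T a b \<or> v \<in> side T b a"
proof -
  have "(a, v) \<in> T\<^sup>*" using v ab conn_spanD(4,7)[OF T] by blast
  then show ?thesis
  proof induction
    case (step y z)
    then show ?case using side_step[of y T a b z] side_step[of y T b a z] self_in_side by metis
  qed simp
qed

text \<open>A common vertex would join \<open>a\<close> to \<open>b\<close> without the edge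
  \<open>ab\<close>, which could then be dropped, against \<open>bridge\<close>.\<close>

lemma sides_disjoint:
  assumes T: "span_tree T" and ab: "(a, b) \<in> T"
  shows "side T a b \<inter> side T b a = {}"
proof (rule ccontr)
  assume "side T a b \<inter> side T b a \<noteq> {}"
  then obtain v where "v \<in> side T a b" "v \<in> side T b a" by blast
  then have v: "(a, v) \<in> (del_edge T a b)\<^sup>*" "(b, v) \<in> (del_edge T a b)\<^sup>*"
    unfolding side_def del_edge_commute[of T b a] mem_Collect_eq .
  note cT = span_treeD(1)[OF T]
  let ?D = "del_edge T a b"
  have sD: "sym (?D\<^sup>*)" using sym_rtrancl[OF sym_del_edge[OF conn_spanD(2)[OF cT]]] .
  have ab1: "(a, b) \<in> ?D\<^sup>*" using rtrancl_trans[OF v(1) symD[OF sD v(2)]] .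
  note ab' = ab1 symD[OF sD ab1]
  have "T \<subseteq> ?D\<^sup>*" using ab' by (auto simp: del_edge_def)
  then have "T\<^sup>* \<subseteq> ?D\<^sup>*" by (rule rtrancl_subset_rtrancl)
  moreover have "?D \<subseteq> E" using conn_spanD(1)[OF cT] by (auto simp: del_edge_def)
  moreover have "sym ?D" using sym_del_edge[OF conn_spanD(2)[OF cT]] .
  ultimately have "conn_span ?D"
    using conn_spanD(7)[OF cT] by (auto simp: conn_span_def)
  then show False using bridge[OF T ab] by blast
qed

context
  fixes T assumes T: "span_tree T"
begin

lemma cT: "conn_span T"
  using span_treeD(1)[OF T] .

lemma T_sym: "(u, v) \<in> T \<Longrightarrow> (v, u) \<in> T"
  using conn_spanD(3)[OF cT] .

lemma T_verts: "(u, v) \<in> T \<Longrightarrow> u \<in> V \<and> v \<in> V"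
  using conn_spanD(4)[OF cT] .

lemma not_in_side: "(a, b) \<in> T \<Longrightarrow> b \<notin> side T a b"
  using sides_disjoint[OF T] self_in_side[of b T a] by blast

lemma side_step':
  assumes "(a, b) \<in> T" "v \<in> side T a b" "(v, w) \<in> T"
  shows "w \<in> side T a b \<or> v = a \<and> w = b"
  using side_step[OF assms(2,3)] not_in_side[OF assms(1)] assms(2) by blast

text \<open>A walk from \<open>a\<close> that avoids the edge \<open>ab\<close> never meets
  \<open>b\<close>, so it does not use the edge \<open>bc\<close> either.\<close>

lemma side_nested:
  assumes ab: "(a, b) \<in> T" and bc: "(b, c) \<in> T" and "a \<noteq> c"
  shows "side T a b \<subseteq> side T b c"
proof
  fix v assume "v \<in> side T a b"
  then have "(a, v) \<in> (del_edge T a b)\<^sup>*" by (simp add: side_def)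
  then show "v \<in> side T b c"
  proof induction
    case base
    have "(b, a) \<in> del_edge T b c" using T_sym[OF ab] \<open>a \<noteq> c\<close> by (auto simp: del_edge_def)
    then show ?case by (auto simp: side_def)
  next
    case (step y z)
    have "y \<in> side T a b" using step.hyps(1) by (simp add: side_def)
    then have "y \<noteq> b" using not_in_side[OF ab] by blast
    then show ?case using side_step'[OF bc step.IH, of z] step.hyps(2) by (auto simp: del_edge_def)
  qed
qed

lemma sides_at_disjoint:
  assumes "(b, a) \<in> T" "(b, c) \<in> T" "a \<noteq> c"
  shows "side T a b \<inter> side T c b = {}"
  using side_nested[OF T_sym[OF assms(1)] assms(2,3)] sides_disjoint[OF T assms(2)] by blast

lemma side_decomp:
  assumes bc: "(b, c) \<in> T"
  shows "side T b c = insert b (\<Union>a \<in> T `` {b} - {c}. side T a b)"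
proof
  show "insert b (\<Union>a \<in> T `` {b} - {c}. side T a b) \<subseteq> side T b c"
    using side_nested[OF _ bc] T_sym by auto
  show "side T b c \<subseteq> insert b (\<Union>a \<in> T `` {b} - {c}. side T a b)"
  proof (rule side_subset)
    fix v w assume v: "v \<in> insert b (\<Union>a \<in> T `` {b} - {c}. side T a b)" and vw: "(v, w) \<in> T"
    then consider "v = b" | a where "a \<noteq> c" "(b, a) \<in> T" "v \<in> side T a b" by auto
    then show "w \<in> insert b (\<Union>a \<in> T `` {b} - {c}. side T a b) \<or> v = b \<and> w = c"
    proof cases
      case 1
      then have "w \<in> side T w b \<and> (b, w) \<in> T" using vw by simp
      then show ?thesis using 1 by blast
    next
      case 2
      then show ?thesis using side_step'[OF T_sym[OF 2(2)] 2(3) vw] by auto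
    qed
  qed simp
qed

text \<open>\<open>w\<close> is the second vertex of the tree path from \<open>v\<close> to
  \<open>x\<close>; it is unique by \<open>direction_unique\<close>.\<close>

lemma ex_direction:
  assumes "v \<in> V" "x \<in> V" "x \<noteq> v"
  obtains w where "(v, w) \<in> T" "x \<in> side T w v"
proof -
  have "(v, x) \<in> T\<^sup>*" using conn_spanD(7)[OF cT] assms by blast
  then have "x = v \<or> (\<exists>w. (v, w) \<in> T \<and> x \<in> side T w v)"
  proof induction
    case (step y z)
    show ?case
    proof (cases "y = v")
      case True
      then show ?thesis using step.hyps by auto
    next
      case False
      then obtain w where w: "(v, w) \<in> T" "y \<in> side T w v" using step.IH by blast
      then show ?thesis using side_step'[OF T_sym[OF w(1)] w(2) step.hyps(2)] by auto
    qed
  qed simp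
  then show ?thesis using assms that by blast
qed

lemma direction_unique:
  assumes "(v, w) \<in> T" "(v, w') \<in> T" "x \<in> side T w v" "x \<in> side T w' v"
  shows "w = w'"
  using sides_at_disjoint[OF assms(1,2)] assms(3,4) by blast

text \<open>The new edge reconnects \<open>v\<close> and \<open>w\<close>, since \<open>x\<close>
  and \<open>y\<close> lie on their respective sides. The number of arcs does not grow, and
  \<open>span_tree\<close> demands no more.\<close>

lemma swap_span_tree:
  assumes vw: "(v, w) \<in> T" and x: "x \<in> side T v w" and y: "y \<in> side T w v" and xy: "(x, y) \<in> E"
  shows "span_tree (swap_edge T v w x y)"
proof -
  let ?S = "swap_edge T v w x y" and ?D = "del_edge T v w"
  have symS: "sym ?S" using conn_spanD(2)[OF cT] by (auto simp: swap_edge_def del_edge_def sym_def)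
  have sub: "?D\<^sup>* \<subseteq> ?S\<^sup>*" by (rule rtrancl_mono) (auto simp: swap_edge_def)
  have D: "(v, x) \<in> ?D\<^sup>*" "(w, y) \<in> ?D\<^sup>*"
    using x y unfolding side_def del_edge_commute[of T w v] mem_Collect_eq .
  note vx = subsetD[OF sub D(1)] and wy = subsetD[OF sub D(2)]
  have "(x, y) \<in> ?S" by (auto simp: swap_edge_def)
  then have "(v, w) \<in> ?S\<^sup>*"
    by (rule rtrancl_trans[OF rtrancl_into_rtrancl[OF vx] symD[OF sym_rtrancl[OF symS] wy]])
  note vw' = this symD[OF sym_rtrancl[OF symS] this]
  have "T \<subseteq> ?S\<^sup>*" using vw' by (auto simp: swap_edge_def del_edge_def)
  then have "T\<^sup>* \<subseteq> ?S\<^sup>*" by (rule rtrancl_subset_rtrancl)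
  moreover have "?S \<subseteq> E"
    using conn_spanD(1)[OF cT] xy E_sym by (auto simp: swap_edge_def del_edge_def)
  ultimately have "conn_span ?S" using symS conn_spanD(7)[OF cT] by (auto simp: conn_span_def)
  moreover have "card ?S \<le> card T"
  proof -
    have ne: "v \<noteq> w" using vw conn_spanD(5)[OF cT] by auto
    have "card ?S \<le> card ?D + card {(x, y), (y, x)}"
      unfolding swap_edge_def by (rule card_Un_le)
    moreover have "card {(x, y), (y, x)} \<le> 2" using card_length[of "[(x, y), (y, x)]"] by simp
    moreover have "card ?D = card T - 2"
      unfolding del_edge_def using vw T_sym[OF vw] ne conn_spanD(6)[OF cT]
      by (subst card_Diff_subset) auto
    moreover have "card {(v, w), (w, v)} \<le> card T"
      using vw T_sym[OF vw] conn_spanD(6)[OF cT] by (intro card_mono) auto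
    moreover have "card {(v, w), (w, v)} = 2" using ne by simp
    ultimately show ?thesis by linarith
  qed
  ultimately show ?thesis using T by (auto simp: span_tree_def)
qed

lemma val_ge_1: "v \<in> V \<Longrightarrow> V \<noteq> {v} \<Longrightarrow> 1 \<le> val T v"
proof -
  assume v: "v \<in> V" "V \<noteq> {v}"
  then obtain x where "x \<in> V" "x \<noteq> v" by blast
  then obtain w where "(v, w) \<in> T" using ex_direction v by blast
  then have "T `` {v} \<noteq> {}" by blast
  then show ?thesis using finite_nbrs[OF cT] by (simp add: val_def Suc_le_eq card_gt_0_iff)
qed

section \<open>Valencies and leaves of a spanning tree\<close>

lemma sum_val: "(\<Sum>v\<in>V. val T v) = 2 * (card V - 1)"
proof -
  have "T = Sigma V (\<lambda>v. T `` {v})" using T_verts by auto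
  then have "card T = card (Sigma V (\<lambda>v. T `` {v}))" by simp
  also have "\<dots> = (\<Sum>v\<in>V. val T v)"
    using finV finite_nbrs[OF cT] by (simp add: val_def)
  finally show ?thesis using span_treeD(2)[OF T] by simp
qed

text \<open>By \<open>sum_val\<close> the numbers val - 2 add up to -2. A leaf contributes -1 and
  every other vertex its share of the excess.\<close>

lemma card_leaves:
  assumes "2 \<le> card V"
  shows "card (leaves T) = excess T + 2"
proof -
  have ge: "1 \<le> val T v" if "v \<in> V" for v
    using val_ge_1[OF that] assms by fastforce
  \<comment> \<open>Truncated subtraction turns the -1 of a leaf into 0; the last term corrects
    this.\<close>
  have "int (val T v) - 2 = int (val T v - 2) - (if val T v = 1 then 1 else 0)" if "v \<in> V" for v
    using ge[OF that] by (auto simp: of_nat_diff)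
  then have "(\<Sum>v\<in>V. int (val T v) - 2) =
      (\<Sum>v\<in>V. int (val T v - 2) - (if val T v = 1 then 1 else 0))" by (rule sum.cong[OF refl])
  also have "\<dots> = int (excess T) - int (card (leaves T))"
    using finV by (simp add: sum_subtractf excess_def leaves_def sum.If_cases Collect_conj_eq)
  finally have *: "(\<Sum>v\<in>V. int (val T v) - 2) = int (excess T) - int (card (leaves T))" .
  have "(\<Sum>v\<in>V. int (val T v) - 2) = int (\<Sum>v\<in>V. val T v) - 2 * int (card V)"
    by (simp add: sum_subtractf)
  also have "\<dots> = -2" using sum_val assms by (simp add: of_nat_diff)
  finally show ?thesis using * by linarith
qed

lemma leafD:
  assumes "x \<in> leaves T" "(x, w) \<in> T" "(x, w') \<in> T"
  shows "w = w'"
proof -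
  have "card (T `` {x}) = 1" using assms(1) by (simp add: leaves_def val_def)
  then obtain z where "T `` {x} = {z}" by (auto simp: card_1_singleton_iff)
  moreover have "w \<in> T `` {x}" "w' \<in> T `` {x}" using assms(2,3) by auto
  ultimately show ?thesis by simp
qed

lemma side_leaf:
  assumes "x \<in> leaves T" "(x, w) \<in> T"
  shows "side T x w = {x}"
proof -
  have "T `` {x} - {w} = {}" using leafD[OF assms(1) _ assms(2)] by blast
  then show ?thesis unfolding side_decomp[OF assms(2)] by blast
qed

end

end

section \<open>Leaves of spanning trees of minimum excess in claw-free graphs\<close>

locale claw_free_graph = fin_graph +
  assumes claw: "\<And>v a b c. (v, a) \<in> E \<Longrightarrow> (v, b) \<in> E \<Longrightarrow> (v, c) \<in> E \<Longrightarrow> a \<noteq> b \<Longrightarrow> a \<noteq> c \<Longrightarrow> b \<noteq> c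
    \<Longrightarrow> (a, b) \<in> E \<or> (a, c) \<in> E \<or> (b, c) \<in> E"
begin

text \<open>The bounds cover \<open>x = v\<close> and \<open>y = w\<close>, where gain and loss at a
  vertex cancel.\<close>

lemma val_swap:
  assumes T: "span_tree T" and vw: "(v, w) \<in> T" and "x \<in> side T v w" "y \<in> side T w v"
  shows "val (swap_edge T v w x y) u \<le> val T u + (if u = x \<or> u = y then 1 else 0)"
    and "u = v \<or> u = w \<Longrightarrow> 1 \<le> val T u \<and>
      val (swap_edge T v w x y) u \<le> val T u - 1 + (if u = x \<or> u = y then 1 else 0)"
    and "\<lbrakk>u \<noteq> x; u \<noteq> y; u \<noteq> v; u \<noteq> w\<rbrakk> \<Longrightarrow> val (swap_edge T v w x y) u = val T u"
    and "u = v \<Longrightarrow> u \<noteq> x \<Longrightarrow> val (swap_edge T v w x y) u = val T u - 1"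
proof -
  have cT: "conn_span T" using span_treeD(1)[OF T] .
  have fin: "finite (T `` {u})" for u using finite_nbrs[OF cT] .
  have xy: "x \<noteq> y" and xw: "x \<noteq> w" and yv: "y \<noteq> v" and vnw: "v \<noteq> w"
    using sides_disjoint[OF T vw] assms(3,4) self_in_side[of v T w] self_in_side[of w T v] by blast+
  have wv: "(w, v) \<in> T" using vw conn_spanD(3)[OF cT] by blast
  define D where "D u = T `` {u} - (if u = v then {w} else if u = w then {v} else {})" for u
  have S: "swap_edge T v w x y `` {u} = D u \<union> (if u = x then {y} else if u = y then {x} else {})" for u
    using xy vnw by (auto simp: swap_edge_def del_edge_def D_def)
  have D: "card (D u) = val T u - (if u = v \<or> u = w then 1 else 0)" for u
    using vw wv fin by (auto simp: D_def val_def)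
  have pos: "1 \<le> val T u" if "u = v \<or> u = w" for u
  proof -
    have "T `` {u} \<noteq> {}" using that vw wv by blast
    then show ?thesis using fin[of u] by (simp add: val_def Suc_le_eq card_gt_0_iff)
  qed
  have le: "val (swap_edge T v w x y) u \<le> card (D u) + (if u = x \<or> u = y then 1 else 0)" for u
    unfolding val_def S by (rule order.trans[OF card_Un_le]) auto
  show "val (swap_edge T v w x y) u \<le> val T u + (if u = x \<or> u = y then 1 else 0)"
    using le[of u] D[of u] by linarith
  show "1 \<le> val T u \<and> val (swap_edge T v w x y) u \<le> val T u - 1 + (if u = x \<or> u = y then 1 else 0)"
    if "u = v \<or> u = w" using le[of u] D[of u] pos that by auto
  show "val (swap_edge T v w x y) u = val T u" if "u \<noteq> x" "u \<noteq> y" "u \<noteq> v" "u \<noteq> w"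
    using S[of u] D[of u] that by (simp add: val_def)
  show "val (swap_edge T v w x y) u = val T u - 1" if "u = v" "u \<noteq> x"
    using S[of u] D[of u] that yv by (simp add: val_def)
qed

lemma excess_less:
  assumes "\<And>u. u \<in> V \<Longrightarrow> val S u - 2 \<le> val T u - 2" "b \<in> V" "val S b - 2 < val T b - 2"
  shows "excess S < excess T"
  unfolding excess_def using finV assms by (intro sum_strict_mono_ex1) auto

lemma excess_le:
  assumes "\<And>u. u \<in> V \<Longrightarrow> val S u - 2 \<le> val T u - 2"
  shows "excess S \<le> excess T"
  unfolding excess_def using assms by (rule sum_mono)

lemma opt_treeI:
  assumes "opt_tree T" "span_tree S" "excess S \<le> excess T"
  shows "opt_tree S"
  using assms by (fastforce simp: opt_tree_def)

text \<open>Follow the tree from the leaf through vertices of valency two and take the largest side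
  obtained in this way. If \<open>b\<close> had valency two, the side could be extended; if
  \<open>b\<close> were a leaf, the whole tree would be a path of excess zero.\<close>

lemma leg_ends_at_branch:
  assumes T: "span_tree T" and ex: "0 < excess T" and x: "x \<in> leaves T"
  obtains a b where "(a, b) \<in> T" "x \<in> side T a b" "3 \<le> val T b" "side T a b \<inter> leaves T = {x}"
    "\<And>v. v \<in> side T a b \<Longrightarrow> val T v \<le> 2"
proof -
  note cT = span_treeD(1)[OF T]
  note Ts = conn_spanD(3)[OF cT]
  define P where "P p \<longleftrightarrow> p \<in> T \<and> x \<in> side T (fst p) (snd p) \<and> side T (fst p) (snd p) \<inter> leaves T = {x}
    \<and> (\<forall>v\<in>side T (fst p) (snd p). val T v \<le> 2)" for p
  obtain w where w: "(x, w) \<in> T"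
    using x by (auto simp: leaves_def val_def card_1_singleton_iff)
  then have "side T x w = {x}" by (rule side_leaf[OF T x])
  then have "P (x, w)" using w x by (auto simp: P_def leaves_def)
  moreover have "\<forall>p. P p \<longrightarrow> card (side T (fst p) (snd p)) < Suc (card V)"
  proof (intro allI impI)
    fix p assume "P p"
    then have "fst p \<in> V" using conn_spanD(4)[OF cT, of "fst p" "snd p"] by (simp add: P_def)
    then show "card (side T (fst p) (snd p)) < Suc (card V)"
      by (intro le_imp_less_Suc card_mono finV side_in_V[OF cT])
  qed
  ultimately obtain p where p: "P p"
    and pm: "\<And>q. P q \<Longrightarrow> card (side T (fst q) (snd q)) \<le> card (side T (fst p) (snd p))"
    using ex_has_greatest_nat[of P "(x, w)" "\<lambda>p. card (side T (fst p) (snd p))" "Suc (card V)"] by blast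
  obtain a b where [simp]: "p = (a, b)" by (cases p)
  have ab: "(a, b) \<in> T" and xs: "x \<in> side T a b" and sl: "side T a b \<inter> leaves T = {x}"
    and s2: "\<And>v. v \<in> side T a b \<Longrightarrow> val T v \<le> 2" using p by (auto simp: P_def)
  have abV: "a \<in> V" "b \<in> V" using conn_spanD(4)[OF cT ab] by auto
  have "3 \<le> val T b"
  proof (rule ccontr)
    assume "\<not> 3 \<le> val T b"
    moreover have "V \<noteq> {b}" using abV ab conn_spanD(5)[OF cT] by auto
    then have "1 \<le> val T b" using val_ge_1[OF T abV(2)] by blast
    ultimately consider "val T b = 1" | "val T b = 2" by linarith
    then show False
    proof cases
      case 1
      then have "side T b a = {b}" using abV ab Ts by (intro side_leaf[OF T]) (auto simp: leaves_def)
      then have "V \<subseteq> insert b (side T a b)" using in_one_side[OF cT ab] by blast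
      then have "val T v \<le> 2" if "v \<in> V" for v using that s2 1 by fastforce
      then have "excess T = 0" by (simp add: excess_def)
      then show False using ex by simp
    next
      case 2
      then obtain y z where yz: "T `` {b} = {y, z}" "y \<noteq> z" by (auto simp: val_def card_2_iff)
      moreover have "a \<in> T `` {b}" using Ts[OF ab] by simp
      ultimately obtain c where c: "T `` {b} = {a, c}" "c \<noteq> a" by (metis insertE insert_commute singletonD)
      have bc: "(b, c) \<in> T" using c by blast
      have dec: "side T b c = insert b (side T a b)" using side_decomp[OF T bc] c by auto
      have "P (b, c)" using bc dec xs sl s2 2 by (auto simp: P_def leaves_def)
      moreover have "card (side T b c) = Suc (card (side T a b))"
        using dec not_in_side[OF T ab] finite_subset[OF side_in_V[OF cT abV(1), of b] finV] by simp
      ultimately show False using pm[of "(b, c)"] by simp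
    qed
  qed
  then show ?thesis using that ab xs sl s2 by blast
qed

context
  fixes T assumes opt: "opt_tree T" and ex: "0 < excess T"
begin

text \<open>Otherwise detach the leg of \<open>x\<close> from its branch vertex \<open>b\<close> and
  attach it through \<open>xy\<close>. Then \<open>b\<close> loses an edge while \<open>x\<close>
  and \<open>y\<close> rise only to valency two, so the excess drops.\<close>

lemma leaves_independent:
  assumes x: "x \<in> leaves T" and y: "y \<in> leaves T"
  shows "(x, y) \<notin> E"
proof
  assume xy: "(x, y) \<in> E"
  note T = opt_treeD(1)[OF opt] and cT = opt_treeD(2)[OF opt]
  obtain a b where ab: "(a, b) \<in> T" "x \<in> side T a b" "3 \<le> val T b" "side T a b \<inter> leaves T = {x}"
    using leg_ends_at_branch[OF T ex x] by metis
  have "y \<noteq> x" using xy irrE by auto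
  then have "y \<notin> side T a b" using ab(4) y by blast
  then have ys: "y \<in> side T b a" using in_one_side[OF cT ab(1)] y by (auto simp: leaves_def)
  let ?S = "swap_edge T a b x y"
  have "span_tree ?S" using swap_span_tree[OF T ab(1,2) ys xy] .
  moreover have "excess ?S < excess T"
  proof (rule excess_less)
    have v1: "val T x = 1" "val T y = 1" using x y by (auto simp: leaves_def)
    show "val ?S u - 2 \<le> val T u - 2" for u
      using val_swap(1)[OF T ab(1,2) ys, of u] v1 by (auto split: if_splits)
    show "b \<in> V" using conn_spanD(4)[OF cT ab(1)] by blast
    show "val ?S b - 2 < val T b - 2"
      using val_swap(2)[OF T ab(1,2) ys, of b] v1 ab(3) by (auto split: if_splits)
  qed
  ultimately show False using opt_treeD(3)[OF opt, of ?S] span_treeD(1) by fastforce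
qed

end

context
  fixes T assumes opt: "opt_tree T" and ex: "0 < excess T"
begin

text \<open>Replacing \<open>vw\<close> by \<open>xw\<close> keeps the valency of \<open>w\<close>,
  raises that of the leaf \<open>x\<close> to two and takes an edge from \<open>v\<close>. By
  minimality \<open>v\<close> is no branch vertex, so it has valency two and becomes a leaf of
  another optimal tree.\<close>

lemma leaf_swap:
  assumes vw: "(v, w) \<in> T" and x: "x \<in> leaves T" "x \<in> side T v w" "x \<noteq> v" and xw: "(x, w) \<in> E"
  shows "val T v = 2" "opt_tree (swap_edge T v w x w)" "excess (swap_edge T v w x w) = excess T"
    "v \<in> leaves (swap_edge T v w x w)" "leaves T - {x} \<subseteq> leaves (swap_edge T v w x w)"
proof -
  note T = opt_treeD(1)[OF opt] and cT = opt_treeD(2)[OF opt]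
  let ?S = "swap_edge T v w x w"
  have wv: "(w, v) \<in> T" using vw conn_spanD(3)[OF cT] by blast
  have vV: "v \<in> V" "w \<in> V" using conn_spanD(4)[OF cT vw] by auto
  have vw': "v \<noteq> w" using vw conn_spanD(5)[OF cT] by blast
  have ws: "w \<in> side T w v" by simp
  have v1: "val T x = 1" using x by (auto simp: leaves_def)
  have S: "span_tree ?S" using swap_span_tree[OF T vw x(2) ws xw] .
  have le: "val ?S u - 2 \<le> val T u - 2" for u
    using val_swap(1)[OF T vw x(2) ws, of u] val_swap(2)[OF T vw x(2) ws, of w] v1
    by (auto split: if_splits)
  have n3: "\<not> 3 \<le> val T v"
  proof
    assume "3 \<le> val T v"
    then have "excess ?S < excess T"
      using val_swap(4)[OF T vw x(2) ws, of v] x(3) vV(1) by (intro excess_less[OF le]) auto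
    then show False using opt_treeD(3)[OF opt, of ?S] span_treeD(1)[OF S] by fastforce
  qed
  moreover have "val T v \<noteq> 1"
  proof
    assume "val T v = 1"
    then have "side T v w = {v}" using side_leaf[OF T _ vw] vV by (auto simp: leaves_def)
    then show False using x by blast
  qed
  moreover have "1 \<le> val T v" using val_swap(2)[OF T vw x(2) ws, of v] by auto
  ultimately show v2: "val T v = 2" by linarith
  have exS: "excess ?S \<le> excess T" using le by (rule excess_le)
  show "opt_tree ?S" using opt_treeI[OF opt S exS] .
  show "excess ?S = excess T" using exS opt_treeD(3)[OF opt span_treeD(1)[OF S]] by simp
  show "v \<in> leaves ?S"
    using val_swap(4)[OF T vw x(2) ws, of v] x(3) vV v2 by (auto simp: leaves_def)
  show "leaves T - {x} \<subseteq> leaves ?S"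
  proof
    fix u assume u: "u \<in> leaves T - {x}"
    then have "val T u = 1" "u \<in> V" by (auto simp: leaves_def)
    moreover have "u \<noteq> w" using u leaves_independent[OF opt ex x(1), of u] xw by blast
    moreover have "u \<noteq> v" using calculation v2 by auto
    ultimately show "u \<in> leaves ?S"
      using val_swap(3)[OF T vw x(2) ws, of u] u by (auto simp: leaves_def)
  qed
qed

text \<open>After the exchange \<open>v\<close> is a leaf, so it is not adjacent to another leaf.\<close>

lemma leaf_swap_nonadj:
  assumes vw: "(v, w) \<in> T" and x: "x \<in> leaves T" "x \<in> side T v w" "x \<noteq> v"
    and y: "y \<in> leaves T" "y \<noteq> x" "(v, y) \<in> E"
  shows "(x, w) \<notin> E"
proof
  assume xw: "(x, w) \<in> E"
  note sw = leaf_swap[OF vw x xw]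
  have "(v, y) \<notin> E"
    using leaves_independent[OF sw(2), of v y] sw(3-5) ex y by auto
  then show False using y by blast
qed

lemma branch_nonadj:
  assumes "(v, w) \<in> T" "x \<in> leaves T" "x \<in> side T v w" "x \<noteq> v" "3 \<le> val T v"
  shows "(x, w) \<notin> E"
  using leaf_swap(1)[OF assms(1-4)] assms(5) by fastforce

text \<open>Otherwise \<open>v\<close> is the centre of a claw with ends \<open>x\<close>,
  \<open>y\<close>, \<open>w\<close>: leaves are not adjacent, and neither leaf is adjacent to
  \<open>w\<close> by \<open>leaf_swap_nonadj\<close>.\<close>

lemma two_leaves_directions:
  assumes x: "x \<in> leaves T" "(v, x) \<in> E" and y: "y \<in> leaves T" "(v, y) \<in> E" "x \<noteq> y"
    and vw: "(v, w) \<in> T"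
  shows "x \<in> side T w v \<or> y \<in> side T w v"
proof (rule ccontr)
  assume *: "\<not> (x \<in> side T w v \<or> y \<in> side T w v)"
  note T = opt_treeD(1)[OF opt] and cT = opt_treeD(2)[OF opt]
  have xV: "x \<in> V" "y \<in> V" using x y by (auto simp: leaves_def)
  have nv: "x \<noteq> v" "y \<noteq> v" using x y irrE by auto
  have s: "x \<in> side T v w" "y \<in> side T v w" using * in_one_side[OF cT vw] xV by blast+
  have nw: "w \<noteq> x" "w \<noteq> y" using * by auto
  have "(x, w) \<notin> E" using leaf_swap_nonadj[OF vw x(1) s(1) nv(1) y(1)] y by auto
  moreover have "(y, w) \<notin> E" using leaf_swap_nonadj[OF vw y(1) s(2) nv(2) x(1)] x y by auto
  moreover have "(x, y) \<notin> E" using leaves_independent[OF opt ex x(1) y(1)] .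
  moreover have "(v, w) \<in> E" using vw conn_spanD(1)[OF cT] by blast
  ultimately show False using claw[OF x(2) y(2), of w] nw y(3) by auto
qed

text \<open>A third tree edge at \<open>v\<close> would lead to neither leaf.\<close>

lemma two_leaves_no_branch:
  assumes x: "x \<in> leaves T" "(v, x) \<in> E" and y: "y \<in> leaves T" "(v, y) \<in> E" "x \<noteq> y" and "3 \<le> val T v"
  shows False
proof -
  note T = opt_treeD(1)[OF opt] and cT = opt_treeD(2)[OF opt]
  have nv: "x \<noteq> v" "y \<noteq> v" using x y irrE by auto
  have V: "v \<in> V" "x \<in> V" "y \<in> V" using x E_verts by (auto simp: y(1)[unfolded leaves_def, simplified])
  obtain a where a: "(v, a) \<in> T" "x \<in> side T a v" using ex_direction[OF T V(1,2) nv(1)] by metis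
  obtain b where b: "(v, b) \<in> T" "y \<in> side T b v" using ex_direction[OF T V(1,3) nv(2)] by metis
  have "\<not> T `` {v} \<subseteq> {a, b}"
  proof
    assume "T `` {v} \<subseteq> {a, b}"
    then have "val T v \<le> card {a, b}" unfolding val_def by (intro card_mono) auto
    also have "\<dots> \<le> 2" by (simp add: card_insert_if)
    finally show False using assms(6) by simp
  qed
  then obtain c where c: "(v, c) \<in> T" "c \<noteq> a" "c \<noteq> b" by auto
  show False
    using two_leaves_directions[OF x y c(1)] direction_unique[OF T c(1) a(1)] a(2)
      direction_unique[OF T c(1) b(1)] b(2) c by blast
qed

text \<open>Being adjacent to a leaf, \<open>v\<close> is not a leaf itself. So it has another tree
  edge, which leads to neither \<open>x\<close> nor \<open>y\<close>. This excludes blocking an edge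
  twice from the same end.\<close>

lemma two_leaves_same_direction:
  assumes x: "x \<in> leaves T" "(v, x) \<in> E" and y: "y \<in> leaves T" "(v, y) \<in> E" "x \<noteq> y"
    and vw: "(v, w) \<in> T" "x \<in> side T w v" "y \<in> side T w v"
  shows False
proof -
  note T = opt_treeD(1)[OF opt] and cT = opt_treeD(2)[OF opt]
  have "v \<notin> leaves T" using leaves_independent[OF opt ex _ x(1)] x(2) by blast
  moreover have "v \<in> V" using x E_verts by blast
  ultimately have "T `` {v} \<noteq> {w}" by (auto simp: leaves_def val_def)
  then obtain c where c: "(v, c) \<in> T" "c \<noteq> w" using vw(1) by auto
  then show False
    using two_leaves_directions[OF x y c(1)] direction_unique[OF T c(1) vw(1)] vw(2,3) by blast
qed

text \<open>This excludes blocking from opposite ends: the exchange of \<open>wv\<close> for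
  \<open>xv\<close> would turn \<open>w\<close> into a leaf adjacent to the leaf
  \<open>y\<close>.\<close>

lemma edge_blocked_once:
  assumes vw: "(v, w) \<in> T" and x: "x \<in> leaves T" "x \<in> side T w v" "(v, x) \<in> E"
    and y: "y \<in> leaves T" "y \<in> side T v w" "(w, y) \<in> E"
  shows False
proof -
  note T = opt_treeD(1)[OF opt] and cT = opt_treeD(2)[OF opt]
  have wv: "(w, v) \<in> T" using vw conn_spanD(3)[OF cT] by blast
  have "y \<noteq> x" using sides_disjoint[OF T vw] x y by blast
  show False
  proof (cases "x = w")
    case True
    then show False using leaves_independent[OF opt ex x(1) y(1)] y(3) by blast
  next
    case False
    then show False
      using leaf_swap_nonadj[OF wv x(1,2) False y(1) \<open>y \<noteq> x\<close> y(3)] x(3) E_sym by blast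
  qed
qed

text \<open>
  A leaf \<open>x\<close> and a neighbour \<open>v\<close> of \<open>x\<close> block the tree edge that leads from \<open>v\<close> towards \<open>x\<close>.
  Every edge is blocked at most once, so the degree sum of the leaves is the number of blocked edges.
\<close>

definition unblocked :: "'a \<Rightarrow> 'a \<Rightarrow> bool" where
  "unblocked v w \<longleftrightarrow> (v, w) \<in> T \<and> (\<forall>x\<in>leaves T. (x \<in> side T w v \<longrightarrow> (v, x) \<notin> E) \<and> (x \<in> side T v w \<longrightarrow> (w, x) \<notin> E))"

text \<open>Pairs of a leaf and a neighbour inject into the tree edges and miss those given by
  \<open>K\<close> and \<open>q\<close>. Edges are doubletons here because they can be blocked from
  either end.\<close>

lemma leaf_degree_sum:
  assumes K: "finite K" "inj_on (\<lambda>k. {k, q k}) K" "\<And>k. k \<in> K \<Longrightarrow> unblocked k (q k)"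
  shows "(\<Sum>x\<in>leaves T. val E x) + card K \<le> card V - 1"
proof -
  note T = opt_treeD(1)[OF opt] and cT = opt_treeD(2)[OF opt]
  have finL: "finite (leaves T)" using finV by (simp add: leaves_def)
  have finN: "finite (E `` {x})" for x using finE by (simp add: finite_Image)
  define U where "U = (\<lambda>(u, v). {u, v}) ` T"
  define P where "P = Sigma (leaves T) (\<lambda>x. E `` {x})"
  have "\<exists>w. (v, w) \<in> T \<and> x \<in> side T w v" if "(x, v) \<in> P" for x v
  proof -
    have "(x, v) \<in> E" using that by (auto simp: P_def)
    then show ?thesis using ex_direction[OF T, of v x] E_verts irrE by metis
  qed
  then obtain dir where dir: "\<And>x v. (x, v) \<in> P \<Longrightarrow> (v, dir x v) \<in> T \<and> x \<in> side T (dir x v) v" by metis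
  define f where "f = (\<lambda>(x, v). {v, dir x v})"
  have "inj_on f P"
  proof (rule inj_onI)
    fix p p' assume p: "p \<in> P" "p' \<in> P" and eq: "f p = f p'"
    obtain x v x' v' where pp: "p = (x, v)" "p' = (x', v')" by (cases p, cases p')
    have x: "x \<in> leaves T" "(v, x) \<in> E" "x' \<in> leaves T" "(v', x') \<in> E"
      using p pp E_sym by (auto simp: P_def)
    have d: "(v, dir x v) \<in> T" "x \<in> side T (dir x v) v" "(v', dir x' v') \<in> T" "x' \<in> side T (dir x' v') v'"
      using dir p pp by auto
    from eq consider "v = v'" "dir x v = dir x' v'" | "v = dir x' v'" "v' = dir x v"
      by (auto simp: f_def pp doubleton_eq_iff)
    then show "p = p'"
    proof cases
      case 1
      then show ?thesis using two_leaves_same_direction[OF x(1,2,3) _ _ d(1,2)] x d pp by fastforce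
    next
      case 2
      then show ?thesis using edge_blocked_once[OF d(1) x(1) d(2) x(2,3)] x d by metis
    qed
  qed
  moreover have "f ` P \<subseteq> U - (\<lambda>k. {k, q k}) ` K"
  proof
    fix e assume "e \<in> f ` P"
    then obtain x v where p: "(x, v) \<in> P" and e: "e = {v, dir x v}" by (auto simp: f_def)
    have x: "x \<in> leaves T" "(v, x) \<in> E" using p E_sym by (auto simp: P_def)
    note d = dir[OF p]
    have "e \<in> U" using d by (auto simp: U_def e)
    moreover have "e \<noteq> {k, q k}" if "k \<in> K" for k
      using K(3)[OF that] d x by (auto simp: e unblocked_def doubleton_eq_iff)
    ultimately show "e \<in> U - (\<lambda>k. {k, q k}) ` K" by blast
  qed
  moreover have finU: "finite U" using conn_spanD(6)[OF cT] by (simp add: U_def)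
  ultimately have "card P \<le> card (U - (\<lambda>k. {k, q k}) ` K)"
    by (metis card_inj_on_le finite_Diff)
  also have "\<dots> = card U - card K"
  proof -
    have "(\<lambda>k. {k, q k}) ` K \<subseteq> U" using K(3) by (auto simp: U_def unblocked_def)
    then show ?thesis using K(1,2) by (simp add: card_Diff_subset card_image)
  qed
  finally have cP: "card P \<le> card U - card K" .
  have KU: "card K \<le> card U"
  proof -
    have "(\<lambda>k. {k, q k}) ` K \<subseteq> U" using K(3) by (auto simp: U_def unblocked_def)
    then show ?thesis using K(2) finU by (metis card_image card_mono)
  qed
  have "2 * card U \<le> card T"
  proof -
    have "card T = (\<Sum>e\<in>U. card {p\<in>T. (\<lambda>(u, v). {u, v}) p = e})"
      using sum.image_gen[OF conn_spanD(6)[OF cT], of "\<lambda>_. 1 :: nat" "\<lambda>(u, v). {u, v}"]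
      by (simp add: U_def)
    also have "\<dots> \<ge> (\<Sum>e\<in>U. 2)"
    proof (rule sum_mono)
      fix e assume "e \<in> U"
      then obtain u v where uv: "(u, v) \<in> T" "e = {u, v}" by (auto simp: U_def)
      have "u \<noteq> v" using uv(1) conn_spanD(5)[OF cT] by blast
      then have "2 = card {(u, v), (v, u)}" by simp
      also have "\<dots> \<le> card {p\<in>T. (\<lambda>(u, v). {u, v}) p = e}"
        using uv conn_spanD(3,6)[OF cT] by (intro card_mono) auto
      finally show "2 \<le> card {p\<in>T. (\<lambda>(u, v). {u, v}) p = e}" .
    qed
    finally show ?thesis by simp
  qed
  then have "card U \<le> card V - 1" using span_treeD(2)[OF T] by simp
  moreover have "card P = (\<Sum>x\<in>leaves T. val E x)" using finL finN by (simp add: P_def val_def)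
  ultimately show ?thesis using cP KU by linarith
qed

text \<open>The condition on \<open>q\<close> says that the edge \<open>kq\<close> leads from
  \<open>k\<close> towards the root \<open>r\<close>. Such an edge is determined by
  \<open>k\<close>, which yields the injectivity.\<close>

lemma leaf_degree_sum_rooted:
  assumes finK: "finite K" and r: "r \<in> V"
    and K: "\<And>k. k \<in> K \<Longrightarrow> \<exists>q. unblocked k q \<and> r \<notin> side T k q"
  shows "(\<Sum>x\<in>leaves T. val E x) + card K \<le> card V - 1"
proof -
  obtain q where q: "\<And>k. k \<in> K \<Longrightarrow> unblocked k (q k) \<and> r \<notin> side T k (q k)"
    using K by metis
  show ?thesis
  proof (rule leaf_degree_sum[OF finK])
    show "unblocked k (q k)" if "k \<in> K" for k using q[OF that] by simp
    show "inj_on (\<lambda>k. {k, q k}) K"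
    proof (rule inj_onI, rule ccontr)
      fix k k' assume k: "k \<in> K" "k' \<in> K" and eq: "{k, q k} = {k', q k'}" and "k \<noteq> k'"
      then have "q k = k'" "q k' = k" by (auto simp: doubleton_eq_iff)
      then have "(k', k) \<in> T" "r \<notin> side T k k'" "r \<notin> side T k' k"
        using q[OF k(1)] q[OF k(2)] by (auto simp: unblocked_def)
      then show False using in_one_side[OF opt_treeD(2)[OF opt] _ r] by blast
    qed
  qed
qed

text \<open>To identify the two sides it suffices to exhibit a set \<open>D\<close> that can be left
  only through \<open>kq\<close>: the side of \<open>k\<close> lies inside \<open>D\<close> and that
  of \<open>q\<close> outside.\<close>

lemma unblockedI:
  assumes kq: "(k, q) \<in> T" "k \<in> D" "q \<notin> D" and D: "\<And>v w. v \<in> D \<Longrightarrow> (v, w) \<in> T \<Longrightarrow> w \<in> D \<or> v = k \<and> w = q"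
    and k: "\<And>x. x \<in> leaves T \<Longrightarrow> x \<notin> D \<Longrightarrow> (k, x) \<notin> E"
    and q: "\<And>x. x \<in> leaves T \<Longrightarrow> x \<in> D \<Longrightarrow> (q, x) \<notin> E"
  shows "unblocked k q \<and> side T k q \<subseteq> D"
proof -
  note cT = opt_treeD(2)[OF opt]
  have "side T k q \<subseteq> D" using side_subset[of k D T q] kq D by blast
  moreover have "side T q k \<subseteq> - D"
  proof (rule side_subset)
    fix v w assume "v \<in> - D" "(v, w) \<in> T"
    then show "w \<in> - D \<or> v = q \<and> w = k" using D[of w v] conn_spanD(3)[OF cT] by blast
  qed (use kq in simp)
  ultimately show ?thesis using kq k q by (auto simp: unblocked_def)
qed

text \<open>Root the tree at a branch vertex \<open>r\<close>. A branch vertex \<open>b\<close> has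
  val - 1 edges to children, the root one more. At most one of them is blocked: by
  \<open>branch_nonadj\<close> only from \<open>b\<close>, and two blocking leaves would be two leaf
  neighbours of a branch vertex. So val - 2 edges remain at each branch vertex and an extra one at
  the root.\<close>

lemma leaf_degree_sum_excess:
  "(\<Sum>x\<in>leaves T. val E x) + (excess T + 1) \<le> card V - 1"
proof -
  note T = opt_treeD(1)[OF opt] and cT = opt_treeD(2)[OF opt]
  have sym: "(u, v) \<in> T \<Longrightarrow> (v, u) \<in> T" for u v using conn_spanD(3)[OF cT] .
  have "\<exists>r\<in>V. 0 < val T r - 2"
    using ex sum.neutral[of V "\<lambda>v. val T v - 2"] by (fastforce simp: excess_def)
  then obtain r where r: "r \<in> V" "3 \<le> val T r" by fastforce
  define B where "B = branches T"
  have finB: "finite B" and rB: "r \<in> B" using finV r by (auto simp: B_def branches_def)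
  \<comment> \<open>\<open>C b\<close> is the set of children of \<open>b\<close>; an edge to a
    child is named by the child.\<close>
  define C where "C b = {a. (b, a) \<in> T \<and> r \<notin> side T a b}" for b
  define C' where "C' b = {a \<in> C b. unblocked a b}" for b
  have finC: "finite (C b)" for b
    using finite_nbrs[OF cT, of b] by (rule rev_finite_subset) (auto simp: C_def)
  have cardC: "val T b \<le> card (C b) + (if b = r then 0 else 1)" if "b \<in> B" for b
  proof (cases "b = r")
    case True
    have "r \<notin> side T a r" if "(r, a) \<in> T" for a using not_in_side[OF T sym[OF that]] .
    then have "C b = T `` {b}" using True by (auto simp: C_def)
    then show ?thesis using True by (simp add: val_def)
  next
    case False
    have bV: "b \<in> V" using that by (simp add: B_def branches_def)
    obtain w where w: "(b, w) \<in> T" "r \<in> side T w b" using ex_direction[OF T bV r(1)] False by metis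
    have "T `` {b} \<subseteq> insert w (C b)" using direction_unique[OF T w(1) _ w(2)] by (auto simp: C_def)
    then have "val T b \<le> card (insert w (C b))" unfolding val_def by (intro card_mono) (use finC in auto)
    also have "\<dots> \<le> Suc (card (C b))" using finC by (simp add: card_insert_if)
    finally show ?thesis using False by simp
  qed
  have blocked: "\<exists>x\<in>leaves T. x \<in> side T a b \<and> (b, x) \<in> E" if "b \<in> B" "a \<in> C b - C' b" for a b
  proof -
    have ab: "(b, a) \<in> T" "\<not> unblocked a b" "(a, b) \<in> T" using that sym by (auto simp: C_def C'_def)
    moreover have "(a, x) \<notin> E" if x: "x \<in> leaves T" "x \<in> side T b a" for x
    proof -
      have "3 \<le> val T b" using \<open>b \<in> B\<close> by (simp add: B_def branches_def)
      moreover then have "x \<noteq> b" using x by (auto simp: leaves_def)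
      ultimately show ?thesis using branch_nonadj[OF ab(1) x(1,2)] E_sym by blast
    qed
    ultimately show ?thesis unfolding unblocked_def by blast
  qed
  have cardC': "card (C b) \<le> card (C' b) + 1" if b: "b \<in> B" for b
  proof -
    have "a = a'" if a: "a \<in> C b - C' b" "a' \<in> C b - C' b" for a a'
    proof (rule ccontr)
      assume ne: "a \<noteq> a'"
      obtain x where x: "x \<in> leaves T" "x \<in> side T a b" "(b, x) \<in> E" using blocked[OF b a(1)] by blast
      obtain y where y: "y \<in> leaves T" "y \<in> side T a' b" "(b, y) \<in> E" using blocked[OF b a(2)] by blast
      have "(b, a) \<in> T" "(b, a') \<in> T" using a by (auto simp: C_def)
      then have "x \<noteq> y" using sides_at_disjoint[OF T _ _ ne, of b] x y by blast
      then show False using two_leaves_no_branch[OF x(1,3) y(1,3)] b by (simp add: B_def branches_def)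
    qed
    then have "card (C b - C' b) \<le> 1" using finC by (simp add: card_le_Suc0_iff_eq)
    moreover have "card (C b) = card (C' b) + card (C b - C' b)"
    proof -
      have "C b = C' b \<union> (C b - C' b)" by (auto simp: C'_def)
      moreover have "finite (C' b)" using finC by (simp add: C'_def)
      ultimately show ?thesis using finC card_Un_disjoint[of "C' b" "C b - C' b"] by auto
    qed
    ultimately show ?thesis by simp
  qed
  define K where "K = (\<Union>b\<in>B. C' b)"
  have par: "b = b'" if "a \<in> C b" "a \<in> C b'" for a b b'
  proof -
    have "(a, b) \<in> T" "(a, b') \<in> T" "r \<in> side T b a" "r \<in> side T b' a"
      using that sym in_one_side[OF cT _ r(1)] by (auto simp: C_def)
    then show ?thesis using direction_unique[OF T] by blast
  qed
  have "finite (C' b)" for b using finC by (simp add: C'_def)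
  then have finK: "finite K" using finB by (simp add: K_def)
  have "(\<Sum>x\<in>leaves T. val E x) + card K \<le> card V - 1"
    by (rule leaf_degree_sum_rooted[OF finK r(1)]) (auto simp: K_def C'_def C_def)
  moreover have "excess T + 1 \<le> card K"
  proof -
    have "card K = (\<Sum>b\<in>B. card (C' b))" unfolding K_def
    proof (rule card_UN_disjoint[OF finB])
      show "\<forall>b\<in>B. finite (C' b)" using finC by (simp add: C'_def)
      show "\<forall>b\<in>B. \<forall>b'\<in>B. b \<noteq> b' \<longrightarrow> C' b \<inter> C' b' = {}" using par by (auto simp: C'_def)
    qed
    also have "\<dots> \<ge> (\<Sum>b\<in>B. val T b - 2 + (if b = r then 1 else 0))"
    proof (rule sum_mono)
      fix b assume b: "b \<in> B"
      then have "3 \<le> val T b" by (simp add: B_def branches_def)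
      then show "val T b - 2 + (if b = r then 1 else 0) \<le> card (C' b)"
        using cardC[OF b] cardC'[OF b] by (auto split: if_splits)
    qed
    also have "(\<Sum>b\<in>B. val T b - 2 + (if b = r then 1 else 0)) = (\<Sum>b\<in>B. val T b - 2) + 1"
      using finB rB by (simp add: sum.distrib)
    also have "(\<Sum>b\<in>B. val T b - 2) = excess T"
      unfolding excess_def by (rule sum.mono_neutral_left) (use finV in \<open>auto simp: B_def branches_def\<close>)
    finally show ?thesis .
  qed
  ultimately show ?thesis by linarith
qed

end

end

section \<open>Subgraphs given by lists of paths\<close>

definition list_edges :: "'a list \<Rightarrow> 'a rel" where
  "list_edges xs = set (zip xs (tl xs))"

definition lists_rel :: "'a list list \<Rightarrow> 'a rel" where
  "lists_rel xss = (\<Union>xs\<in>set xss. list_edges xs \<union> (list_edges xs)\<inverse>)"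

text \<open>Each list starts at a vertex met before, which makes the union of the paths
  connected.\<close>

fun linked :: "'a set \<Rightarrow> 'a list list \<Rightarrow> bool" where
  "linked A [] \<longleftrightarrow> True"
| "linked A (xs # xss) \<longleftrightarrow> xs \<noteq> [] \<and> hd xs \<in> A \<and> linked (A \<union> set xs) xss"

lemma list_edges_simps [simp]:
  "list_edges [] = {}" "list_edges [x] = {}"
  "list_edges (x # y # zs) = insert (x, y) (list_edges (y # zs))"
  by (simp_all add: list_edges_def)

lemma list_edges_append:
  "list_edges (xs @ ys) = list_edges xs \<union> list_edges ys \<union>
    (if xs = [] \<or> ys = [] then {} else {(last xs, hd ys)})"
proof (induction xs)
  case (Cons x xs)
  then show ?case by (cases xs; cases ys) auto
qed simp

lemma list_edges_in_set: "(u, v) \<in> list_edges xs \<Longrightarrow> u \<in> set xs \<and> v \<in> set xs"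
  by (induction xs rule: induct_list012) auto

lemma finite_list_edges [simp]: "finite (list_edges xs)"
  by (simp add: list_edges_def)

lemma card_list_edges: "card (list_edges xs) \<le> length xs - 1"
  unfolding list_edges_def by (rule order.trans[OF card_length]) simp

lemma sym_lists_rel: "sym (lists_rel xss)"
  by (auto simp: lists_rel_def sym_def)

lemma lists_rel_Cons: "lists_rel (xs # xss) = list_edges xs \<union> (list_edges xs)\<inverse> \<union> lists_rel xss"
  by (simp add: lists_rel_def)

lemma card_lists_rel: "card (lists_rel xss) \<le> 2 * (\<Sum>xs\<leftarrow>xss. length xs - 1)"
proof (induction xss)
  case (Cons xs xss)
  have "card (lists_rel (xs # xss)) \<le> card (list_edges xs \<union> (list_edges xs)\<inverse>) + card (lists_rel xss)"
    unfolding lists_rel_Cons by (rule card_Un_le)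
  moreover have "card (list_edges xs \<union> (list_edges xs)\<inverse>) \<le> card (list_edges xs) + card ((list_edges xs)\<inverse>)"
    by (rule card_Un_le)
  ultimately show ?case using Cons.IH card_list_edges[of xs] by simp
qed (simp add: lists_rel_def)

text \<open>An occurrence of \<open>v\<close> has a successor unless it is the last entry, and a
  predecessor unless it is the first. Thus valencies are bounded by counts of list entries, which
  simplification can add up.\<close>

lemma val_list_edges:
  "card (list_edges xs `` {v}) \<le> count_list (butlast xs) v"
  "card ((list_edges xs)\<inverse> `` {v}) \<le> count_list (tl xs) v"
proof (induction xs rule: induct_list012)
  case (3 x y zs)
  {
    case 1
    have *: "list_edges (x # y # zs) `` {v} = list_edges (y # zs) `` {v} \<union> (if x = v then {y} else {})" by auto
    show ?case unfolding * using 3(3) by (cases "x = v") (auto intro: order.trans[OF card_insert_le_m1] simp: card_insert_if)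
  next
    case 2
    have *: "(list_edges (x # y # zs))\<inverse> `` {v} = (list_edges (y # zs))\<inverse> `` {v} \<union> (if y = v then {x} else {})" by auto
    show ?case unfolding * using 3(4) by (cases "y = v") (auto simp: card_insert_if)
  }
qed auto

lemma val_lists_rel: "val (lists_rel xss) v \<le> (\<Sum>xs\<leftarrow>xss. count_list (butlast xs) v + count_list (tl xs) v)"
proof (induction xss)
  case (Cons xs xss)
  have "lists_rel (xs # xss) `` {v} = list_edges xs `` {v} \<union> (list_edges xs)\<inverse> `` {v} \<union> lists_rel xss `` {v}"
    by (auto simp: lists_rel_Cons)
  then have "val (lists_rel (xs # xss)) v
      \<le> card (list_edges xs `` {v}) + card ((list_edges xs)\<inverse> `` {v}) + val (lists_rel xss) v"
    unfolding val_def by (metis (no_types, lifting) add_le_cancel_right card_Un_le order.trans)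
  then show ?case using Cons.IH val_list_edges[of xs v] by simp
qed (simp add: lists_rel_def val_def)

lemma list_edges_reach:
  assumes "xs \<noteq> []" "v \<in> set xs" "list_edges xs \<subseteq> R"
  shows "(hd xs, v) \<in> R\<^sup>*"
  using assms
proof (induction xs rule: induct_list012)
  case (3 x y zs)
  show ?case
  proof (cases "v = x")
    case False
    then have "(y, v) \<in> R\<^sup>*" "(x, y) \<in> R" using 3 by auto
    then show ?thesis by (auto intro: converse_rtrancl_into_rtrancl)
  qed simp
qed auto

lemma linked_reach:
  assumes "linked A xss" "\<And>a. a \<in> A \<Longrightarrow> (r, a) \<in> R\<^sup>*" "lists_rel xss \<subseteq> R" "v \<in> A \<union> \<Union>(set ` set xss)"
  shows "(r, v) \<in> R\<^sup>*"
  using assms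
proof (induction A xss rule: linked.induct)
  case (2 A xs xss)
  show ?case
  proof (rule "2.IH")
    show "linked (A \<union> set xs) xss" using 2 by simp
    show "lists_rel xss \<subseteq> R" "v \<in> A \<union> set xs \<union> \<Union>(set ` set xss)"
      using 2 by (auto simp: lists_rel_Cons)
    fix a assume "a \<in> A \<union> set xs"
    moreover have "(r, a) \<in> R\<^sup>*" if "a \<in> set xs"
    proof -
      have "(r, hd xs) \<in> R\<^sup>*" using 2 by simp
      moreover have "(hd xs, a) \<in> R\<^sup>*"
        using 2(2,4) that by (intro list_edges_reach) (auto simp: lists_rel_Cons)
      ultimately show ?thesis by simp
    qed
    ultimately show "(r, a) \<in> R\<^sup>*" using 2 by blast
  qed
qed auto

text \<open>\<open>D\<close> splits only one of the lists, into a part outside followed by a part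
  inside. So \<open>D\<close> can be left only through the edge from \<open>k\<close> to
  \<open>last U\<close>.\<close>

lemma lists_rel_cut:
  assumes xs: "U @ k # W \<in> set xss" "U \<noteq> []" "set (k # W) \<subseteq> D" "set U \<inter> D = {}"
    and others: "\<And>ys. ys \<in> set xss \<Longrightarrow> ys \<noteq> U @ k # W \<Longrightarrow> set ys \<subseteq> D \<or> set ys \<inter> D = {}"
    and vw: "v \<in> D" "(v, w) \<in> lists_rel xss"
  shows "w \<in> D \<or> v = k \<and> w = last U"
proof -
  obtain ys where ys: "ys \<in> set xss" "(v, w) \<in> list_edges ys \<or> (w, v) \<in> list_edges ys"
    using vw by (auto simp: lists_rel_def)
  show ?thesis
  proof (cases "ys = U @ k # W")
    case True
    then show ?thesis
      using ys(2) xs(2-4) vw(1) by (auto simp: list_edges_append dest!: list_edges_in_set)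
  next
    case False
    then show ?thesis using others[OF ys(1)] ys(2) vw(1) list_edges_in_set by fast
  qed
qed

lemma count_list_distinct: "distinct xs \<Longrightarrow> count_list xs v = (if v \<in> set xs then 1 else 0)"
  by (induction xs) auto

lemma count_list_butlast:
  "distinct xs \<Longrightarrow> xs \<noteq> [] \<Longrightarrow> count_list (butlast xs) v = (if v \<in> set xs \<and> v \<noteq> last xs then 1 else 0)"
  using count_list_distinct[of "butlast xs" v] append_butlast_last_id[of xs] distinct_append[of "butlast xs" "[last xs]"]
    set_append[of "butlast xs" "[last xs]"] distinct_butlast[of xs] by auto

lemma count_list_butlast_le: "count_list (butlast xs) v \<le> count_list xs v"
  by (induction xs) auto

context fin_graph
begin

definition path :: "'a list \<Rightarrow> bool" where
  "path xs \<longleftrightarrow> successively (\<lambda>x y. (x, y) \<in> E) xs"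

lemma E_commute: "(u, v) \<in> E \<longleftrightarrow> (v, u) \<in> E"
  using E_sym by blast

lemma path_simps [simp]:
  "path []" "path [x]"
  "path (x # y # zs) \<longleftrightarrow> (x, y) \<in> E \<and> path (y # zs)"
  by (simp_all add: path_def)

lemma path_Cons: "path (x # xs) \<longleftrightarrow> xs = [] \<or> (x, hd xs) \<in> E \<and> path xs"
  by (cases xs) auto

lemma path_append: "path (xs @ ys) \<longleftrightarrow> path xs \<and> path ys \<and> (xs = [] \<or> ys = [] \<or> (last xs, hd ys) \<in> E)"
  by (auto simp: path_def successively_append_iff)

lemma path_rev [simp]: "path (rev xs) = path xs"
  unfolding path_def successively_rev using E_commute by simp

lemma list_edges_path: "path xs \<Longrightarrow> list_edges xs \<subseteq> E"
  by (induction xs rule: induct_list012) auto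

text \<open>Enumerations of \<open>V\<close> without repetition are stated as equations of
  multisets, since these are insensitive to cutting, reversing and reordering the lists; each
  exchange can then verify them by simplification.\<close>

lemma mset_verts:
  assumes "mset xs = mset_set V"
  shows "set xs = V" "distinct xs"
proof -
  have "set_mset (mset xs) = set_mset (mset_set V)" by (simp only: assms)
  then show "set xs = V" using finV by simp
  have "size (mset xs) = card V" by (simp add: assms)
  then show "distinct xs" using \<open>set xs = V\<close> by (simp add: card_distinct)
qed

lemma conn_span_lists:
  assumes "\<And>xs. xs \<in> set xss \<Longrightarrow> path xs" "linked {r} xss" "r \<in> V" "V \<subseteq> insert r (\<Union>(set ` set xss))"
  shows "conn_span (lists_rel xss)"
proof -
  let ?R = "lists_rel xss"
  have "?R \<subseteq> E" using assms(1) list_edges_path E_sym by (fastforce simp: lists_rel_def)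
  moreover have reach: "(r, v) \<in> ?R\<^sup>*" if "v \<in> V" for v
    by (rule linked_reach[OF assms(2)]) (use that assms(4) in auto)
  have "(u, v) \<in> ?R\<^sup>*" if "u \<in> V" "v \<in> V" for u v
    using rtrancl_trans[OF symD[OF sym_rtrancl[OF sym_lists_rel] reach[OF that(1)]] reach[OF that(2)]] .
  ultimately show ?thesis using sym_lists_rel by (auto simp: conn_span_def)
qed

lemma linked_arms: "h \<in> A \<Longrightarrow> linked (A \<union> \<Union>(set ` set (map ((#) h) Ys))) zss \<Longrightarrow> linked A (map ((#) h) Ys @ zss)"
  by (induction Ys arbitrary: A) (auto simp: Un_assoc insert_absorb)

lemma count_arms:
  assumes "v \<noteq> h"
  shows "(\<Sum>xs\<leftarrow>map ((#) h) Ys. count_list (butlast xs) v + count_list (tl xs) v) \<le> 2 * count_list (concat Ys) v"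
proof (induction Ys)
  case (Cons Y Ys)
  show ?case using Cons assms count_list_butlast_le[of Y v] by (auto simp: count_list_append)
qed simp

text \<open>
  A path between two hubs, with further paths (arms) attached to the hubs, has no branch vertex
  other than the hubs.
\<close>

lemma two_hubs:
  assumes paths: "path (u # M @ [w])" "\<And>Y. Y \<in> set Ys \<Longrightarrow> path (u # Y)" "\<And>Z. Z \<in> set Zs \<Longrightarrow> path (w # Z)"
    and V: "mset (u # w # M @ concat Ys @ concat Zs) = mset_set V"
  shows "\<exists>H. conn_span H \<and> card (branches H) \<le> 2"
proof -
  define xss where "xss = (u # M @ [w]) # map ((#) u) Ys @ map ((#) w) Zs"
  note sV = mset_verts[OF V]
  have "conn_span (lists_rel xss)"
  proof (rule conn_span_lists)
    show "path xs" if "xs \<in> set xss" for xs using that paths by (auto simp: xss_def)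
    show "linked {u} xss"
      using linked_arms[of w _ Zs "[]"] by (auto simp: xss_def intro!: linked_arms)
    show "u \<in> V" using sV(1) by auto
    show "V \<subseteq> insert u (\<Union>(set ` set xss))" using sV(1) by (auto simp: xss_def)
  qed
  moreover have "branches (lists_rel xss) \<subseteq> {u, w}"
  proof
    fix v assume v: "v \<in> branches (lists_rel xss)"
    show "v \<in> {u, w}"
    proof (rule ccontr)
      assume "v \<notin> {u, w}"
      then have nv: "v \<noteq> u" "v \<noteq> w" "u \<noteq> v" "w \<noteq> v" by auto
      have "count_list (u # w # M @ concat Ys @ concat Zs) v \<le> 1"
        using sV(2) by (simp add: distinct_count_atmost_1 count_mset[symmetric] del: count_mset)
      then have c: "count_list M v + count_list (concat Ys) v + count_list (concat Zs) v \<le> 1"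
        using nv by (auto simp: count_list_append split: if_splits)
      \<comment> \<open>An entry other than a hub contributes at most two edges, and
        \<open>v\<close> occurs at most once.\<close>
      have "(\<Sum>xs\<leftarrow>xss. count_list (butlast xs) v + count_list (tl xs) v)
          \<le> 2 * (count_list M v + count_list (concat Ys) v + count_list (concat Zs) v)"
        using count_arms[of v u Ys] count_arms[of v w Zs] nv
        by (simp add: xss_def butlast_append count_list_append)
      then have "val (lists_rel xss) v \<le> 2 * 1"
        by (rule order.trans[OF val_lists_rel order.trans[OF _ mult_le_mono2[OF c]]])
      then show False using v by (simp add: branches_def)
    qed
  qed
  then have "card (branches (lists_rel xss)) \<le> card {u, w}" by (intro card_mono) auto
  then have "card (branches (lists_rel xss)) \<le> 2" by (simp add: card_insert_if split: if_splits)
  ultimately show ?thesis by blast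
qed

text \<open>
  A tree with three branch vertices of valency three: \<open>s\<close>, \<open>b\<close>, \<open>c\<close> are the branch vertices, \<open>P\<close> and \<open>S\<close>
  list the vertices strictly between \<open>s\<close> and \<open>b\<close> and between \<open>b\<close> and \<open>c\<close>, and the legs \<open>X1\<close>, \<open>X2\<close> at \<open>s\<close>,
  \<open>X3\<close> at \<open>b\<close>, \<open>X4\<close>, \<open>X5\<close> at \<open>c\<close> are listed away from the branch vertex, so that \<open>last Xi\<close> is a leaf.
\<close>

definition config :: "'a \<Rightarrow> 'a list \<Rightarrow> 'a list \<Rightarrow> 'a list \<Rightarrow> 'a \<Rightarrow> 'a list \<Rightarrow> 'a list \<Rightarrow> 'a \<Rightarrow> 'a list \<Rightarrow> 'a list \<Rightarrow> bool"
  where "config s X1 X2 P b X3 S c X4 X5 \<longleftrightarrow>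
    X1 \<noteq> [] \<and> X2 \<noteq> [] \<and> X3 \<noteq> [] \<and> X4 \<noteq> [] \<and> X5 \<noteq> [] \<and>
    path (s # X1) \<and> path (s # X2) \<and> path (s # P @ [b]) \<and> path (b # X3) \<and> path (b # S @ [c]) \<and>
    path (c # X4) \<and> path (c # X5) \<and>
    mset (s # X1 @ X2 @ P @ b # X3 @ S @ c # X4 @ X5) = mset_set V"

definition config_tree :: "'a \<Rightarrow> 'a list \<Rightarrow> 'a list \<Rightarrow> 'a list \<Rightarrow> 'a \<Rightarrow> 'a list \<Rightarrow> 'a list \<Rightarrow> 'a \<Rightarrow> 'a list \<Rightarrow> 'a list \<Rightarrow> 'a rel"
  where "config_tree s X1 X2 P b X3 S c X4 X5 =
    lists_rel [s # X1, s # X2, s # P @ [b], b # X3, b # S @ [c], c # X4, c # X5]"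

context
  fixes s X1 X2 P b X3 S c X4 X5
  assumes cfg: "config s X1 X2 P b X3 S c X4 X5"
begin

lemma config_verts:
  "V = set (s # X1 @ X2 @ P @ b # X3 @ S @ c # X4 @ X5)" "distinct (s # X1 @ X2 @ P @ b # X3 @ S @ c # X4 @ X5)"
  using mset_verts[of "s # X1 @ X2 @ P @ b # X3 @ S @ c # X4 @ X5"] cfg by (simp_all only: config_def)

lemma config_card: "card V = length (s # X1 @ X2 @ P @ b # X3 @ S @ c # X4 @ X5)"
  unfolding config_verts(1) using config_verts(2) by (rule distinct_card)

lemma config_span_tree: "span_tree (config_tree s X1 X2 P b X3 S c X4 X5)"
proof -
  have "conn_span (config_tree s X1 X2 P b X3 S c X4 X5)" unfolding config_tree_def
  proof (rule conn_span_lists)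
    show "s \<in> V" using config_verts(1) by simp
    show "V \<subseteq> insert s (\<Union>(set ` set [s # X1, s # X2, s # P @ [b], b # X3, b # S @ [c], c # X4, c # X5]))"
      unfolding config_verts(1) by auto
  qed (use cfg in \<open>auto simp: config_def\<close>)
  moreover have "card (config_tree s X1 X2 P b X3 S c X4 X5) \<le> 2 * (card V - 1)"
    unfolding config_tree_def config_card by (rule order.trans[OF card_lists_rel]) simp
  ultimately show ?thesis by (simp add: span_tree_def)
qed

lemma config_val:
  "v \<in> V \<Longrightarrow> val (config_tree s X1 X2 P b X3 S c X4 X5) v \<le> (if v = s \<or> v = b \<or> v = c then 3 else 2)"
  "val (config_tree s X1 X2 P b X3 S c X4 X5) (last X1) \<le> 1" "val (config_tree s X1 X2 P b X3 S c X4 X5) (last X2) \<le> 1" "val (config_tree s X1 X2 P b X3 S c X4 X5) (last X3) \<le> 1" "val (config_tree s X1 X2 P b X3 S c X4 X5) (last X4) \<le> 1" "val (config_tree s X1 X2 P b X3 S c X4 X5) (last X5) \<le> 1"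
proof -
  have ne: "X1 \<noteq> []" "X2 \<noteq> []" "X3 \<noteq> []" "X4 \<noteq> []" "X5 \<noteq> []" using cfg by (auto simp: config_def)
  note d = config_verts(2)
  \<comment> \<open>In the sum of \<open>val_lists_rel\<close>, \<open>A\<close> collects the terms
    from \<open>tl\<close> and \<open>B\<close> those from \<open>butlast\<close>, up to the branch
    vertices, each of which is an end of three of the seven lists.\<close>
  define B where "B v = count_list (butlast X1) v + count_list (butlast X2) v + count_list (butlast X3) v
    + count_list (butlast X4) v + count_list (butlast X5) v + count_list P v + count_list S v" for v
  define A where "A v = count_list X1 v + count_list X2 v + count_list X3 v + count_list X4 v + count_list X5 v
    + count_list P v + count_list S v" for v
  have BA: "B v \<le> A v" for v
    unfolding A_def B_def by (intro add_mono count_list_butlast_le order_refl)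
  have A1: "A v + of_bool (v = s) + of_bool (v = b) + of_bool (v = c) \<le> 1" for v
  proof -
    have "count_list (s # X1 @ X2 @ P @ b # X3 @ S @ c # X4 @ X5) v \<le> 1"
      using count_list_distinct[OF d, of v] by simp
    moreover have "count_list (s # X1 @ X2 @ P @ b # X3 @ S @ c # X4 @ X5) v =
        A v + of_bool (v = s) + of_bool (v = b) + of_bool (v = c)"
      by (simp add: A_def)
    ultimately show ?thesis by simp
  qed
  have "(\<Sum>xs\<leftarrow>[s # X1, s # X2, s # P @ [b], b # X3, b # S @ [c], c # X4, c # X5].
      count_list (butlast xs) v + count_list (tl xs) v)
      = A v + B v + 3 * of_bool (v = s) + 3 * of_bool (v = b) + 3 * of_bool (v = c)" for v
    using ne by (simp add: A_def B_def butlast_append)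
  then have bound: "val (config_tree s X1 X2 P b X3 S c X4 X5) v
      \<le> A v + B v + 3 * of_bool (v = s) + 3 * of_bool (v = b) + 3 * of_bool (v = c)" for v
    using val_lists_rel[of "[s # X1, s # X2, s # P @ [b], b # X3, b # S @ [c], c # X4, c # X5]" v]
    by (simp only: config_tree_def)
  show "val (config_tree s X1 X2 P b X3 S c X4 X5) v \<le> (if v = s \<or> v = b \<or> v = c then 3 else 2)"
    using bound[of v] BA[of v] A1[of v] by (auto simp: of_bool_def split: if_splits)
  have leaf: "val (config_tree s X1 X2 P b X3 S c X4 X5) (last X) \<le> 1" if "X \<in> {X1, X2, X3, X4, X5}" for X
  proof -
    have "X \<noteq> []" "distinct X" using that ne d by auto
    then have X: "count_list X (last X) = 1" "count_list (butlast X) (last X) = 0"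
      by (simp_all add: count_list_distinct count_list_butlast)
    note le = count_list_butlast_le[of X1 "last X"] count_list_butlast_le[of X2 "last X"]
      count_list_butlast_le[of X3 "last X"] count_list_butlast_le[of X4 "last X"] count_list_butlast_le[of X5 "last X"]
    \<comment> \<open>The end of a leg is counted by \<open>A\<close> but not by
      \<open>B\<close>.\<close>
    have "B (last X) + 1 \<le> A (last X)"
      using that X le unfolding A_def B_def by (elim insertE emptyE) simp_all
    then show ?thesis using bound[of "last X"] A1[of "last X"] by linarith
  qed
  show "val (config_tree s X1 X2 P b X3 S c X4 X5) (last X1) \<le> 1"
    "val (config_tree s X1 X2 P b X3 S c X4 X5) (last X2) \<le> 1"
    "val (config_tree s X1 X2 P b X3 S c X4 X5) (last X3) \<le> 1"
    "val (config_tree s X1 X2 P b X3 S c X4 X5) (last X4) \<le> 1"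
    "val (config_tree s X1 X2 P b X3 S c X4 X5) (last X5) \<le> 1"
    by (rule leaf, simp)+
qed

end

end

lemma (in fin_graph) card_branches_le_excess: "card (branches T) \<le> excess T"
proof -
  have "card (branches T) = (\<Sum>v\<in>branches T. 1)" by simp
  also have "\<dots> \<le> (\<Sum>v\<in>branches T. val T v - 2)"
    by (intro sum_mono) (auto simp: branches_def)
  also have "\<dots> \<le> excess T"
    unfolding excess_def by (intro sum_mono2) (use finV in \<open>auto simp: branches_def\<close>)
  finally show ?thesis .
qed

text \<open>This is the negated conclusion. It speaks of connected spanning subgraphs because a
  spanning tree inside one has no further branch vertices.\<close>

locale three_branch_graph = claw_free_graph +
  assumes no_two: "\<And>H. conn_span H \<Longrightarrow> 2 < card (branches H)"
begin

lemma excess_ge_3: "conn_span H \<Longrightarrow> 3 \<le> excess H"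
  using no_two[of H] card_branches_le_excess[of H] by linarith

lemma hubs:
  assumes "path (u # M @ [w])" "\<And>Y. Y \<in> set Ys \<Longrightarrow> path (u # Y)" "\<And>Z. Z \<in> set Zs \<Longrightarrow> path (w # Z)"
    "mset (u # w # M @ concat Ys @ concat Zs) = mset_set V"
  shows False
proof -
  obtain H where "conn_span H" "card (branches H) \<le> 2" using two_hubs[OF assms] by blast
  then show False using no_two[of H] by simp
qed

context
  fixes s X1 X2 P b X3 S c X4 X5
  assumes cfg: "config s X1 X2 P b X3 S c X4 X5"
begin

abbreviation "CT \<equiv> config_tree s X1 X2 P b X3 S c X4 X5"

text \<open>Three vertices of valency at most three give the upper bound, \<open>excess_ge_3\<close>
  the lower one. Hence the tree of every configuration is automatically optimal.\<close>

lemma config_excess: "excess CT = 3"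
proof (rule antisym)
  have sub: "{s, b, c} \<subseteq> V" using config_verts(1)[OF cfg] by auto
  have "excess CT \<le> (\<Sum>v\<in>V. if v \<in> {s, b, c} then 1 else 0)"
    unfolding excess_def
  proof (rule sum_mono)
    fix v assume "v \<in> V"
    then show "val CT v - 2 \<le> (if v \<in> {s, b, c} then 1 else 0)"
      using config_val(1)[OF cfg, of v] by (auto split: if_splits)
  qed
  also have "\<dots> = card {s, b, c}" using finV sub by (simp add: sum.If_cases Int_absorb1 del: insert_iff)
  also have "\<dots> \<le> 3" using card_length[of "[s, b, c]"] by simp
  finally show "excess CT \<le> 3" .
qed (use excess_ge_3 span_treeD(1)[OF config_span_tree[OF cfg]] in blast)

lemma config_opt: "opt_tree CT"
  using config_span_tree[OF cfg] excess_ge_3 config_excess by (simp add: opt_tree_def)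

text \<open>The five ends of the legs have valency at most one, and by \<open>card_leaves\<close>
  there are exactly 3 + 2 leaves.\<close>

lemma config_leaves: "leaves CT = {last X1, last X2, last X3, last X4, last X5}"
proof -
  have ne: "X1 \<noteq> []" "X2 \<noteq> []" "X3 \<noteq> []" "X4 \<noteq> []" "X5 \<noteq> []" using cfg by (auto simp: config_def)
  let ?L = "{last X1, last X2, last X3, last X4, last X5}"
  have in_set: "last X1 \<in> set X1" "last X2 \<in> set X2" "last X3 \<in> set X3" "last X4 \<in> set X4" "last X5 \<in> set X5"
    using ne by auto
  then have LV: "?L \<subseteq> V" using config_verts(1)[OF cfg] by auto
  note d = config_verts(2)[OF cfg]
  have "last X1 \<notin> set (X2 @ X3 @ X4 @ X5)" using in_set(1) d by auto
  then have n1: "last X1 \<noteq> last X2" "last X1 \<noteq> last X3" "last X1 \<noteq> last X4" "last X1 \<noteq> last X5"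
    using in_set by auto
  have "last X2 \<notin> set (X3 @ X4 @ X5)" using in_set(2) d by auto
  then have n2: "last X2 \<noteq> last X3" "last X2 \<noteq> last X4" "last X2 \<noteq> last X5" using in_set by auto
  have "last X3 \<notin> set (X4 @ X5)" using in_set(3) d by auto
  then have n3: "last X3 \<noteq> last X4" "last X3 \<noteq> last X5" using in_set by auto
  have "last X4 \<notin> set X5" using in_set(4) d by auto
  then have n4: "last X4 \<noteq> last X5" using in_set by auto
  have "distinct [last X1, last X2, last X3, last X4, last X5]" using n1 n2 n3 n4 by simp
  then have "card (set [last X1, last X2, last X3, last X4, last X5]) = 5"
    by (simp only: distinct_card list.size)
  then have "card ?L = 5" by simp
  have "card {s, b} \<le> card V" using config_verts(1)[OF cfg] by (intro card_mono finV) auto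
  moreover have "s \<noteq> b" using config_verts(2)[OF cfg] by auto
  ultimately have V2: "2 \<le> card V" by simp
  have "?L \<subseteq> leaves CT"
  proof
    fix x assume x: "x \<in> ?L"
    then have "val CT x \<le> 1"
      by (elim insertE emptyE) (simp_all add: config_val(2-6)[OF cfg, unfolded One_nat_def])
    moreover have "V \<noteq> {x}" using V2 by auto
    then have "1 \<le> val CT x" using val_ge_1[OF config_span_tree[OF cfg]] x LV by blast
    ultimately show "x \<in> leaves CT" using x LV by (auto simp: leaves_def)
  qed
  moreover have "card (leaves CT) = 5"
    using card_leaves[OF config_span_tree[OF cfg] V2] config_excess by simp
  moreover have "finite (leaves CT)" using finV by (simp add: leaves_def)
  ultimately show ?thesis using \<open>card ?L = 5\<close> card_subset_eq[of "leaves CT" ?L] by simp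
qed

lemma config_edge:
  assumes xs: "U @ k # W \<in> set [s # X1, s # X2, s # P @ [b], b # X3, b # S @ [c], c # X4, c # X5]"
    "U \<noteq> []" "set (k # W) \<subseteq> D" "set U \<inter> D = {}" "s \<notin> D"
    and others: "\<And>ys. ys \<in> set [s # X1, s # X2, s # P @ [b], b # X3, b # S @ [c], c # X4, c # X5] \<Longrightarrow>
      ys \<noteq> U @ k # W \<Longrightarrow> set ys \<subseteq> D \<or> set ys \<inter> D = {}"
    and leaf: "\<And>x. x \<in> {last X1, last X2, last X3, last X4, last X5} \<Longrightarrow>
      (x \<notin> D \<longrightarrow> (k, x) \<notin> E) \<and> (x \<in> D \<longrightarrow> (last U, x) \<notin> E)"
  shows "\<exists>q. unblocked CT k q \<and> s \<notin> side CT k q"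
proof -
  have "unblocked CT k (last U) \<and> side CT k (last U) \<subseteq> D"
  proof (rule unblockedI[OF config_opt])
    show "0 < excess CT" using config_excess by simp
    have "(last U, k) \<in> list_edges (U @ k # W)" using xs(2) by (simp add: list_edges_append)
    then show "(k, last U) \<in> CT" using xs(1) unfolding config_tree_def lists_rel_def by blast
    show "k \<in> D" using xs(3) by simp
    show "last U \<notin> D" using xs(2,4) last_in_set[of U] by blast
    show "w \<in> D \<or> v = k \<and> w = last U" if "v \<in> D" "(v, w) \<in> CT" for v w
      using lists_rel_cut[OF xs(1-4) others that(1)] that(2) unfolding config_tree_def by blast
  qed (use leaf config_leaves in auto)
  then show ?thesis using xs(5) by blast
qed

end

end

section \<open>Maximal configurations\<close>

text \<open>\<open>max1\<close> is used against the exchanges in \<open>p_hd_X1\<close> and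
  \<open>P_x1\<close>, \<open>max2\<close> against that in \<open>S_x3\<close> and
  \<open>max3\<close> against that in \<open>S_hd_X4\<close>. All other exchanges end with two
  hubs.\<close>

locale max_config = three_branch_graph +
  fixes s X1 X2 P b X3 S c X4 X5
  assumes cfg: "config s X1 X2 P b X3 S c X4 X5"
    and max1: "\<And>s' X1' X2' P' b' X3' S' c' X4' X5'. config s' X1' X2' P' b' X3' S' c' X4' X5' \<Longrightarrow>
      length X1' + length X2' \<le> length X1 + length X2"
    and max2: "\<And>s' X1' X2' P' b' X3' S' c' X4' X5'. config s' X1' X2' P' b' X3' S' c' X4' X5' \<Longrightarrow>
      length X1' + length X2' = length X1 + length X2 \<Longrightarrow> length P' \<le> length P"
    and max3: "\<And>s' X1' X2' P' b' X3' S' c' X4' X5'. config s' X1' X2' P' b' X3' S' c' X4' X5' \<Longrightarrow>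
      length X1' + length X2' = length X1 + length X2 \<Longrightarrow> length P' = length P \<Longrightarrow>
      length X4' + length X5' \<le> length X4 + length X5"
begin

lemma ne: "X1 \<noteq> []" "X2 \<noteq> []" "X3 \<noteq> []" "X4 \<noteq> []" "X5 \<noteq> []"
  using cfg by (auto simp: config_def)

lemma paths: "path (s # X1)" "path (s # X2)" "path (s # P @ [b])" "path (b # X3)" "path (b # S @ [c])"
    "path (c # X4)" "path (c # X5)"
  using cfg by (auto simp: config_def)

lemma msV: "mset (s # X1 @ X2 @ P @ b # X3 @ S @ c # X4 @ X5) = mset_set V"
  using cfg by (simp only: config_def)

lemmas path_iff = path_Cons path_append hd_append last_append hd_rev last_rev E_commute ac_simps add_mset_commute

lemma hubsI:
  assumes "path (u # M @ [w])" "\<forall>Y\<in>set Ys. path (u # Y)" "\<forall>Z\<in>set Zs. path (w # Z)"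
    "mset (u # w # M @ concat Ys @ concat Zs) = mset_set V"
  shows False
  using assms by (intro hubs[of u M w Ys Zs]) auto

text \<open>The two legs at \<open>s\<close> are interchangeable, as are those at \<open>c\<close>
  by \<open>swap45\<close>; so most exchanges are carried out for one leg only.\<close>

lemma swap12: "max_config V E s X2 X1 P b X3 S c X4 X5"
proof
  show "config s X2 X1 P b X3 S c X4 X5" using cfg by (auto simp: config_def ac_simps)
qed (use max1 max2 max3 in \<open>simp_all add: add.commute[of "length X2"]\<close>)

lemma swap45: "max_config V E s X1 X2 P b X3 S c X5 X4"
proof
  show "config s X1 X2 P b X3 S c X5 X4" using cfg by (auto simp: config_def ac_simps)
qed (use max1 max2 max3 in \<open>simp_all add: add.commute[of "length X5"]\<close>)

text \<open>
  In the names of the exchange lemmas \<open>xi\<close> stands for the leaf \<open>last Xi\<close>.  If the excluded edge were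
  present, then either a spanning subgraph whose only branch vertices are the two hubs passed to
  \<open>hubsI\<close> would exist, or a configuration larger in the lexicographic order of \<open>max1\<close>, \<open>max2\<close>, \<open>max3\<close>.
\<close>

lemma b_hd_X1:
  assumes "P = []"
  shows "(b, hd X1) \<notin> E"
proof
  assume *: "(b, hd X1) \<in> E"
  show False
    by (rule hubsI[of "b" "S" "c" "[X1, s # X2, X3]" "[X4, X5]"])
      (use * assms paths ne msV in \<open>auto simp: path_iff split: if_splits\<close>)
qed

text \<open>If \<open>P\<close> is nonempty, its first vertex could replace \<open>s\<close> as a
  branch vertex and \<open>s\<close> would lengthen the leg \<open>X2\<close>, against
  \<open>max1\<close>. If \<open>P\<close> is empty, the vertex is \<open>b\<close>.\<close>

lemma p_hd_X1: "(hd (P @ [b]), hd X1) \<notin> E"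
proof (cases P)
  case Nil
  then show ?thesis using b_hd_X1 by simp
next
  case (Cons p P')
  show ?thesis
  proof
    assume "(hd (P @ [b]), hd X1) \<in> E"
    then have "config p X1 (s # X2) P' b X3 S c X4 X5"
      using paths ne msV Cons unfolding config_def by (auto simp: path_iff split: if_splits)
    from max1[OF this] show False by simp
  qed
qed

lemma config_distinct: "distinct (s # X1 @ X2 @ P @ b # X3 @ S @ c # X4 @ X5)"
  using config_verts(2)[OF cfg] .

text \<open>Of the three tree neighbours of \<open>s\<close>, neither first leg vertex is adjacent
  to the one towards \<open>b\<close>, so claw-freeness at \<open>s\<close> joins the first leg
  vertices. Hence \<open>rev X1 @ X2\<close> is a path without \<open>s\<close>.\<close>

lemma hd_X1_X2: "(hd X1, hd X2) \<in> E"
proof -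
  have in_set: "hd X1 \<in> set X1" "hd X2 \<in> set X2" "hd (P @ [b]) \<in> set (P @ [b])"
    using ne hd_in_set[of "P @ [b]"] by simp_all
  have "hd X1 \<notin> set (X2 @ P @ [b])" using in_set(1) config_distinct by auto
  then have 1: "hd X1 \<noteq> hd X2" "hd X1 \<noteq> hd (P @ [b])" using in_set(2,3) by auto
  have "hd X2 \<notin> set (P @ [b])" using in_set(2) config_distinct by auto
  then have 2: "hd X2 \<noteq> hd (P @ [b])" using in_set(3) by metis
  have "(s, hd X1) \<in> E" "(s, hd X2) \<in> E" "(s, hd (P @ [b])) \<in> E"
    using paths ne by (auto simp: path_Cons)
  from claw[OF this 1 2] show ?thesis
    using p_hd_X1 max_config.p_hd_X1[OF swap12] E_sym by blast
qed

text \<open>If \<open>s\<close> could be put in front of a path through both legs, then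
  \<open>rev P @ s # Y\<close> would be a single arm at \<open>b\<close>, and only \<open>b\<close>
  and \<open>c\<close> would branch.\<close>

lemma ham:
  assumes "mset Y = mset X1 + mset X2" "path Y"
  shows "(s, hd Y) \<notin> E"
proof
  assume *: "(s, hd Y) \<in> E"
  show False
    by (rule hubsI[of b S c "[rev P @ s # Y, X3]" "[X4, X5]"])
      (use * assms paths ne msV in \<open>auto simp: path_iff split: if_splits\<close>)
qed

text \<open>The path \<open>rev X1 @ X2\<close> starts at \<open>last X1\<close>.\<close>

lemma s_x1: "(s, last X1) \<notin> E"
  using ham[of "rev X1 @ X2"] hd_X1_X2 paths ne by (auto simp: path_iff split: if_splits)

lemmas s_x2 = max_config.s_x1[OF swap12]

section \<open>Further non-neighbours of \<open>s\<close>\<close>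

lemma s_x3:
  shows "(s, last X3) \<notin> E"
proof
  assume *: "(s, last X3) \<in> E"
  show False
    by (rule hubsI[of "s" "rev X3 @ b # S" "c" "[X1, X2, P]" "[X4, X5]"])
      (use *  paths ne msV in \<open>auto simp: path_iff split: if_splits\<close>)
qed

lemma s_x4:
  shows "(s, last X4) \<notin> E"
proof
  assume *: "(s, last X4) \<in> E"
  show False
    by (rule hubsI[of "s" "rev X4" "c" "[X1, X2, P]" "[X5, rev S @ b # X3]"])
      (use *  paths ne msV in \<open>auto simp: path_iff split: if_splits\<close>)
qed

lemmas s_x5 = max_config.s_x4[OF swap45]

lemma s_c:
  shows "(s, c) \<notin> E"
proof
  assume *: "(s, c) \<in> E"
  show False
    by (rule hubsI[of "s" "[]" "c" "[X1, X2, P]" "[X4, X5, rev S @ b # X3]"])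
      (use *  paths ne msV in \<open>auto simp: path_iff split: if_splits\<close>)
qed

lemma s_hd_X4:
  shows "(s, hd X4) \<notin> E"
proof
  assume *: "(s, hd X4) \<in> E"
  show False
    by (rule hubsI[of "s" "P" "b" "[X1, X2, X4]" "[X3, S @ c # X5]"])
      (use *  paths ne msV in \<open>auto simp: path_iff split: if_splits\<close>)
qed

lemmas s_hd_X5 = max_config.s_hd_X4[OF swap45]

lemma s_hd_X3:
  shows "(s, hd X3) \<notin> E"
proof
  assume *: "(s, hd X3) \<in> E"
  show False
    by (rule hubsI[of "s" "P @ b # S" "c" "[X1, X2, X3]" "[X4, X5]"])
      (use *  paths ne msV in \<open>auto simp: path_iff split: if_splits\<close>)
qed

lemma s_hd_S:
  shows "(s, hd (S @ [c])) \<notin> E"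
proof
  assume *: "(s, hd (S @ [c])) \<in> E"
  show False
    by (rule hubsI[of "s" "S" "c" "[X1, X2, P @ b # X3]" "[X4, X5]"])
      (use *  paths ne msV in \<open>auto simp: path_iff split: if_splits\<close>)
qed

section \<open>Nonadjacencies at \<open>b\<close> and \<open>c\<close>\<close>

lemma b_x1:
  shows "(b, last X1) \<notin> E"
proof
  assume *: "(b, last X1) \<in> E"
  show False
    by (rule hubsI[of "b" "S" "c" "[X3, rev X1, rev P @ s # X2]" "[X4, X5]"])
      (use *  paths ne msV in \<open>auto simp: path_iff split: if_splits\<close>)
qed

lemmas b_x2 = max_config.b_x1[OF swap12]

lemma b_x4:
  shows "(b, last X4) \<notin> E"
proof
  assume *: "(b, last X4) \<in> E"
  show False
    by (rule hubsI[of "s" "P" "b" "[X1, X2]" "[X3, rev X4, S @ c # X5]"])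
      (use *  paths ne msV in \<open>auto simp: path_iff split: if_splits\<close>)
qed

lemmas b_x5 = max_config.b_x4[OF swap45]

lemma c_x1:
  shows "(c, last X1) \<notin> E"
proof
  assume *: "(c, last X1) \<in> E"
  show False
    by (rule hubsI[of "c" "rev S" "b" "[X4, X5, rev X1]" "[X3, rev P @ s # X2]"])
      (use *  paths ne msV in \<open>auto simp: path_iff split: if_splits\<close>)
qed

lemmas c_x2 = max_config.c_x1[OF swap12]

lemma c_x3:
  shows "(c, last X3) \<notin> E"
proof
  assume *: "(c, last X3) \<in> E"
  show False
    by (rule hubsI[of "s" "P @ b # S" "c" "[X1, X2]" "[X4, X5, rev X3]"])
      (use *  paths ne msV in \<open>auto simp: path_iff split: if_splits\<close>)
qed

lemma b_hd_X4:
  assumes "S = []"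
  shows "(b, hd X4) \<notin> E"
proof
  assume *: "(b, hd X4) \<in> E"
  show False
    by (rule hubsI[of "s" "P" "b" "[X1, X2]" "[X3, X4, c # X5]"])
      (use * assms paths ne msV in \<open>auto simp: path_iff split: if_splits\<close>)
qed

text \<open>If \<open>S\<close> is nonempty, its last vertex could replace \<open>c\<close> as a
  branch vertex and \<open>c\<close> would lengthen the leg \<open>X5\<close>, against
  \<open>max3\<close>; the legs at \<open>s\<close> and \<open>P\<close> stay the same.\<close>

lemma S_hd_X4: "(last (b # S), hd X4) \<notin> E"
proof (cases S rule: rev_cases)
  case Nil
  then show ?thesis using b_hd_X4 by simp
next
  case (snoc S' e)
  show ?thesis
  proof
    assume "(last (b # S), hd X4) \<in> E"
    then have "config s X1 X2 P b X3 S' e X4 (c # X5)"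
      using paths ne msV snoc unfolding config_def by (auto simp: path_iff split: if_splits)
    from max3[OF this] show False by simp
  qed
qed

text \<open>The claw argument of \<open>hd_X1_X2\<close>, now at \<open>c\<close>.\<close>

lemma hd_X4_X5: "(hd X4, hd X5) \<in> E"
proof -
  have in_set: "hd X4 \<in> set X4" "hd X5 \<in> set X5" "last (b # S) \<in> set (b # S)"
    using ne by auto
  have "hd X4 \<notin> set (b # S @ X5)" using in_set(1) config_distinct by auto
  then have 1: "hd X4 \<noteq> hd X5" "hd X4 \<noteq> last (b # S)" using in_set(2,3) by auto
  have "hd X5 \<notin> set (b # S)" using in_set(2) config_distinct by auto
  then have 2: "hd X5 \<noteq> last (b # S)" using in_set(3) by metis
  have "(c, hd X4) \<in> E" "(c, hd X5) \<in> E" "(c, last (b # S)) \<in> E"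
    using paths ne by (auto simp: path_iff split: if_splits)
  from claw[OF this 1 2] show ?thesis
    using S_hd_X4 max_config.S_hd_X4[OF swap45] E_sym by blast
qed

text \<open>By \<open>hd_X4_X5\<close> the legs at \<open>c\<close> would form one path attached to
  \<open>c\<close> through \<open>last X4\<close>, and \<open>c\<close> would no longer
  branch.\<close>

lemma c_x4:
  shows "(c, last X4) \<notin> E"
proof
  assume *: "(c, last X4) \<in> E"
  show False
    by (rule hubsI[of "s" "P" "b" "[X1, X2]" "[X3, S @ c # rev X4 @ X5]"])
      (use *  hd_X4_X5 paths ne msV in \<open>auto simp: path_iff split: if_splits\<close>)
qed

section \<open>Exchanges at vertices of \<open>P\<close>, \<open>X3\<close>, \<open>S\<close> and
  \<open>X4\<close>\<close>

lemma P_x1_first: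
  assumes "P = p # B"
  shows "(p, last X1) \<notin> E"
proof
  assume *: "(p, last X1) \<in> E"
  show False
    by (rule hubsI[of "b" "S" "c" "[rev P @ rev X1 @ s # X2, X3]" "[X4, X5]"])
      (use * assms paths ne msV in \<open>auto simp: path_iff split: if_splits\<close>)
qed

text \<open>Unless \<open>p\<close> is the first vertex of \<open>P\<close>, it could become the
  branch vertex with legs \<open>rev A\<close> and \<open>rev X1 @ s # X2\<close>. The new legs
  contain \<open>s\<close> and \<open>A\<close> in addition, against \<open>max1\<close>.\<close>

lemma P_x1:
  assumes "p \<in> set P"
  shows "(p, last X1) \<notin> E"
proof -
  obtain A B where P: "P = A @ p # B" using split_list[OF assms] by blast
  show ?thesis
  proof (cases "A = []")
    case True
    then show ?thesis using P_x1_first P by simp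
  next
    case False
    show ?thesis
    proof
      assume "(p, last X1) \<in> E"
      then have "config p (rev A) (rev X1 @ s # X2) B b X3 S c X4 X5"
        using paths ne msV P False unfolding config_def by (auto simp: path_iff split: if_splits)
      from max1[OF this] False show False by simp
    qed
  qed
qed

lemmas P_x2 = max_config.P_x1[OF swap12]

text \<open>The chord from \<open>s\<close> to \<open>p\<close> bypasses \<open>A\<close>, so
  \<open>A\<close> can carry the leg \<open>X3\<close> as an arm at \<open>s\<close>, and
  \<open>b\<close> stops branching.\<close>

lemma P_chord_x3:
  assumes "P = A @ p # B" "A \<noteq> []" "(s, p) \<in> E"
  shows "(last A, last X3) \<notin> E"
proof
  assume *: "(last A, last X3) \<in> E"
  show False
    by (rule hubsI[of "s" "p # B @ b # S" "c" "[X1, X2, A @ rev X3]" "[X4, X5]"])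
      (use * assms paths ne msV in \<open>auto simp: path_iff split: if_splits\<close>)
qed

lemma P_chord_x4:
  assumes "P = A @ p # B" "A \<noteq> []" "(s, p) \<in> E"
  shows "(last A, last X4) \<notin> E"
proof
  assume *: "(last A, last X4) \<in> E"
  show False
    by (rule hubsI[of "s" "p # B" "b" "[X1, X2, A @ rev X4]" "[X3, S @ c # X5]"])
      (use * assms paths ne msV in \<open>auto simp: path_iff split: if_splits\<close>)
qed

text \<open>\<open>v\<close> becomes a hub in place of \<open>s\<close>: by \<open>hd_X1_X2\<close>
  the two legs at \<open>s\<close> form one arm at \<open>v\<close>, and \<open>s\<close> together
  with \<open>P\<close> forms another. The same rearrangement recurs in \<open>S_x1\<close> and
  \<open>X4_x1\<close>.\<close>

lemma X3_x1:
  assumes "X3 = A @ v # B" "A \<noteq> []" "(s, v) \<in> E"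
  shows "(v, last X1) \<notin> E"
proof
  assume *: "(v, last X1) \<in> E"
  show False
    by (rule hubsI[of "v" "rev A @ b # S" "c" "[B, rev X1 @ X2, s # P]" "[X4, X5]"])
      (use * assms hd_X1_X2 paths ne msV in \<open>auto simp: path_iff split: if_splits\<close>)
qed

lemma X3_x4:
  assumes "X3 = A @ v # B" "A \<noteq> []" "(s, v) \<in> E"
  shows "(v, last X4) \<notin> E"
proof
  assume *: "(v, last X4) \<in> E"
  show False
    by (rule hubsI[of "s" "[]" "v" "[X1, X2, P]" "[B, rev X4, rev A @ b # S @ c # X5]"])
      (use * assms paths ne msV in \<open>auto simp: path_iff split: if_splits\<close>)
qed

lemma X3_x3:
  assumes "X3 = A @ v # B" "A \<noteq> []" "(s, v) \<in> E"
  shows "(last A, last X3) \<notin> E"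
proof
  assume *: "(last A, last X3) \<in> E"
  show False
    by (rule hubsI[of "s" "v # B @ rev A @ b # S" "c" "[X1, X2, P]" "[X4, X5]"])
      (use * assms paths ne msV in \<open>auto simp: path_iff split: if_splits\<close>)
qed

lemma S_x1:
  assumes "S = A @ v # B" "A \<noteq> []" "(s, v) \<in> E"
  shows "(v, last X1) \<notin> E"
proof
  assume *: "(v, last X1) \<in> E"
  show False
    by (rule hubsI[of "v" "B" "c" "[rev X1 @ X2, s # P, rev A @ b # X3]" "[X4, X5]"])
      (use * assms hd_X1_X2 paths ne msV in \<open>auto simp: path_iff split: if_splits\<close>)
qed

text \<open>With \<open>v\<close> as the middle branch vertex, the path from \<open>s\<close> to it
  would run through \<open>b\<close> and \<open>X3\<close>, against \<open>max2\<close>, while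
  \<open>rev A\<close> is the new leg.\<close>

lemma S_x3:
  assumes "S = A @ v # B" "A \<noteq> []"
  shows "(v, last X3) \<notin> E"
proof
  assume "(v, last X3) \<in> E"
  then have "config s X1 X2 (P @ b # X3) v (rev A) B c X4 X5"
    using paths ne msV assms unfolding config_def by (auto simp: path_iff split: if_splits)
  from max2[OF this] show False by simp
qed

lemma S_x4:
  assumes "S = A @ v # B" "A \<noteq> []" "(s, v) \<in> E"
  shows "(last A, last X4) \<notin> E"
proof
  assume *: "(last A, last X4) \<in> E"
  show False
    by (rule hubsI[of "s" "v # B" "c" "[X1, X2, P]" "[X5, X4 @ rev A @ b # X3]"])
      (use * assms paths ne msV in \<open>auto simp: path_iff split: if_splits\<close>)
qed

lemma X4_x1:
  assumes "X4 = A @ v # B" "A \<noteq> []" "(s, v) \<in> E"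
  shows "(v, last X1) \<notin> E"
proof
  assume *: "(v, last X1) \<in> E"
  show False
    by (rule hubsI[of "v" "rev A" "c" "[B, rev X1 @ X2, s # P]" "[X5, rev S @ b # X3]"])
      (use * assms hd_X1_X2 paths ne msV in \<open>auto simp: path_iff split: if_splits\<close>)
qed

lemma X4_x3:
  assumes "X4 = A @ v # B" "A \<noteq> []" "(s, v) \<in> E"
  shows "(v, last X3) \<notin> E"
proof
  assume *: "(v, last X3) \<in> E"
  show False
    by (rule hubsI[of "s" "[]" "v" "[X1, X2, P]" "[B, rev A, rev X3 @ b # S @ c # X5]"])
      (use * assms paths ne msV in \<open>auto simp: path_iff split: if_splits\<close>)
qed

lemma X4_x5:
  assumes "X4 = A @ v # B" "A \<noteq> []" "(s, v) \<in> E"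
  shows "(v, last X5) \<notin> E"
proof
  assume *: "(v, last X5) \<in> E"
  show False
    by (rule hubsI[of "s" "[]" "v" "[X1, X2, P]" "[B, rev X5, rev A @ c # rev S @ b # X3]"])
      (use * assms paths ne msV in \<open>auto simp: path_iff split: if_splits\<close>)
qed

lemma X4_x4:
  assumes "X4 = A @ v # B" "A \<noteq> []" "(s, v) \<in> E"
  shows "(last A, last X4) \<notin> E"
proof
  assume *: "(last A, last X4) \<in> E"
  show False
    by (rule hubsI[of "s" "v # B @ rev A" "c" "[X1, X2, P]" "[X5, rev S @ b # X3]"])
      (use * assms paths ne msV in \<open>auto simp: path_iff split: if_splits\<close>)
qed

section \<open>Exchanges at the tree edges next to \<open>b\<close> and \<open>c\<close>\<close>

lemma hd_X4_x5:
  shows "(hd X4, last X5) \<notin> E"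
proof
  assume *: "(hd X4, last X5) \<in> E"
  show False
    by (rule hubsI[of "s" "P" "b" "[X1, X2]" "[X3, S @ c # X5 @ X4]"])
      (use *  paths ne msV in \<open>auto simp: path_iff split: if_splits\<close>)
qed

lemma hd_X4_x3:
  shows "(hd X4, last X3) \<notin> E"
proof
  assume *: "(hd X4, last X3) \<in> E"
  show False
    by (rule hubsI[of "s" "P" "b" "[X1, X2]" "[X3 @ X4, S @ c # X5]"])
      (use *  paths ne msV in \<open>auto simp: path_iff split: if_splits\<close>)
qed

lemma hd_X4_x1:
  shows "(hd X4, last X1) \<notin> E"
proof
  assume *: "(hd X4, last X1) \<in> E"
  show False
    by (rule hubsI[of "s" "P" "b" "[X1 @ X4, X2]" "[X3, S @ c # X5]"])
      (use *  paths ne msV in \<open>auto simp: path_iff split: if_splits\<close>)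
qed

lemma last_S_x4:
  shows "(last (b # S), last X4) \<notin> E"
proof
  assume *: "(last (b # S), last X4) \<in> E"
  show False
    by (rule hubsI[of "s" "P" "b" "[X1, X2]" "[X3, S @ rev X4 @ c # X5]"])
      (use *  paths ne msV in \<open>auto simp: path_iff split: if_splits\<close>)
qed

lemma hd_X3_x1:
  shows "(hd X3, last X1) \<notin> E"
proof
  assume *: "(hd X3, last X1) \<in> E"
  show False
    by (rule hubsI[of "s" "P @ b # S" "c" "[X1 @ X3, X2]" "[X4, X5]"])
      (use *  paths ne msV in \<open>auto simp: path_iff split: if_splits\<close>)
qed

lemma hd_X3_x4:
  shows "(hd X3, last X4) \<notin> E"
proof
  assume *: "(hd X3, last X4) \<in> E"
  show False
    by (rule hubsI[of "s" "P @ b # S" "c" "[X1, X2]" "[X4 @ X3, X5]"])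
      (use *  paths ne msV in \<open>auto simp: path_iff split: if_splits\<close>)
qed

lemma hd_S_x1:
  shows "(hd (S @ [c]), last X1) \<notin> E"
proof
  assume *: "(hd (S @ [c]), last X1) \<in> E"
  show False
    by (rule hubsI[of "s" "X1 @ S" "c" "[X2, P @ b # X3]" "[X4, X5]"])
      (use *  paths ne msV in \<open>auto simp: path_iff split: if_splits\<close>)
qed

lemma hd_S_x3:
  shows "(hd (S @ [c]), last X3) \<notin> E"
proof
  assume *: "(hd (S @ [c]), last X3) \<in> E"
  show False
    by (rule hubsI[of "s" "P @ b # X3 @ S" "c" "[X1, X2]" "[X4, X5]"])
      (use *  paths ne msV in \<open>auto simp: path_iff split: if_splits\<close>)
qed

lemma last_P_x3:
  shows "(last (s # P), last X3) \<notin> E"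
proof
  assume *: "(last (s # P), last X3) \<in> E"
  show False
    by (rule hubsI[of "s" "P @ rev X3 @ b # S" "c" "[X1, X2]" "[X4, X5]"])
      (use *  paths ne msV in \<open>auto simp: path_iff split: if_splits\<close>)
qed

lemma last_P_x4:
  shows "(last (s # P), last X4) \<notin> E"
proof
  assume *: "(last (s # P), last X4) \<in> E"
  show False
    by (rule hubsI[of "s" "P @ rev X4" "c" "[X1, X2]" "[X5, rev S @ b # X3]"])
      (use *  paths ne msV in \<open>auto simp: path_iff split: if_splits\<close>)
qed

section \<open>Exclusions for a claw at \<open>b\<close>\<close>

lemma c_hd_X3:
  assumes "S = []"
  shows "(c, hd X3) \<notin> E"
proof
  assume *: "(c, hd X3) \<in> E"
  show False
    by (rule hubsI[of "s" "P @ [b]" "c" "[X1, X2]" "[X4, X5, X3]"])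
      (use * assms paths ne msV in \<open>auto simp: path_iff split: if_splits\<close>)
qed

lemma last_P_c:
  assumes "S = []"
  shows "(last (s # P), c) \<notin> E"
proof
  assume *: "(last (s # P), c) \<in> E"
  show False
    by (rule hubsI[of "s" "P" "c" "[X1, X2]" "[X4, X5, b # X3]"])
      (use * assms paths ne msV in \<open>auto simp: path_iff split: if_splits\<close>)
qed

lemma hd_X3_last_P:
  assumes "(b, last X3) \<in> E"
  shows "(hd X3, last (s # P)) \<notin> E"
proof
  assume *: "(hd X3, last (s # P)) \<in> E"
  show False
    by (rule hubsI[of "s" "P @ X3 @ b # S" "c" "[X1, X2]" "[X4, X5]"])
      (use * assms paths ne msV in \<open>auto simp: path_iff split: if_splits\<close>)
qed

section \<open>Neighbours of \<open>s\<close> on the leg \<open>X1\<close>\<close>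

lemma X1_x3:
  assumes "X1 = A @ v # B" "(s, v) \<in> E"
  shows "(v, last X3) \<notin> E"
proof
  assume *: "(v, last X3) \<in> E"
  show False
    by (rule hubsI[of "v" "rev X3 @ b # S" "c" "[B, rev A @ X2, s # P]" "[X4, X5]"])
      (use * assms hd_X1_X2 paths ne msV in \<open>auto simp: path_iff split: if_splits\<close>)
qed

lemma X1_x4:
  assumes "X1 = A @ v # B" "(s, v) \<in> E"
  shows "(v, last X4) \<notin> E"
proof
  assume *: "(v, last X4) \<in> E"
  show False
    by (rule hubsI[of "v" "rev X4" "c" "[B, rev A @ X2, s # P]" "[X5, rev S @ b # X3]"])
      (use * assms hd_X1_X2 paths ne msV in \<open>auto simp: path_iff split: if_splits\<close>)
qed

text \<open>Otherwise the path \<open>v # B @ rev A @ X2\<close> through both legs starts at a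
  neighbour of \<open>s\<close>, against \<open>ham\<close>.\<close>

lemma X1_x1:
  assumes "X1 = A @ v # B" "A \<noteq> []" "(s, v) \<in> E"
  shows "(last A, last X1) \<notin> E"
  using ham[of "v # B @ rev A @ X2"] assms hd_X1_X2 paths ne by (auto simp: path_iff split: if_splits)

end

lemma lists_rel_cong: "set xss = set yss \<Longrightarrow> lists_rel xss = lists_rel yss"
  by (simp add: lists_rel_def)

context max_config
begin

abbreviation T where "T \<equiv> config_tree s X1 X2 P b X3 S c X4 X5"

text \<open>The edge of \<open>T\<close> from \<open>k\<close> towards the root \<open>s\<close> is not blocked.\<close>

definition free :: "'a \<Rightarrow> bool" where
  "free k \<longleftrightarrow> (\<exists>q. unblocked T k q \<and> s \<notin> side T k q)"

lemma free_swap12: "max_config.free V E s X2 X1 P b X3 S c X4 X5 k \<longleftrightarrow> free k"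
proof -
  have "config_tree s X2 X1 P b X3 S c X4 X5 = T"
    unfolding config_tree_def by (rule lists_rel_cong) auto
  then show ?thesis by (simp add: free_def max_config.free_def[OF swap12])
qed

lemma free_swap45: "max_config.free V E s X1 X2 P b X3 S c X5 X4 k \<longleftrightarrow> free k"
proof -
  have "config_tree s X1 X2 P b X3 S c X5 X4 = T"
    unfolding config_tree_def by (rule lists_rel_cong) auto
  then show ?thesis by (simp add: free_def max_config.free_def[OF swap45])
qed

lemma lasts: "last X1 \<in> set X1" "last X2 \<in> set X2" "last X3 \<in> set X3" "last X4 \<in> set X4" "last X5 \<in> set X5"
  using ne by auto

lemma leaves_T: "leaves T = {last X1, last X2, last X3, last X4, last X5}"
  by (rule config_leaves[OF cfg])

lemma leaf_nonadj: "x \<in> leaves T \<Longrightarrow> y \<in> leaves T \<Longrightarrow> (x, y) \<notin> E"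
proof -
  have "0 < excess T" by (simp add: config_excess[OF cfg])
  then show "x \<in> leaves T \<Longrightarrow> y \<in> leaves T \<Longrightarrow> (x, y) \<notin> E"
    by (rule leaves_independent[OF config_opt[OF cfg]])
qed

lemma last_notin:
  "last X1 \<notin> set X2 \<union> set X3 \<union> set X4 \<union> set X5 \<union> set P \<union> set S \<union> {s, b, c}"
  "last X2 \<notin> set X1 \<union> set X3 \<union> set X4 \<union> set X5 \<union> set P \<union> set S \<union> {s, b, c}"
  "last X3 \<notin> set X1 \<union> set X2 \<union> set X4 \<union> set X5 \<union> set P \<union> set S \<union> {s, b, c}"
  "last X4 \<notin> set X1 \<union> set X2 \<union> set X3 \<union> set X5 \<union> set P \<union> set S \<union> {s, b, c}"
  "last X5 \<notin> set X1 \<union> set X2 \<union> set X3 \<union> set X4 \<union> set P \<union> set S \<union> {s, b, c}"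
proof -
  note d = config_distinct
  show "last X1 \<notin> set X2 \<union> set X3 \<union> set X4 \<union> set X5 \<union> set P \<union> set S \<union> {s, b, c}"
    using lasts(1) d by auto
  show "last X2 \<notin> set X1 \<union> set X3 \<union> set X4 \<union> set X5 \<union> set P \<union> set S \<union> {s, b, c}"
    using lasts(2) d by auto
  show "last X3 \<notin> set X1 \<union> set X2 \<union> set X4 \<union> set X5 \<union> set P \<union> set S \<union> {s, b, c}"
    using lasts(3) d by auto
  show "last X4 \<notin> set X1 \<union> set X2 \<union> set X3 \<union> set X5 \<union> set P \<union> set S \<union> {s, b, c}"
    using lasts(4) d by auto
  show "last X5 \<notin> set X1 \<union> set X2 \<union> set X3 \<union> set X4 \<union> set P \<union> set S \<union> {s, b, c}"
    using lasts(5) d by auto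
qed

lemma freeI:
  assumes "U @ k # W \<in> set [s # X1, s # X2, s # P @ [b], b # X3, b # S @ [c], c # X4, c # X5]"
    "U \<noteq> []" "set (k # W) \<subseteq> D" "set U \<inter> D = {}" "s \<notin> D"
    "\<And>ys. ys \<in> set [s # X1, s # X2, s # P @ [b], b # X3, b # S @ [c], c # X4, c # X5] \<Longrightarrow>
      ys \<noteq> U @ k # W \<Longrightarrow> set ys \<subseteq> D \<or> set ys \<inter> D = {}"
    and "\<forall>x\<in>{last X1, last X2, last X3, last X4, last X5}.
      (x \<notin> D \<longrightarrow> (k, x) \<notin> E) \<and> (x \<in> D \<longrightarrow> (last U, x) \<notin> E)"
  shows "free k"
  unfolding free_def by (rule config_edge[OF cfg assms(1-6) bspec[OF assms(7)]])

text \<open>The part of the leg from \<open>k\<close> on contains only the leaf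
  \<open>last X1\<close>. So \<open>k\<close> has to avoid the other four leaves, and the vertex
  before \<open>k\<close> has to avoid \<open>last X1\<close>.\<close>

lemma free_X1:
  assumes X: "X1 = A @ k # B" and k: "(k, last X2) \<notin> E" "(k, last X3) \<notin> E" "(k, last X4) \<notin> E" "(k, last X5) \<notin> E"
    and q: "(last (s # A), last X1) \<notin> E"
  shows "free k"
proof (rule freeI[of "s # A" k B "set (k # B)"])
  have sub: "set (k # B) \<subseteq> set X1" using X by auto
  have "last X1 \<in> set (k # B)" using last_in_set[of "k # B"] unfolding X by simp
  then have "last X1 \<in> set (k # B)" "last X2 \<notin> set (k # B)" "last X3 \<notin> set (k # B)" "last X4 \<notin> set (k # B)" "last X5 \<notin> set (k # B)"
    using sub last_notin by blast+
  then show "\<forall>x\<in>{last X1, last X2, last X3, last X4, last X5}.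
      (x \<notin> set (k # B) \<longrightarrow> (k, x) \<notin> E) \<and> (x \<in> set (k # B) \<longrightarrow> (last (s # A), x) \<notin> E)"
    using k q by blast
  show "(s # A) @ k # B \<in> set [s # X1, s # X2, s # P @ [b], b # X3, b # S @ [c], c # X4, c # X5]"
    using X by simp
  have d: "distinct (A @ k # B)" "s \<notin> set X1" using config_distinct X by auto
  show "s # A \<noteq> []" "set (k # B) \<subseteq> set (k # B)" by simp_all
  show "set (s # A) \<inter> set (k # B) = {}" using d sub by auto
  show "s \<notin> set (k # B)" using sub config_distinct by auto
  show "set ys \<subseteq> set (k # B) \<or> set ys \<inter> set (k # B) = {}"
    if ys: "ys \<in> set [s # X1, s # X2, s # P @ [b], b # X3, b # S @ [c], c # X4, c # X5]" "ys \<noteq> (s # A) @ k # B" for ys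
  proof -
    have "ys \<noteq> s # X1" using ys(2) X by simp
    then have "ys \<in> {s # X2, s # P @ [b], b # X3, b # S @ [c], c # X4, c # X5}" using ys(1) by simp
    then have "set ys \<inter> set X1 = {}"
      using config_distinct by (elim insertE emptyE) auto
    then show ?thesis using sub by blast
  qed
qed

lemma free_X3:
  assumes X: "X3 = A @ k # B" and k: "(k, last X1) \<notin> E" "(k, last X2) \<notin> E" "(k, last X4) \<notin> E" "(k, last X5) \<notin> E"
    and q: "(last (b # A), last X3) \<notin> E"
  shows "free k"
proof (rule freeI[of "b # A" k B "set (k # B)"])
  have sub: "set (k # B) \<subseteq> set X3" using X by auto
  have "last X3 \<in> set (k # B)" using last_in_set[of "k # B"] unfolding X by simp
  then have "last X3 \<in> set (k # B)" "last X1 \<notin> set (k # B)" "last X2 \<notin> set (k # B)" "last X4 \<notin> set (k # B)" "last X5 \<notin> set (k # B)"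
    using sub last_notin by blast+
  then show "\<forall>x\<in>{last X1, last X2, last X3, last X4, last X5}.
      (x \<notin> set (k # B) \<longrightarrow> (k, x) \<notin> E) \<and> (x \<in> set (k # B) \<longrightarrow> (last (b # A), x) \<notin> E)"
    using k q by blast
  show "(b # A) @ k # B \<in> set [s # X1, s # X2, s # P @ [b], b # X3, b # S @ [c], c # X4, c # X5]"
    using X by simp
  have d: "distinct (A @ k # B)" "b \<notin> set X3" using config_distinct X by auto
  show "b # A \<noteq> []" "set (k # B) \<subseteq> set (k # B)" by simp_all
  show "set (b # A) \<inter> set (k # B) = {}" using d sub by auto
  show "s \<notin> set (k # B)" using sub config_distinct by auto
  show "set ys \<subseteq> set (k # B) \<or> set ys \<inter> set (k # B) = {}"
    if ys: "ys \<in> set [s # X1, s # X2, s # P @ [b], b # X3, b # S @ [c], c # X4, c # X5]" "ys \<noteq> (b # A) @ k # B" for ys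
  proof -
    have "ys \<noteq> b # X3" using ys(2) X by simp
    then have "ys \<in> {s # X1, s # X2, s # P @ [b], b # S @ [c], c # X4, c # X5}" using ys(1) by simp
    then have "set ys \<inter> set X3 = {}"
      using config_distinct by (elim insertE emptyE) auto
    then show ?thesis using sub by blast
  qed
qed

lemma free_X4:
  assumes X: "X4 = A @ k # B" and k: "(k, last X1) \<notin> E" "(k, last X2) \<notin> E" "(k, last X3) \<notin> E" "(k, last X5) \<notin> E"
    and q: "(last (c # A), last X4) \<notin> E"
  shows "free k"
proof (rule freeI[of "c # A" k B "set (k # B)"])
  have sub: "set (k # B) \<subseteq> set X4" using X by auto
  have "last X4 \<in> set (k # B)" using last_in_set[of "k # B"] unfolding X by simp
  then have "last X4 \<in> set (k # B)" "last X1 \<notin> set (k # B)" "last X2 \<notin> set (k # B)" "last X3 \<notin> set (k # B)" "last X5 \<notin> set (k # B)"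
    using sub last_notin by blast+
  then show "\<forall>x\<in>{last X1, last X2, last X3, last X4, last X5}.
      (x \<notin> set (k # B) \<longrightarrow> (k, x) \<notin> E) \<and> (x \<in> set (k # B) \<longrightarrow> (last (c # A), x) \<notin> E)"
    using k q by blast
  show "(c # A) @ k # B \<in> set [s # X1, s # X2, s # P @ [b], b # X3, b # S @ [c], c # X4, c # X5]"
    using X by simp
  have d: "distinct (A @ k # B)" "c \<notin> set X4" using config_distinct X by auto
  show "c # A \<noteq> []" "set (k # B) \<subseteq> set (k # B)" by simp_all
  show "set (c # A) \<inter> set (k # B) = {}" using d sub by auto
  show "s \<notin> set (k # B)" using sub config_distinct by auto
  show "set ys \<subseteq> set (k # B) \<or> set ys \<inter> set (k # B) = {}"
    if ys: "ys \<in> set [s # X1, s # X2, s # P @ [b], b # X3, b # S @ [c], c # X4, c # X5]" "ys \<noteq> (c # A) @ k # B" for ys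
  proof -
    have "ys \<noteq> c # X4" using ys(2) X by simp
    then have "ys \<in> {s # X1, s # X2, s # P @ [b], b # X3, b # S @ [c], c # X5}" using ys(1) by simp
    then have "set ys \<inter> set X4 = {}"
      using config_distinct by (elim insertE emptyE) auto
    then show ?thesis using sub by blast
  qed
qed

text \<open>Everything beyond \<open>k\<close>, including \<open>b\<close>, \<open>c\<close> and
  their legs, lies on the side of \<open>k\<close>; the leaves split into two on the side of
  \<open>s\<close> and three on that of \<open>k\<close>.\<close>

lemma free_P:
  assumes X: "P @ [b] = A @ k # B" and k: "(k, last X1) \<notin> E" "(k, last X2) \<notin> E"
    and q: "(last (s # A), last X3) \<notin> E" "(last (s # A), last X4) \<notin> E" "(last (s # A), last X5) \<notin> E"
  shows "free k"
proof (rule freeI[of "s # A" k B "set (k # B @ X3 @ S @ c # X4 @ X5)"])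
  let ?D = "set (k # B @ X3 @ S @ c # X4 @ X5)"
  have sX: "set (P @ [b]) = set (A @ k # B)" using X by simp
  have b: "b \<in> set (k # B)" using arg_cong[OF X, of last] by (cases "B = []") auto
  have "distinct (s # X1 @ X2 @ (P @ [b]) @ X3 @ S @ c # X4 @ X5)" using config_distinct by auto
  then have d: "distinct (s # X1 @ X2 @ (A @ k # B) @ X3 @ S @ c # X4 @ X5)" unfolding X .
  have "last X1 \<notin> ?D" "last X2 \<notin> ?D" "last X3 \<in> ?D" "last X4 \<in> ?D" "last X5 \<in> ?D"
    using sX lasts last_notin by auto
  then show "\<forall>x\<in>{last X1, last X2, last X3, last X4, last X5}.
      (x \<notin> ?D \<longrightarrow> (k, x) \<notin> E) \<and> (x \<in> ?D \<longrightarrow> (last (s # A), x) \<notin> E)"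
    using k q by blast
  show "(s # A) @ k # B \<in> set [s # X1, s # X2, s # P @ [b], b # X3, b # S @ [c], c # X4, c # X5]"
    using X by simp
  show "set (s # A) \<inter> ?D = {}" "s \<notin> ?D" "set (k # B) \<subseteq> ?D" "s # A \<noteq> []" using d by auto
  show "set ys \<subseteq> ?D \<or> set ys \<inter> ?D = {}"
    if "ys \<in> set [s # X1, s # X2, s # P @ [b], b # X3, b # S @ [c], c # X4, c # X5]" "ys \<noteq> (s # A) @ k # B" for ys
  proof -
    have "ys \<noteq> s # P @ [b]" using that(2) X by simp
    then have "ys \<in> {s # X1, s # X2} \<or> ys \<in> {b # X3, b # S @ [c], c # X4, c # X5}" using that(1) by auto
    then show ?thesis
    proof
      assume "ys \<in> {s # X1, s # X2}"
      then have "set ys \<inter> ?D = {}" using d by (elim insertE emptyE) auto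
      then show ?thesis ..
    next
      assume "ys \<in> {b # X3, b # S @ [c], c # X4, c # X5}"
      then have "set ys \<subseteq> ?D" using b by (elim insertE emptyE) auto
      then show ?thesis ..
    qed
  qed
qed

lemma free_S:
  assumes X: "S @ [c] = A @ k # B" and k: "(k, last X1) \<notin> E" "(k, last X2) \<notin> E" "(k, last X3) \<notin> E"
    and q: "(last (b # A), last X4) \<notin> E" "(last (b # A), last X5) \<notin> E"
  shows "free k"
proof (rule freeI[of "b # A" k B "set (k # B @ X4 @ X5)"])
  let ?D = "set (k # B @ X4 @ X5)"
  have sX: "set (S @ [c]) = set (A @ k # B)" using X by simp
  have c: "c \<in> set (k # B)" using arg_cong[OF X, of last] by (cases "B = []") auto
  have "distinct (s # X1 @ X2 @ P @ b # X3 @ (S @ [c]) @ X4 @ X5)" using config_distinct by auto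
  then have d: "distinct (s # X1 @ X2 @ P @ b # X3 @ (A @ k # B) @ X4 @ X5)" unfolding X .
  have "last X1 \<notin> ?D" "last X2 \<notin> ?D" "last X3 \<notin> ?D" "last X4 \<in> ?D" "last X5 \<in> ?D"
    using sX lasts last_notin by auto
  then show "\<forall>x\<in>{last X1, last X2, last X3, last X4, last X5}.
      (x \<notin> ?D \<longrightarrow> (k, x) \<notin> E) \<and> (x \<in> ?D \<longrightarrow> (last (b # A), x) \<notin> E)"
    using k q by blast
  show "(b # A) @ k # B \<in> set [s # X1, s # X2, s # P @ [b], b # X3, b # S @ [c], c # X4, c # X5]"
    using X by simp
  show "set (b # A) \<inter> ?D = {}" "s \<notin> ?D" "set (k # B) \<subseteq> ?D" "b # A \<noteq> []" using d by auto
  show "set ys \<subseteq> ?D \<or> set ys \<inter> ?D = {}"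
    if "ys \<in> set [s # X1, s # X2, s # P @ [b], b # X3, b # S @ [c], c # X4, c # X5]" "ys \<noteq> (b # A) @ k # B" for ys
  proof -
    have "ys \<noteq> b # S @ [c]" using that(2) X by simp
    then have "ys \<in> {s # X1, s # X2, s # P @ [b], b # X3} \<or> ys \<in> {c # X4, c # X5}" using that(1) by auto
    then show ?thesis
    proof
      assume "ys \<in> {s # X1, s # X2, s # P @ [b], b # X3}"
      then have "set ys \<inter> ?D = {}" using d by (elim insertE emptyE) auto
      then show ?thesis ..
    next
      assume "ys \<in> {c # X4, c # X5}"
      then have "set ys \<subseteq> ?D" using c by (elim insertE emptyE) auto
      then show ?thesis ..
    qed
  qed
qed

section \<open>Free vertices at \<open>b\<close> and \<open>c\<close>\<close>

lemma free_hd_X4: "free (hd X4)"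
  using free_X4[of "[]" "hd X4" "tl X4"] ne c_x4 hd_X4_x1 max_config.hd_X4_x1[OF swap12] hd_X4_x3 hd_X4_x5
  by simp

lemma free_hd_X5: "free (hd X5)"
  using max_config.free_hd_X4[OF swap45] free_swap45 by simp

lemma free_c: "free c"
  using free_S[of S c "[]"] c_x1 c_x2 c_x3 last_S_x4 max_config.last_S_x4[OF swap45] by simp

lemma free_hd_X3: "(b, last X3) \<notin> E \<Longrightarrow> free (hd X3)"
  using free_X3[of "[]" "hd X3" "tl X3"] ne hd_X3_x1 max_config.hd_X3_x1[OF swap12] hd_X3_x4
    max_config.hd_X3_x4[OF swap45]
  by simp

lemma free_hd_S: "free (hd (S @ [c]))"
proof -
  have "S @ [c] = [] @ hd (S @ [c]) # tl (S @ [c])" by (metis Nil_is_append_conv append_Nil list.collapse not_Cons_self2)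
  from free_S[OF this hd_S_x1 max_config.hd_S_x1[OF swap12] hd_S_x3] show ?thesis
    using b_x4 b_x5 by simp
qed

lemma free_b: "free b"
  using free_P[of P b "[]"] b_x1 b_x2 last_P_x3 last_P_x4 max_config.last_P_x4[OF swap45] by simp

text \<open>Adjacency of \<open>v\<close> to the leaf of the other leg is the one case left open by
  the exchanges; pivoting arranges that it does not occur.\<close>

lemma free_nbr_X1:
  assumes "v \<in> set X1" "(s, v) \<in> E" "(v, last X2) \<notin> E"
  shows "free v"
proof -
  obtain A B where X: "X1 = A @ v # B" using split_list[OF assms(1)] by blast
  have "(last (s # A), last X1) \<notin> E" using X1_x1[OF X _ assms(2)] s_x1 by simp
  then show ?thesis
    using free_X1[OF X assms(3) X1_x3[OF X assms(2)] X1_x4[OF X assms(2)]]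
      max_config.X1_x4[OF swap45 X assms(2)] by blast
qed

lemma free_nbr_X2: "v \<in> set X2 \<Longrightarrow> (s, v) \<in> E \<Longrightarrow> (v, last X1) \<notin> E \<Longrightarrow> free v"
  using max_config.free_nbr_X1[OF swap12] free_swap12 by simp

lemma free_nbr_P:
  assumes "v \<in> set P" "(s, v) \<in> E"
  shows "free v"
proof -
  obtain A B where X: "P = A @ v # B" using split_list[OF assms(1)] by blast
  have q: "(last (s # A), last X3) \<notin> E" "(last (s # A), last X4) \<notin> E" "(last (s # A), last X5) \<notin> E"
    using P_chord_x3[OF X _ assms(2)] P_chord_x4[OF X _ assms(2)]
      max_config.P_chord_x4[OF swap45 X _ assms(2)] s_x3 s_x4 s_x5 by simp_all
  show ?thesis using free_P[of A v "B @ [b]", OF _ P_x1[OF assms(1)] P_x2[OF assms(1)] q] X by simp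
qed

lemma free_nbr_X3:
  assumes "v \<in> set X3" "(s, v) \<in> E"
  shows "free v"
proof -
  obtain A B where X: "X3 = A @ v # B" using split_list[OF assms(1)] by blast
  then have A: "A \<noteq> []" using s_hd_X3 assms(2) by auto
  note X' = X A assms(2)
  have "(last (b # A), last X3) \<notin> E" using X3_x3[OF X'] A by simp
  then show ?thesis
    using free_X3[OF X X3_x1[OF X'] max_config.X3_x1[OF swap12 X'] X3_x4[OF X']
      max_config.X3_x4[OF swap45 X']] by blast
qed

lemma free_nbr_S:
  assumes "v \<in> set S" "(s, v) \<in> E"
  shows "free v"
proof -
  obtain A B where X: "S = A @ v # B" using split_list[OF assms(1)] by blast
  then have A: "A \<noteq> []" using s_hd_S assms(2) by auto
  note X' = X A assms(2)
  have "(last (b # A), last X4) \<notin> E" "(last (b # A), last X5) \<notin> E"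
    using S_x4[OF X'] max_config.S_x4[OF swap45 X'] A by simp_all
  then show ?thesis
    using free_S[of A v "B @ [c]", OF _ S_x1[OF X'] max_config.S_x1[OF swap12 X'] S_x3[OF X A]] X by simp
qed

lemma free_nbr_X4:
  assumes "v \<in> set X4" "(s, v) \<in> E"
  shows "free v"
proof -
  obtain A B where X: "X4 = A @ v # B" using split_list[OF assms(1)] by blast
  then have A: "A \<noteq> []" using s_hd_X4 assms(2) by auto
  note X' = X A assms(2)
  have "(last (c # A), last X4) \<notin> E" using X4_x4[OF X'] A by simp
  then show ?thesis
    using free_X4[OF X X4_x1[OF X'] max_config.X4_x1[OF swap12 X'] X4_x3[OF X'] X4_x5[OF X']] by blast
qed

lemma free_nbr_X5: "v \<in> set X5 \<Longrightarrow> (s, v) \<in> E \<Longrightarrow> free v"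
  using max_config.free_nbr_X4[OF swap45] free_swap45 by simp

lemma free_nbr:
  assumes "\<forall>v\<in>set X1. (s, v) \<in> E \<longrightarrow> (v, last X2) \<notin> E" "\<forall>v\<in>set X2. (s, v) \<in> E \<longrightarrow> (v, last X1) \<notin> E"
    and sv: "(s, v) \<in> E"
  shows "free v"
proof -
  have "v \<in> V" using sv E_verts by blast
  then have "v \<in> insert s (set X1 \<union> set X2 \<union> set P \<union> insert b (set X3 \<union> set S \<union> insert c (set X4 \<union> set X5)))"
    using config_verts(1)[OF cfg] by auto
  moreover have "v \<noteq> s" "v \<noteq> c" using sv irrE s_c by auto
  ultimately show ?thesis
    using assms free_nbr_X1 free_nbr_X2 free_nbr_P free_nbr_X3 free_nbr_S free_nbr_X4 free_nbr_X5 free_b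
    by blast
qed

lemma hd_notin:
  "hd X3 \<notin> set X4 \<union> set X5 \<union> set P \<union> set S \<union> {s, b, c}"
  "hd X4 \<notin> set X3 \<union> set X5 \<union> set P \<union> set S \<union> {s, b, c}"
  "hd X5 \<notin> set X3 \<union> set X4 \<union> set P \<union> set S \<union> {s, b, c}"
proof -
  have in_set: "hd X3 \<in> set X3" "hd X4 \<in> set X4" "hd X5 \<in> set X5" using ne by auto
  note d = config_distinct
  show "hd X3 \<notin> set X4 \<union> set X5 \<union> set P \<union> set S \<union> {s, b, c}" using in_set(1) d by auto
  show "hd X4 \<notin> set X3 \<union> set X5 \<union> set P \<union> set S \<union> {s, b, c}" using in_set(2) d by auto
  show "hd X5 \<notin> set X3 \<union> set X4 \<union> set P \<union> set S \<union> {s, b, c}" using in_set(3) d by auto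
qed

lemma hubs_distinct: "s \<noteq> b" "s \<noteq> c" "b \<noteq> c" "c \<notin> set P" "c \<notin> set S" "b \<notin> set S" "s \<notin> set S"
  using config_distinct by auto

text \<open>Otherwise \<open>b\<close> is the centre of a claw whose ends are \<open>c\<close>,
  \<open>hd X3\<close> and the neighbour of \<open>b\<close> towards \<open>s\<close>.\<close>

lemma S_ne: "(b, last X3) \<in> E \<Longrightarrow> S \<noteq> []"
proof
  assume x3: "(b, last X3) \<in> E" and S: "S = []"
  have last: "last (s # P) \<in> set (s # P)" by (rule last_in_set) simp
  have "c \<notin> set (s # P)" using hubs_distinct by auto
  then have "c \<noteq> last (s # P)" using last by metis
  moreover have "hd X3 \<notin> set (s # P)" using hd_notin(1) by auto
  then have "hd X3 \<noteq> last (s # P)" using last by metis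
  moreover have "c \<noteq> hd X3" using hd_notin(1) by auto
  moreover have "(b, c) \<in> E" "(b, hd X3) \<in> E" "(b, last (s # P)) \<in> E"
    using paths ne S by (auto simp: path_iff split: if_splits)
  ultimately show False
    using claw[of b c "hd X3" "last (s # P)"] c_hd_X3[OF S] last_P_c[OF S] hd_X3_last_P[OF x3] E_sym by blast
qed

text \<open>Otherwise there is a claw at \<open>b\<close> with ends \<open>s\<close>,
  \<open>last X3\<close> and the neighbour of \<open>b\<close> towards \<open>c\<close>.\<close>

lemma s_b_x3:
  assumes "(b, last X3) \<in> E"
  shows "(s, b) \<notin> E"
proof
  assume "(s, b) \<in> E"
  then have "(b, s) \<in> E" by (rule E_sym)
  moreover have hd: "hd (S @ [c]) \<in> set (S @ [c])" by (rule hd_in_set) simp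
  have "s \<notin> set (S @ [c])" using hubs_distinct by auto
  then have "s \<noteq> hd (S @ [c])" using hd by metis
  moreover have "last X3 \<notin> set (S @ [c])" using last_notin(3) by auto
  then have "last X3 \<noteq> hd (S @ [c])" using hd by metis
  moreover have "s \<noteq> last X3" using last_notin(3) by auto
  moreover have "(b, hd (S @ [c])) \<in> E"
    using paths by (auto simp: path_iff split: if_splits)
  ultimately show False
    using claw[of b s "last X3" "hd (S @ [c])"] assms s_x3 s_hd_S hd_S_x3 E_sym by blast
qed

text \<open>Otherwise there is a claw at \<open>b\<close> with ends \<open>s\<close>,
  \<open>c\<close> and \<open>hd X3\<close>.\<close>

lemma s_b_S:
  assumes S: "S = []"
  shows "(s, b) \<notin> E"
proof
  assume "(s, b) \<in> E"
  then have "(b, s) \<in> E" by (rule E_sym)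
  moreover have "s \<noteq> c" "s \<noteq> hd X3" "c \<noteq> hd X3"
    using hd_notin(1) hubs_distinct by auto
  moreover have "(b, c) \<in> E" "(b, hd X3) \<in> E"
    using paths ne S by (auto simp: path_iff split: if_splits)
  ultimately show False
    using claw[of b s c "hd X3"] s_c s_hd_X3 c_hd_X3[OF S] by blast
qed

text \<open>\<open>K\<close> avoids the neighbours of \<open>s\<close> because they are counted
  separately. The vertices \<open>hd X4\<close>, \<open>hd X5\<close> and \<open>c\<close> always
  qualify. Two more are found among \<open>hd X3\<close> (if \<open>b\<close> is not adjacent to
  \<open>last X3\<close>), \<open>hd S\<close> (if \<open>S\<close> is nonempty) and
  \<open>b\<close> (if it is not adjacent to \<open>s\<close>), by \<open>S_ne\<close>,
  \<open>s_b_x3\<close> and \<open>s_b_S\<close>.\<close>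

lemma five_free:
  obtains K where "finite K" "card K = 5" "K \<inter> E `` {s} = {}" "\<And>k. k \<in> K \<Longrightarrow> free k"
proof -
  have base: "free (hd X4)" "free (hd X5)" "free c" "(s, hd X4) \<notin> E" "(s, hd X5) \<notin> E" "(s, c) \<notin> E"
    using free_hd_X4 free_hd_X5 free_c s_hd_X4 s_hd_X5 s_c by auto
  have dist: "hd X4 \<noteq> hd X5" "hd X4 \<noteq> c" "hd X5 \<noteq> c" "hd X4 \<noteq> b" "hd X5 \<noteq> b" "b \<noteq> c"
    "hd X3 \<noteq> hd X4" "hd X3 \<noteq> hd X5" "hd X3 \<noteq> c" "hd X3 \<noteq> b"
  proof -
    have "hd X4 \<in> set X4" "hd X5 \<in> set X5" using ne by auto
    then show "hd X4 \<noteq> hd X5" "hd X3 \<noteq> hd X4" "hd X3 \<noteq> hd X5" using hd_notin by auto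
  qed (use hd_notin hubs_distinct in auto)
  have S: "hd S \<noteq> hd X4" "hd S \<noteq> hd X5" "hd S \<noteq> c" "hd S \<noteq> b" "hd S \<noteq> hd X3" "free (hd S)" "(s, hd S) \<notin> E"
    if "S \<noteq> []"
  proof -
    have "hd S \<in> set S" using that by simp
    then show "hd S \<noteq> hd X4" "hd S \<noteq> hd X5" "hd S \<noteq> c" "hd S \<noteq> b" "hd S \<noteq> hd X3"
      using hd_notin hubs_distinct by auto
    show "free (hd S)" "(s, hd S) \<notin> E" using free_hd_S s_hd_S that by simp_all
  qed
  consider "(b, last X3) \<in> E" "S \<noteq> []" "(s, b) \<notin> E" | "(b, last X3) \<notin> E" "S \<noteq> []" | "(b, last X3) \<notin> E" "S = []" "(s, b) \<notin> E"
    using S_ne s_b_x3 s_b_S by blast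
  then show ?thesis
  proof cases
    case 1
    show ?thesis
      by (rule that[of "{hd X4, hd X5, c, hd S, b}"]) (use 1 base dist S free_b in auto)
  next
    case 2
    show ?thesis
      by (rule that[of "{hd X4, hd X5, c, hd X3, hd S}"])
        (use 2 base dist S free_hd_X3 s_hd_X3 in \<open>auto simp: card_insert_if\<close>)
  next
    case 3
    show ?thesis
      by (rule that[of "{hd X4, hd X5, c, hd X3, b}"])
        (use 3 base dist free_hd_X3 s_hd_X3 free_b in \<open>auto simp: card_insert_if\<close>)
  qed
qed

lemma six_independent:
  assumes "\<forall>v\<in>set X1. (s, v) \<in> E \<longrightarrow> (v, last X2) \<notin> E" "\<forall>v\<in>set X2. (s, v) \<in> E \<longrightarrow> (v, last X1) \<notin> E"
  shows "\<exists>I\<subseteq>V. card I = 6 \<and> (\<forall>x\<in>I. \<forall>y\<in>I. (x, y) \<notin> E) \<and> (\<Sum>x\<in>I. val E x) + 6 \<le> card V"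
proof -
  obtain K where K: "finite K" "card K = 5" "K \<inter> E `` {s} = {}" "\<And>k. k \<in> K \<Longrightarrow> free k"
    using five_free by blast
  have ex: "0 < excess T" using config_excess[OF cfg] by simp
  have sV: "s \<in> V" using config_verts(1)[OF cfg] by simp
  have finN: "finite (E `` {s})" using finE by (simp add: finite_Image)
  \<comment> \<open>The neighbours of \<open>s\<close> pay for the degree of \<open>s\<close>, and
    \<open>K\<close> yields the five further units.\<close>
  have "(\<Sum>x\<in>leaves T. val E x) + card (K \<union> E `` {s}) \<le> card V - 1"
  proof (rule leaf_degree_sum_rooted[OF config_opt[OF cfg] ex _ sV])
    show "finite (K \<union> E `` {s})" using K(1) finN by simp
    show "\<exists>q. unblocked T k q \<and> s \<notin> side T k q" if "k \<in> K \<union> E `` {s}" for k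
      using that K(4) free_nbr[OF assms] unfolding free_def by blast
  qed
  moreover have "card (K \<union> E `` {s}) = 5 + val E s"
    using K(1-3) finN by (simp add: card_Un_disjoint val_def)
  ultimately have sum: "(\<Sum>x\<in>leaves T. val E x) + val E s + 5 \<le> card V - 1" by simp
  have s_leaf: "(s, x) \<notin> E" "x \<noteq> s" if "x \<in> leaves T" for x
    using that s_x1 s_x2 s_x3 s_x4 s_x5 lasts config_distinct unfolding leaves_T by auto
  have finL: "finite (leaves T)" by (simp add: leaves_T)
  have cardL: "card (leaves T) = 5"
  proof -
    have "card {s, b} \<le> card V" using config_verts(1)[OF cfg] by (intro card_mono finV) auto
    moreover have "s \<noteq> b" using config_distinct by auto
    ultimately have "2 \<le> card V" by simp
    then show ?thesis using card_leaves[OF config_span_tree[OF cfg]] config_excess[OF cfg] by simp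
  qed
  have sn: "s \<notin> leaves T" using s_leaf by blast
  have "insert s (leaves T) \<subseteq> V" using sV by (auto simp: leaves_def)
  moreover have "card (insert s (leaves T)) = 6" using finL cardL sn by simp
  moreover have "\<forall>x\<in>insert s (leaves T). \<forall>y\<in>insert s (leaves T). (x, y) \<notin> E"
    using s_leaf leaf_nonadj irrE E_sym by blast
  moreover have "(\<Sum>x\<in>insert s (leaves T). val E x) + 6 \<le> card V"
    using sum finL sn by simp
  ultimately show ?thesis by blast
qed

end

context max_config
begin

text \<open>
  The root \<open>s\<close> may be inserted between any two consecutive neighbours of \<open>s\<close> on the path
  \<open>rev X1 @ X2\<close>; choosing the place well makes all edges at neighbours of \<open>s\<close> free.
\<close>

lemma pivot_step:
  assumes X: "X1 = A @ u # B" and u: "(s, u) \<in> E" "(u, last X2) \<in> E"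
  shows "max_config V E s B (u # rev A @ X2) P b X3 S c X4 X5"
    and "\<forall>w\<in>set (u # rev A @ X2). (s, w) \<in> E \<longrightarrow> (w, last B) \<notin> E"
proof -
  have B: "B \<noteq> []"
  proof
    assume "B = []"
    then show False using s_x1 u(1) X by simp
  qed
  then obtain u' B' where B': "B = u' # B'" by (cases B) auto
  have uu: "(u, u') \<in> E" using paths X B' by (simp add: path_iff)
  \<comment> \<open>Otherwise a path through both legs starts at \<open>u\<close>: back to the start
    of \<open>X1\<close>, along \<open>X2\<close>, and over to \<open>u'\<close> and the rest of
    \<open>X1\<close>.\<close>
  have "(u', last X2) \<notin> E"
    using ham[of "u # rev A @ X2 @ u' # B'"] u X B' hd_X1_X2 paths ne by (auto simp: path_iff split: if_splits)
  moreover have "u' \<in> set X1" using X B' by simp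
  then have "u' \<noteq> last X2" "u' \<noteq> s" using lasts config_distinct by auto
  moreover have "s \<noteq> last X2" using lasts config_distinct by auto
  \<comment> \<open>In the potential claw at \<open>u\<close> with ends \<open>s\<close>,
    \<open>last X2\<close>, \<open>u'\<close>, only the edge from \<open>s\<close> to
    \<open>u'\<close> is possible.\<close>
  ultimately have su': "(s, u') \<in> E"
    using claw[of u s "last X2" u'] E_sym u uu s_x2 by blast
  have cfg': "config s B (u # rev A @ X2) P b X3 S c X4 X5"
    using paths ne msV X B' u su' hd_X1_X2 unfolding config_def by (auto simp: path_iff split: if_splits)
  have len: "length B + length (u # rev A @ X2) = length X1 + length X2" using X by simp
  show "max_config V E s B (u # rev A @ X2) P b X3 S c X4 X5"
    by unfold_locales (use cfg' max1 max2 max3 in \<open>simp_all only: len\<close>)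
  have leaf: "(last X2, last X1) \<notin> E" using leaf_nonadj leaves_T by simp
  have lB: "last B = last X1" using X B by simp
  show "\<forall>w\<in>set (u # rev A @ X2). (s, w) \<in> E \<longrightarrow> (w, last B) \<notin> E"
  proof (intro ballI impI notI)
    fix w assume w: "w \<in> set (u # rev A @ X2)" "(s, w) \<in> E" "(w, last B) \<in> E"
    \<comment> \<open>Otherwise \<open>u\<close> is the centre of a claw with ends \<open>s\<close>,
      \<open>last X1\<close>, \<open>last X2\<close>.\<close>
    have "w \<noteq> u"
    proof
      assume "w = u"
      moreover have "last X1 \<noteq> last X2" "s \<noteq> last X1" using lasts config_distinct by auto
      ultimately show False
        using claw[of u s "last X1" "last X2"] u E_sym w(3) lB s_x1 s_x2 leaf \<open>s \<noteq> last X2\<close> by metis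
    qed
    then have "w \<in> set (rev A @ X2)" using w(1) by simp
    then obtain C D where CD: "rev A @ X2 = C @ w # D" by (metis split_list)
    have lD: "last (w # D) = last X2" using arg_cong[OF CD, of last] ne by (simp add: last_append)
    then have D: "D \<noteq> []" using w(3) leaf lB by auto
    have "path (u # rev A @ X2)" using cfg' by (simp add: config_def path_Cons)
    then have p: "path (u # C @ w # D)" unfolding CD .
    have "mset (rev A @ X2) = mset (C @ w # D)" using CD by simp
    then have m: "mset A + mset X2 = add_mset w (mset C + mset D)" by simp
    \<comment> \<open>A path through both legs from the neighbour \<open>u'\<close> of
      \<open>s\<close>: on to \<open>last X1\<close>, over to \<open>w\<close>, back to
      \<open>u\<close>, over to \<open>last X2\<close> and back to the vertex after
      \<open>w\<close>.\<close>
    have "mset (u' # B' @ w # rev C @ u # rev D) = mset X1 + mset X2"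
    proof -
      have "mset X1 + mset X2 = add_mset u (add_mset u' (mset B' + (mset A + mset X2)))"
        using X B' by (simp add: ac_simps add_mset_commute)
      then show ?thesis unfolding m by (simp add: ac_simps add_mset_commute)
    qed
    moreover have "path (u' # B' @ w # rev C @ u # rev D)"
      using p D w(3) lD u(2) B' X paths by (auto simp: path_iff split: if_splits)
    ultimately show False using ham[of "u' # B' @ w # rev C @ u # rev D"] su' by simp
  qed
qed

end

context three_branch_graph
begin

text \<open>Each \<open>pivot_step\<close> cuts \<open>X1\<close> down to a proper final segment and
  re-establishes the condition on the second leg, so the process stops.\<close>

lemma pivot:
  assumes "max_config V E s X1 X2 P b X3 S c X4 X5" "\<forall>v\<in>set X2. (s, v) \<in> E \<longrightarrow> (v, last X1) \<notin> E"
  shows "\<exists>Y1 Y2. max_config V E s Y1 Y2 P b X3 S c X4 X5 \<and>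
    (\<forall>v\<in>set Y1. (s, v) \<in> E \<longrightarrow> (v, last Y2) \<notin> E) \<and> (\<forall>v\<in>set Y2. (s, v) \<in> E \<longrightarrow> (v, last Y1) \<notin> E)"
  using assms
proof (induction "length X1" arbitrary: X1 X2 rule: less_induct)
  case less
  show ?case
  proof (cases "\<forall>v\<in>set X1. (s, v) \<in> E \<longrightarrow> (v, last X2) \<notin> E")
    case False
    then obtain u where "u \<in> set X1" and u: "(s, u) \<in> E" "(u, last X2) \<in> E" by blast
    then obtain A B where X: "X1 = A @ u # B" by (metis split_list)
    note step = max_config.pivot_step[OF less.prems(1) X u]
    show ?thesis by (rule less.hyps[OF _ step]) (simp add: X)
  qed (use less.prems in blast)
qed

text \<open>At most one \<open>pivot_step\<close> with the legs interchanged provides the condition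
  on the second leg that \<open>pivot\<close> starts from.\<close>

lemma max_config_independent:
  assumes m: "max_config V E s X1 X2 P b X3 S c X4 X5"
  shows "\<exists>I\<subseteq>V. card I = 6 \<and> (\<forall>x\<in>I. \<forall>y\<in>I. (x, y) \<notin> E) \<and> (\<Sum>x\<in>I. val E x) + 6 \<le> card V"
proof -
  have "\<exists>Y1 Y2. max_config V E s Y1 Y2 P b X3 S c X4 X5 \<and> (\<forall>v\<in>set Y2. (s, v) \<in> E \<longrightarrow> (v, last Y1) \<notin> E)"
  proof (cases "\<forall>v\<in>set X2. (s, v) \<in> E \<longrightarrow> (v, last X1) \<notin> E")
    case False
    then obtain u where "u \<in> set X2" and u: "(s, u) \<in> E" "(u, last X1) \<in> E" by blast
    then obtain A B where X: "X2 = A @ u # B" by (metis split_list)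
    show ?thesis using max_config.pivot_step[OF max_config.swap12[OF m] X u] by blast
  qed (use m in blast)
  then obtain Y1 Y2 where "max_config V E s Y1 Y2 P b X3 S c X4 X5"
    "\<forall>v\<in>set Y2. (s, v) \<in> E \<longrightarrow> (v, last Y1) \<notin> E" by blast
  from pivot[OF this] obtain Z1 Z2 where Z: "max_config V E s Z1 Z2 P b X3 S c X4 X5"
    "\<forall>v\<in>set Z1. (s, v) \<in> E \<longrightarrow> (v, last Z2) \<notin> E" "\<forall>v\<in>set Z2. (s, v) \<in> E \<longrightarrow> (v, last Z1) \<notin> E" by blast
  show ?thesis by (rule max_config.six_independent[OF Z])
qed

text \<open>All three measures are at most the number of vertices, so three successive maximizations
  yield a lexicographic maximum.\<close>

lemma config_independent:
  assumes "config s X1 X2 P b X3 S c X4 X5"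
  shows "\<exists>I\<subseteq>V. card I = 6 \<and> (\<forall>x\<in>I. \<forall>y\<in>I. (x, y) \<notin> E) \<and> (\<Sum>x\<in>I. val E x) + 6 \<le> card V"
proof -
  define C where "C = (\<lambda>(s, X1, X2, P, b, X3, S, c, X4, X5). config s X1 X2 P b X3 S c X4 X5)"
  define f1 :: "'a \<times> 'a list \<times> 'a list \<times> 'a list \<times> 'a \<times> 'a list \<times> 'a list \<times> 'a \<times> 'a list \<times> 'a list \<Rightarrow> nat"
    where "f1 = (\<lambda>(s, X1, X2, P, b, X3, S, c, X4, X5). length X1 + length X2)"
  define f2 :: "'a \<times> 'a list \<times> 'a list \<times> 'a list \<times> 'a \<times> 'a list \<times> 'a list \<times> 'a \<times> 'a list \<times> 'a list \<Rightarrow> nat"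
    where "f2 = (\<lambda>(s, X1, X2, P, b, X3, S, c, X4, X5). length P)"
  define f3 :: "'a \<times> 'a list \<times> 'a list \<times> 'a list \<times> 'a \<times> 'a list \<times> 'a list \<times> 'a \<times> 'a list \<times> 'a list \<Rightarrow> nat"
    where "f3 = (\<lambda>(s, X1, X2, P, b, X3, S, c, X4, X5). length X4 + length X5)"
  have bound: "f1 t < Suc (card V)" "f2 t < Suc (card V)" "f3 t < Suc (card V)" if "C t" for t
    using that by (auto simp: C_def f1_def f2_def f3_def dest!: config_card)
  obtain t0 where t0: "C t0" using assms by (auto simp: C_def)
  obtain t1 where t1: "C t1" "\<And>t. C t \<Longrightarrow> f1 t \<le> f1 t1"
    using ex_has_greatest_nat[of C t0 f1 "Suc (card V)"] t0 bound by blast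
  obtain t2 where t2: "C t2 \<and> f1 t2 = f1 t1" "\<And>t. C t \<and> f1 t = f1 t1 \<Longrightarrow> f2 t \<le> f2 t2"
    using ex_has_greatest_nat[of "\<lambda>t. C t \<and> f1 t = f1 t1" t1 f2 "Suc (card V)"] t1 bound by blast
  obtain t3 where t3: "C t3 \<and> f1 t3 = f1 t1 \<and> f2 t3 = f2 t2"
    "\<And>t. C t \<and> f1 t = f1 t1 \<and> f2 t = f2 t2 \<Longrightarrow> f3 t \<le> f3 t3"
    using ex_has_greatest_nat[of "\<lambda>t. C t \<and> f1 t = f1 t1 \<and> f2 t = f2 t2" t2 f3 "Suc (card V)"] t2 bound by blast
  obtain s X1 X2 P b X3 S c X4 X5 where t: "t3 = (s, X1, X2, P, b, X3, S, c, X4, X5)"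
    using prod_cases4 prod_cases7 by metis
  have "max_config V E s X1 X2 P b X3 S c X4 X5"
  proof unfold_locales
    show "config s X1 X2 P b X3 S c X4 X5" using t3(1) by (simp add: C_def t)
    fix s' X1' X2' P' b' X3' S' c' X4' X5'
    assume "config s' X1' X2' P' b' X3' S' c' X4' X5'"
    then have c: "C (s', X1', X2', P', b', X3', S', c', X4', X5')" by (simp add: C_def)
    show l1: "length X1' + length X2' \<le> length X1 + length X2"
      using t1(2)[OF c] t3(1) by (simp add: f1_def t)
    assume e1: "length X1' + length X2' = length X1 + length X2"
    then show "length P' \<le> length P"
      using t2(2)[OF conjI[OF c]] t3(1) by (simp add: f1_def f2_def t)
    assume "length P' = length P"
    then show "length X4' + length X5' \<le> length X4 + length X5"
      using t3(2)[OF conjI[OF c]] e1 t3(1) by (simp add: f1_def f2_def f3_def t)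
  qed
  then show ?thesis by (rule max_config_independent)
qed

end

section \<open>Trees with three branch vertices\<close>

text \<open>Each branch vertex contributes at least one to the excess and there are at least three
  of them, so each contributes exactly one.\<close>

lemma (in three_branch_graph) three_branches:
  assumes T: "conn_span T" and ex: "excess T = 3"
  shows "card (branches T) = 3" "\<And>v. v \<in> V \<Longrightarrow> val T v \<le> 3"
proof -
  have finB: "finite (branches T)" using finV by (simp add: branches_def)
  show c3: "card (branches T) = 3" using no_two[OF T] card_branches_le_excess[of T] ex by linarith
  have e: "excess T = (\<Sum>v\<in>branches T. val T v - 2)"
    unfolding excess_def by (rule sum.mono_neutral_right) (use finV in \<open>auto simp: branches_def\<close>)
  show "val T v \<le> 3" if v: "v \<in> V" for v
  proof (rule ccontr)
    assume "\<not> val T v \<le> 3"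
    then have vB: "v \<in> branches T" using v by (simp add: branches_def)
    have "(\<Sum>v\<in>branches T. 1) < (\<Sum>v\<in>branches T. val T v - 2)"
      using finB vB \<open>\<not> val T v \<le> 3\<close> by (intro sum_strict_mono_ex1) (auto simp: branches_def intro!: bexI[of _ v])
    then show False using e ex c3 by simp
  qed
qed

context fin_graph
begin

text \<open>Walk from \<open>p\<close> through \<open>a\<close> along vertices of valency two until
  a leaf ends the side or a first branch vertex \<open>h\<close>, with predecessor \<open>q\<close>,
  is reached.\<close>

lemma walk_to_branch:
  assumes T: "span_tree T" and pa: "(p, a) \<in> T"
  shows "(\<exists>X. X \<noteq> [] \<and> path (p # X) \<and> mset X = mset_set (side T a p) \<and> side T a p \<inter> branches T = {})
    \<or> (\<exists>X h q. path (p # X @ [h]) \<and> (q, h) \<in> T \<and> 3 \<le> val T h \<and> side T h q \<subseteq> side T a p \<and>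
        mset_set (side T a p) = mset X + mset_set (side T h q) \<and>
        side T a p \<inter> branches T = side T h q \<inter> branches T)"
  using pa
proof (induction "card (side T a p)" arbitrary: a p rule: less_induct)
  case less
  note cT = span_treeD(1)[OF T]
  have ap: "(a, p) \<in> T" using less.prems conn_spanD(3)[OF cT] by blast
  have V: "a \<in> V" "p \<in> V" using conn_spanD(4)[OF cT ap] by auto
  have pE: "(p, a) \<in> E" using less.prems conn_spanD(1)[OF cT] by blast
  have fin: "finite (side T a p)" using side_in_V[OF cT V(1)] finV finite_subset by blast
  consider "3 \<le> val T a" | "val T a = 1" | "val T a = 2"
  proof -
    have "V \<noteq> {a}" using V ap conn_spanD(5)[OF cT] by auto
    then show ?thesis using that val_ge_1[OF T V(1)] by linarith
  qed
  then show ?case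
  proof cases
    case 1
    then show ?thesis using less.prems pE
      by (intro disjI2 exI[of _ "[]"] exI[of _ a] exI[of _ p]) simp
  next
    case 2
    then have "side T a p = {a}" using V ap by (intro side_leaf[OF T]) (auto simp: leaves_def)
    moreover have "a \<notin> branches T" using 2 by (simp add: branches_def)
    ultimately show ?thesis using pE by (intro disjI1 exI[of _ "[a]"]) simp
  next
    case 3
    then obtain y z where yz: "T `` {a} = {y, z}" "y \<noteq> z" by (auto simp: val_def card_2_iff)
    have "p \<in> T `` {a}" using ap by simp
    then obtain d where d: "T `` {a} = {p, d}" "d \<noteq> p" using yz by (metis insertE insert_commute singletonD)
    have ad: "(a, d) \<in> T" using d by blast
    have dec: "side T a p = insert a (side T d a)" using side_decomp[OF T ap] d by auto
    have an: "a \<notin> side T d a" using not_in_side[OF T] ad conn_spanD(3)[OF cT] by blast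
    have finD: "finite (side T d a)" using fin dec by simp
    have ab: "a \<notin> branches T" using 3 by (simp add: branches_def)
    have "card (side T d a) < card (side T a p)" using dec an finD by simp
    from less.hyps[OF this ad] show ?thesis
    proof
      assume "\<exists>X. X \<noteq> [] \<and> path (a # X) \<and> mset X = mset_set (side T d a) \<and> side T d a \<inter> branches T = {}"
      then obtain X where X: "X \<noteq> []" "path (a # X)" "mset X = mset_set (side T d a)" "side T d a \<inter> branches T = {}"
        by blast
      have "path (p # a # X)" using X pE by simp
      moreover have "mset (a # X) = mset_set (side T a p)" using X dec an finD by simp
      moreover have "side T a p \<inter> branches T = {}" using X ab dec by auto
      ultimately show ?thesis by blast
    next
      assume "\<exists>X h q. path (a # X @ [h]) \<and> (q, h) \<in> T \<and> 3 \<le> val T h \<and> side T h q \<subseteq> side T d a \<and>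
        mset_set (side T d a) = mset X + mset_set (side T h q) \<and>
        side T d a \<inter> branches T = side T h q \<inter> branches T"
      then obtain X h q where X: "path (a # X @ [h])" "(q, h) \<in> T" "3 \<le> val T h" "side T h q \<subseteq> side T d a"
        "mset_set (side T d a) = mset X + mset_set (side T h q)"
        "side T d a \<inter> branches T = side T h q \<inter> branches T" by blast
      have "path (p # (a # X) @ [h])" using X(1) pE by simp
      moreover have "mset_set (side T a p) = mset (a # X) + mset_set (side T h q)"
        using X(5) dec an finD by simp
      moreover have "side T h q \<subseteq> side T a p" using X(4) dec by blast
      moreover have "side T a p \<inter> branches T = side T h q \<inter> branches T" using X(6) dec ab by auto
      ultimately show ?thesis using X(2,3) by blast
    qed
  qed
qed

lemma split_at_branch:
  assumes T: "span_tree T" and qh: "(q, h) \<in> T" and v3: "val T h = 3"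
  obtains y z where "(h, y) \<in> T" "(h, z) \<in> T"
    "mset_set (side T h q) = add_mset h (mset_set (side T y h) + mset_set (side T z h))"
    "card (side T h q \<inter> branches T) = Suc (card (side T y h \<inter> branches T) + card (side T z h \<inter> branches T))"
proof -
  note cT = span_treeD(1)[OF T]
  have hq: "(h, q) \<in> T" using qh conn_spanD(3)[OF cT] by blast
  have "card (T `` {h} - {q}) = 2" using v3 hq finite_nbrs[OF cT, of h] by (simp add: val_def)
  then obtain y z where yz: "T `` {h} - {q} = {y, z}" "y \<noteq> z" by (auto simp: card_2_iff)
  then have hy: "(h, y) \<in> T" "(h, z) \<in> T" by auto
  have V: "h \<in> V" "y \<in> V" "z \<in> V" using conn_spanD(4)[OF cT] hy by blast+
  have fin: "finite (side T y h)" "finite (side T z h)"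
    using side_in_V[OF cT] V finV finite_subset by blast+
  have dec: "side T h q = insert h (side T y h \<union> side T z h)"
    using side_decomp[OF T hq] yz(1) by simp
  have hn: "h \<notin> side T y h" "h \<notin> side T z h" using not_in_side[OF T] hy conn_spanD(3)[OF cT] by blast+
  have dis: "side T y h \<inter> side T z h = {}" using sides_at_disjoint[OF T hy yz(2)] .
  have hB: "h \<in> branches T" using v3 V by (simp add: branches_def)
  have "mset_set (side T h q) = add_mset h (mset_set (side T y h) + mset_set (side T z h))"
    unfolding dec using fin hn dis by (simp add: mset_set_Union)
  moreover have "card (side T h q \<inter> branches T) = Suc (card (side T y h \<inter> branches T) + card (side T z h \<inter> branches T))"
  proof -
    have "side T h q \<inter> branches T = insert h (side T y h \<inter> branches T \<union> side T z h \<inter> branches T)"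
      using dec hB by auto
    moreover have "card (side T y h \<inter> branches T \<union> side T z h \<inter> branches T)
        = card (side T y h \<inter> branches T) + card (side T z h \<inter> branches T)"
      using fin dis by (intro card_Un_disjoint) auto
    ultimately show ?thesis using fin hn by simp
  qed
  ultimately show ?thesis using that hy by blast
qed

context
  fixes T assumes T: "span_tree T" and val3: "\<And>v. v \<in> V \<Longrightarrow> val T v \<le> 3"
begin

lemma branches_subset: "branches S \<subseteq> V"
  by (auto simp: branches_def)

lemma finite_branches: "finite (A \<inter> branches T)"
  using finV by (simp add: branches_def)

lemma arm0:
  assumes pa: "(p, a) \<in> T" and "card (side T a p \<inter> branches T) = 0"
  obtains X where "X \<noteq> []" "path (p # X)" "mset X = mset_set (side T a p)"
proof -
  have no: "side T a p \<inter> branches T = {}" using assms(2) finite_branches by simp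
  have "h \<in> side T h q \<inter> branches T" if "(q, h) \<in> T" "3 \<le> val T h" for h q
    using that conn_spanD(4)[OF span_treeD(1)[OF T] that(1)] by (simp add: branches_def)
  then show ?thesis using walk_to_branch[OF T pa] no that by (metis empty_iff)
qed

lemma arm_branch:
  assumes pa: "(p, a) \<in> T" and n: "card (side T a p \<inter> branches T) = Suc n"
  obtains X h y z where "path (p # X @ [h])" "(h, y) \<in> T" "(h, z) \<in> T"
    "mset_set (side T a p) = mset X + add_mset h (mset_set (side T y h) + mset_set (side T z h))"
    "n = card (side T y h \<inter> branches T) + card (side T z h \<inter> branches T)"
proof -
  have "side T a p \<inter> branches T \<noteq> {}" using n by auto
  then obtain X h q where X: "path (p # X @ [h])" "(q, h) \<in> T" "3 \<le> val T h"
    "mset_set (side T a p) = mset X + mset_set (side T h q)"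
    "side T a p \<inter> branches T = side T h q \<inter> branches T"
    using walk_to_branch[OF T pa] by blast
  have "h \<in> V" using conn_spanD(4)[OF span_treeD(1)[OF T] X(2)] by blast
  then have "val T h = 3" using val3 X(3) by (simp add: antisym)
  from split_at_branch[OF T X(2) this] obtain y z where "(h, y) \<in> T" "(h, z) \<in> T"
    "mset_set (side T h q) = add_mset h (mset_set (side T y h) + mset_set (side T z h))"
    "card (side T h q \<inter> branches T) = Suc (card (side T y h \<inter> branches T) + card (side T z h \<inter> branches T))" .
  then show ?thesis using that X n by simp
qed

lemma arm1:
  assumes pa: "(p, a) \<in> T" and n: "card (side T a p \<inter> branches T) = 1"
  obtains X h Y Z where "path (p # X @ [h])" "Y \<noteq> []" "Z \<noteq> []" "path (h # Y)" "path (h # Z)"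
    "mset_set (side T a p) = mset X + add_mset h (mset Y + mset Z)"
proof -
  obtain X h y z where X: "path (p # X @ [h])" "(h, y) \<in> T" "(h, z) \<in> T"
    "mset_set (side T a p) = mset X + add_mset h (mset_set (side T y h) + mset_set (side T z h))"
    "0 = card (side T y h \<inter> branches T) + card (side T z h \<inter> branches T)"
    using arm_branch[OF pa, of 0] n by (metis One_nat_def)
  obtain Y where Y: "Y \<noteq> []" "path (h # Y)" "mset Y = mset_set (side T y h)"
    using arm0[OF X(2)] X(5) by auto
  obtain Z where Z: "Z \<noteq> []" "path (h # Z)" "mset Z = mset_set (side T z h)"
    using arm0[OF X(3)] X(5) by auto
  show ?thesis using that[OF X(1) Y(1) Z(1) Y(2) Z(2)] X(4) Y(3) Z(3) by simp
qed

text \<open>The first branch vertex \<open>h\<close> met has two onward edges; one leads to a plain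
  leg and the other to the second branch vertex \<open>k\<close>.\<close>

lemma arm2:
  assumes pa: "(p, a) \<in> T" and n: "card (side T a p \<inter> branches T) = 2"
  obtains X h Y Z k U W where "path (p # X @ [h])" "Y \<noteq> []" "path (h # Y)" "path (h # Z @ [k])"
    "U \<noteq> []" "W \<noteq> []" "path (k # U)" "path (k # W)"
    "mset_set (side T a p) = mset X + add_mset h (mset Y + (mset Z + add_mset k (mset U + mset W)))"
proof -
  obtain X h y z where X: "path (p # X @ [h])" "(h, y) \<in> T" "(h, z) \<in> T"
    "mset_set (side T a p) = mset X + add_mset h (mset_set (side T y h) + mset_set (side T z h))"
    "1 = card (side T y h \<inter> branches T) + card (side T z h \<inter> branches T)"
    using arm_branch[OF pa, of 1] n by (metis Suc_1)
  note concl = that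
  have *: thesis if y: "(h, y) \<in> T" "card (side T y h \<inter> branches T) = 0"
    and z: "(h, z) \<in> T" "card (side T z h \<inter> branches T) = 1"
    and m: "mset_set (side T a p) = mset X + add_mset h (mset_set (side T y h) + mset_set (side T z h))" for y z
  proof -
    obtain Y where Y: "Y \<noteq> []" "path (h # Y)" "mset Y = mset_set (side T y h)" using arm0[OF y] .
    obtain Z k U W where Z: "path (h # Z @ [k])" "U \<noteq> []" "W \<noteq> []" "path (k # U)" "path (k # W)"
      "mset_set (side T z h) = mset Z + add_mset k (mset U + mset W)" using arm1[OF z] .
    show ?thesis using concl[OF X(1) Y(1,2) Z(1-5)] m Y(3) Z(6) by simp
  qed
  from X(5) consider "card (side T y h \<inter> branches T) = 0" "card (side T z h \<inter> branches T) = 1"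
    | "card (side T z h \<inter> branches T) = 0" "card (side T y h \<inter> branches T) = 1" by linarith
  then show ?thesis
  proof cases
    case 1
    then show ?thesis using * X(2-4) by blast
  next
    case 2
    then show ?thesis using *[of z y] X(2-4) by (simp add: add.commute)
  qed
qed

text \<open>Read the tree from the leaf \<open>r\<close> to its first branch vertex
  \<open>h\<close>. If the two other branch vertices lie in the same direction, \<open>h\<close> is
  an end of the chain and takes the role of \<open>s\<close>; if they lie in different directions,
  \<open>h\<close> is the middle one. The path back to \<open>r\<close> is one of the legs at
  \<open>h\<close>.\<close>

lemma ex_config:
  assumes card_branches: "card (branches T) = 3" and leaf: "r \<in> leaves T"
  shows "\<exists>s X1 X2 P b X3 S c X4 X5. config s X1 X2 P b X3 S c X4 X5"
proof -
  note cT = span_treeD(1)[OF T]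
  obtain a where ra: "(r, a) \<in> T" using leaf by (auto simp: leaves_def val_def card_1_singleton_iff)
  have rV: "r \<in> V" using leaf by (simp add: leaves_def)
  have ar: "(a, r) \<in> T" using ra conn_spanD(3)[OF cT] by blast
  have sd: "side T r a = {r}" using side_leaf[OF T leaf ra] .
  have fin: "finite (side T a r)" using side_in_V[OF cT] conn_spanD(4)[OF cT ar] finV finite_subset by blast
  have "V = insert r (side T a r)"
    using in_one_side[OF cT ra] sd side_in_V[OF cT, of a r] conn_spanD(4)[OF cT ar] rV by blast
  moreover have "r \<notin> side T a r" using not_in_side[OF T ar] .
  ultimately have mV: "mset_set V = add_mset r (mset_set (side T a r))" using fin by (metis mset_set.insert)
  have "r \<notin> branches T" using leaf by (simp add: leaves_def branches_def)
  then have "side T a r \<inter> branches T = branches T"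
    using \<open>V = insert r (side T a r)\<close> branches_subset[of T] by blast
  then have "card (side T a r \<inter> branches T) = Suc 2" using card_branches by simp
  then obtain X h y z where X: "path (r # X @ [h])" "(h, y) \<in> T" "(h, z) \<in> T"
    "mset_set (side T a r) = mset X + add_mset h (mset_set (side T y h) + mset_set (side T z h))"
    "2 = card (side T y h \<inter> branches T) + card (side T z h \<inter> branches T)"
    using arm_branch[OF ra] by metis
  have *: ?thesis if y: "(h, y) \<in> T" "card (side T y h \<inter> branches T) = 0"
    and z: "(h, z) \<in> T" "card (side T z h \<inter> branches T) = 2"
    and m: "mset_set (side T a r) = mset X + add_mset h (mset_set (side T y h) + mset_set (side T z h))" for y z
  proof -
    obtain Y where Y: "Y \<noteq> []" "path (h # Y)" "mset Y = mset_set (side T y h)" using arm0[OF y] .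
    obtain P b X3 S c X4 X5 where Z: "path (h # P @ [b])" "X3 \<noteq> []" "path (b # X3)" "path (b # S @ [c])"
      "X4 \<noteq> []" "X5 \<noteq> []" "path (c # X4)" "path (c # X5)"
      "mset_set (side T z h) = mset P + add_mset b (mset X3 + (mset S + add_mset c (mset X4 + mset X5)))"
      using arm2[OF z] .
    have "config h (rev X @ [r]) Y P b X3 S c X4 X5"
      unfolding config_def mV m Z(9) Y(3)[symmetric]
      using X(1) Y Z by (auto simp: path_Cons path_append hd_append last_append hd_rev last_rev E_commute
          ac_simps add_mset_commute split: if_splits)
    then show ?thesis by blast
  qed
  from X(5) consider "card (side T y h \<inter> branches T) = 0" "card (side T z h \<inter> branches T) = 2"
    | "card (side T z h \<inter> branches T) = 0" "card (side T y h \<inter> branches T) = 2"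
    | "card (side T y h \<inter> branches T) = 1" "card (side T z h \<inter> branches T) = 1" by linarith
  then show ?thesis
  proof cases
    case 1
    then show ?thesis using * X(2-4) by blast
  next
    case 2
    then show ?thesis using *[of z y] X(2-4) by (simp add: add.commute)
  next
    case 3
    obtain P s X1 X2 where Y: "path (h # P @ [s])" "X1 \<noteq> []" "X2 \<noteq> []" "path (s # X1)" "path (s # X2)"
      "mset_set (side T y h) = mset P + add_mset s (mset X1 + mset X2)" using arm1[OF X(2) 3(1)] .
    obtain S c X4 X5 where Z: "path (h # S @ [c])" "X4 \<noteq> []" "X5 \<noteq> []" "path (c # X4)" "path (c # X5)"
      "mset_set (side T z h) = mset S + add_mset c (mset X4 + mset X5)" using arm1[OF X(3) 3(2)] .
    have "config s X1 X2 (rev P) h (rev X @ [r]) S c X4 X5"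
      unfolding config_def mV X(4) Y(6) Z(6)
      using X(1) Y Z by (auto simp: path_Cons path_append hd_append last_append hd_rev last_rev E_commute
          ac_simps add_mset_commute split: if_splits)
    then show ?thesis by blast
  qed
qed

end

end

section \<open>The degree condition\<close>

lemma (in claw_free_graph) two_branches:
  assumes conn: "conn_span E"
    and deg: "\<And>I. I \<subseteq> V \<Longrightarrow> card I = 6 \<Longrightarrow> \<forall>x\<in>I. \<forall>y\<in>I. (x, y) \<notin> E \<Longrightarrow> card V \<le> (\<Sum>x\<in>I. val E x) + 5"
  shows "\<exists>H. conn_span H \<and> card (branches H) \<le> 2"
proof (rule ccontr)
  assume no: "\<not> ?thesis"
  interpret three_branch_graph V E
  proof unfold_locales
    fix H assume "conn_span H"
    then have "\<not> card (branches H) \<le> 2" using no by blast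
    then show "2 < card (branches H)" by simp
  qed
  have "\<exists>I\<subseteq>V. card I = 6 \<and> (\<forall>x\<in>I. \<forall>y\<in>I. (x, y) \<notin> E) \<and> (\<Sum>x\<in>I. val E x) + 6 \<le> card V"
  proof -
    obtain T where opt: "opt_tree T" using ex_opt_tree[OF conn] .
    note T = opt_treeD(1)[OF opt] and cT = opt_treeD(2)[OF opt]
    have ex: "3 \<le> excess T" using excess_ge_3[OF cT] .
    have "2 < card (branches T)" using no_two[OF cT] .
    moreover have "card (branches T) \<le> card V" using finV by (intro card_mono) (auto simp: branches_def)
    ultimately have V2: "2 \<le> card V" by linarith
    have finL: "finite (leaves T)" using finV by (simp add: leaves_def)
    have cardL: "card (leaves T) = excess T + 2" using card_leaves[OF T V2] .
    show ?thesis
    proof (cases "excess T = 3")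
      case True
      have "leaves T \<noteq> {}" using cardL by auto
      then obtain r where "r \<in> leaves T" by blast
      from ex_config[OF T three_branches(2)[OF cT True] three_branches(1)[OF cT True] this]
      obtain s X1 X2 P b X3 S c X4 X5 where "config s X1 X2 P b X3 S c X4 X5" by blast
      then show ?thesis by (rule config_independent)
    next
      case False
      then have ex4: "4 \<le> excess T" "0 < excess T" using ex by auto
      have "6 \<le> card (leaves T)" using ex4 cardL by simp
      then obtain I where I: "I \<subseteq> leaves T" "card I = 6" "finite I"
        by (rule obtain_subset_with_card_n)
      have "(\<Sum>x\<in>I. val E x) \<le> (\<Sum>x\<in>leaves T. val E x)" by (rule sum_mono2[OF finL I(1)]) simp
      moreover have "(\<Sum>x\<in>leaves T. val E x) + (excess T + 1) \<le> card V - 1"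
        using leaf_degree_sum_excess[OF opt ex4(2)] .
      \<comment> \<open>Excess four gives five unblocked edges; the sixth unit is the difference
        between vertices and tree edges.\<close>
      ultimately have "(\<Sum>x\<in>I. val E x) + 6 \<le> card V" using ex4 V2 by linarith
      moreover have "\<forall>x\<in>I. \<forall>y\<in>I. (x, y) \<notin> E"
        using leaves_independent[OF opt ex4(2)] I(1) by blast
      moreover have "I \<subseteq> V" using I(1) by (auto simp: leaves_def)
      ultimately show ?thesis using I(2) by blast
    qed
  qed
  then obtain I where "I \<subseteq> V" "card I = 6" "\<forall>x\<in>I. \<forall>y\<in>I. (x, y) \<notin> E" "(\<Sum>x\<in>I. val E x) + 6 \<le> card V" by blast
  then show False using deg[of I] by linarith
qed

section \<open>Translation to the definitions for pair graphs\<close>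

lemma rtrancl_on_pair: "reachable (with_proj G) u v \<Longrightarrow> (u, v) \<in> (parcs G)\<^sup>*"
  unfolding reachable_def with_proj_simps by (rule rtrancl_on_rtranclI)

lemma pair_reachableI:
  assumes "(u, v) \<in> R\<^sup>*" "u \<in> pverts G" "R \<subseteq> parcs G" "R \<subseteq> pverts G \<times> pverts G"
  shows "reachable (with_proj G) u v"
  using assms(1)
proof induction
  case base
  then show ?case using assms(2) by (simp add: reachable_def)
next
  case (step y z)
  then have "(y, z) \<in> parcs G" "z \<in> pverts G" using assms by auto
  then show ?case using step.IH unfolding reachable_def by (auto intro: rtrancl_on_into_rtrancl_on)
qed

text \<open>Connectedness refers to the symmetric closure, which for a pair graph has the same
  arcs.\<close>

lemma connected_pair_iff:
  assumes "pair_graph G"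
  shows "connected (with_proj G) \<longleftrightarrow> pverts G \<noteq> {} \<and> (\<forall>u\<in>pverts G. \<forall>v\<in>pverts G. (u, v) \<in> (parcs G)\<^sup>*)"
proof -
  interpret pair_graph G by fact
  have sym: "symmetric (with_proj G)" by (rule pair_sym_arcs)
  have vm: "pverts (mk_symmetric (with_proj G)) = pverts G" by (simp add: mk_symmetric_def)
  have am: "parcs (mk_symmetric (with_proj G)) = parcs G" using adj_mk_symmetric_eq[OF sym] by simp
  have sub: "parcs G \<subseteq> pverts G \<times> pverts G" using in_arcsD1 in_arcsD2 by auto
  have "reachable (with_proj (mk_symmetric (with_proj G))) u v \<longleftrightarrow> (u, v) \<in> (parcs G)\<^sup>*" if "u \<in> pverts G" for u v
    using rtrancl_on_pair[of "mk_symmetric (with_proj G)" u v]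
      pair_reachableI[of u v "parcs G" "mk_symmetric (with_proj G)"] sub that by (auto simp: vm am)
  then show ?thesis by (simp add: connected_def strongly_connected_def vm)
qed

lemma claw_free_graph_pair:
  assumes G: "pair_graph G" "connected (with_proj G)" "claw_free G"
  shows "claw_free_graph (pverts G) (parcs G)"
proof -
  interpret pair_graph G by fact
  have sub: "parcs G \<subseteq> pverts G \<times> pverts G" using in_arcsD1 in_arcsD2 by auto
  have sym: "sym (parcs G)" using pair_sym_arcs by (simp add: symmetric_def)
  show ?thesis
  proof unfold_locales
    show "finite (pverts G)" by (rule pair_finite_verts)
    show "pverts G \<noteq> {}" using G(2) connected_pair_iff[OF G(1)] by blast
    show "parcs G \<subseteq> pverts G \<times> pverts G" by (rule sub)
    show "sym (parcs G)" by (rule sym)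
    show "(v, v) \<notin> parcs G" for v using pair_no_loops[of "(v, v)"] by auto
    fix v a b c
    assume va: "(v, a) \<in> parcs G" "(v, b) \<in> parcs G" "(v, c) \<in> parcs G" "a \<noteq> b" "a \<noteq> c" "b \<noteq> c"
    show "(a, b) \<in> parcs G \<or> (a, c) \<in> parcs G \<or> (b, c) \<in> parcs G"
    proof (rule ccontr)
      assume n: "\<not> ?thesis"
      define H where "H = \<lparr>pverts = {v, a, b, c}, parcs = {v} \<times> {a, b, c} \<union> {a, b, c} \<times> {v}\<rparr>"
      have irr: "(x, x) \<notin> parcs G" for x using pair_no_loops[of "(x, x)"] by auto
      have "v \<notin> {a, b, c}" using va irr by auto
      have "K\<^bsub>1,3\<^esub> (with_proj H)"
        unfolding complete_bipartite_digraph_pair_def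
      proof (intro conjI exI)
        show "finite (pverts H)" by (simp add: H_def)
        show "pverts H = {v} \<union> {a, b, c}" "{v} \<inter> {a, b, c} = {}"
          "parcs H = {v} \<times> {a, b, c} \<union> {a, b, c} \<times> {v}"
          using \<open>v \<notin> {a, b, c}\<close> by (auto simp: H_def)
        show "card {v} = 1" "card {a, b, c} = 3" using va by simp_all
      qed
      moreover have "induced_subgraph (with_proj H) (with_proj G)"
      proof -
        have va': "(a, v) \<in> parcs G" "(b, v) \<in> parcs G" "(c, v) \<in> parcs G" using va symD[OF sym] by blast+
        have n': "(a, b) \<notin> parcs G" "(a, c) \<notin> parcs G" "(b, c) \<notin> parcs G"
          "(b, a) \<notin> parcs G" "(c, a) \<notin> parcs G" "(c, b) \<notin> parcs G" using n symD[OF sym] by blast+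
        have "parcs H \<subseteq> parcs G" using va va' by (auto simp: H_def)
        moreover have "pverts H \<subseteq> pverts G" using va sub by (auto simp: H_def)
        moreover have "parcs H = {e \<in> parcs G. fst e \<in> pverts H \<and> snd e \<in> pverts H}"
        proof (intro equalityI subsetI)
          fix e assume "e \<in> parcs H"
          then show "e \<in> {e \<in> parcs G. fst e \<in> pverts H \<and> snd e \<in> pverts H}"
            using \<open>parcs H \<subseteq> parcs G\<close> by (auto simp: H_def)
        next
          fix e assume e: "e \<in> {e \<in> parcs G. fst e \<in> pverts H \<and> snd e \<in> pverts H}"
          obtain x y where xy: "e = (x, y)" by (cases e)
          have in_H: "(x, y) \<in> parcs G" "x \<in> insert v {a, b, c}" "y \<in> insert v {a, b, c}"
            using e unfolding xy H_def by simp_all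
          have "(x, y) \<notin> parcs G" if "x \<in> {a, b, c}" "y \<in> {a, b, c}"
            using that n' irr by blast
          then have "x = v \<and> y \<in> {a, b, c} \<or> x \<in> {a, b, c} \<and> y = v" using in_H irr by blast
          then show "e \<in> parcs H" unfolding xy H_def by auto
        qed
        moreover have "wf_digraph (with_proj H)"
          unfolding wf_digraph_wp_iff by unfold_locales (auto simp: H_def)
        ultimately show ?thesis
          using wf_digraph by (auto simp: induced_subgraph_def subgraph_def)
      qed
      ultimately show False using G(3) by (auto simp: claw_free_def)
    qed
  qed
qed

text \<open>This shows that a cycle of length at least three does not traverse its first edge again
  in either direction.\<close>

lemma path_arc_endpoints:
  assumes "pcas x es y" "distinct (pawalk_verts x es)" "(a, b) \<in> set es"
  shows "a \<noteq> y" "b \<noteq> x" "a = x \<Longrightarrow> b = y \<Longrightarrow> length es = 1"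
proof -
  have last: "pcas x es y \<Longrightarrow> y \<in> set (pawalk_verts x es)" for x es
    by (induction es arbitrary: x) auto
  have hd: "x \<in> set (pawalk_verts x es)" if "pcas x es y" for x es
    using that by (cases es) auto
  have verts: "pcas x es y \<Longrightarrow> (a, b) \<in> set es \<Longrightarrow> a \<in> set (pawalk_verts x es) \<and> b \<in> set (pawalk_verts x es)" for x es
    by (induction es arbitrary: x) (auto dest: hd)
  have nil: "es = []" if "pcas y es y" "distinct (pawalk_verts y es)" for es
    using that last by (cases es) auto
  have "a \<noteq> y \<and> b \<noteq> x \<and> (a = x \<longrightarrow> b = y \<longrightarrow> length es = 1)"
    using assms
  proof (induction es arbitrary: x)
    case (Cons e es)
    obtain q where e: "e = (x, q)" and q: "pcas q es y" using Cons.prems(1) by (cases e) auto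
    have d: "distinct (pawalk_verts q es)" "x \<notin> set (pawalk_verts q es)" using Cons.prems(2) e by auto
    show ?case
    proof (cases "(a, b) = (x, q)")
      case True
      then show ?thesis using last[OF q] hd[OF q] d nil[of es] q by auto
    next
      case False
      then have ab: "(a, b) \<in> set es" using Cons.prems(3) e by auto
      then show ?thesis using Cons.IH[OF q d(1) ab] verts[OF q ab] d by auto
    qed
  qed simp
  then show "a \<noteq> y" "b \<noteq> x" "a = x \<Longrightarrow> b = y \<Longrightarrow> length es = 1" by auto
qed

lemma pcas_rtrancl: "pcas x es y \<Longrightarrow> set es \<subseteq> R \<Longrightarrow> (x, y) \<in> R\<^sup>*"
  by (induction es arbitrary: x) (auto intro: converse_rtrancl_into_rtrancl)

context fin_graph
begin

text \<open>A cycle without its first arc would connect the ends of a tree edge while avoiding this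
  edge, against \<open>not_in_side\<close>.\<close>

lemma undirected_tree_pair:
  assumes T: "span_tree T"
  shows "undirected_tree \<lparr>pverts = V, parcs = T\<rparr>" "pair_graph \<lparr>pverts = V, parcs = T\<rparr>"
proof -
  let ?T = "\<lparr>pverts = V, parcs = T\<rparr>"
  note cT = span_treeD(1)[OF T]
  show pg: "pair_graph ?T"
  proof unfold_locales
    show "symmetric (with_proj ?T)" using conn_spanD(2)[OF cT] by (simp add: symmetric_def)
    show "fst e \<in> pverts ?T" "snd e \<in> pverts ?T" if "e \<in> parcs ?T" for e
      using that conn_spanD(4)[OF cT, of "fst e" "snd e"] by auto
    show "fst e \<noteq> snd e" if "e \<in> parcs ?T" for e
      using that conn_spanD(5)[OF cT] by (cases e) auto
  qed (use finV conn_spanD(6)[OF cT] in auto)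
  have "connected (with_proj ?T)"
    using connected_pair_iff[OF pg] neV conn_spanD(7)[OF cT] by simp
  moreover have False if cyc: "pre_digraph.cycle (with_proj ?T) p" and len: "3 \<le> length p" for p
  proof -
    interpret pair_graph ?T by (rule pg)
    obtain u where w: "awalk u p u" and d: "distinct (tl (awalk_verts u p))" and "p \<noteq> []"
      using cyc by (auto simp: cycle_def)
    then obtain e es where p: "p = e # es" by (cases p) auto
    obtain w where e: "e = (u, w)" and es: "pcas w es u" "set es \<subseteq> T" "(u, w) \<in> T"
      using w unfolding awalk_def p by (cases e) auto
    have dv: "distinct (pawalk_verts w es)" using d unfolding p e by simp
    have "set es \<subseteq> del_edge T w u"
    proof
      fix f assume f: "f \<in> set es"
      obtain a b where ab: "f = (a, b)" by (cases f)
      from path_arc_endpoints[OF es(1) dv f[unfolded ab]] have "(a, b) \<noteq> (w, u)" "(a, b) \<noteq> (u, w)"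
        using len p by auto
      then show "f \<in> del_edge T w u" using f ab es(2) by (auto simp: del_edge_def)
    qed
    then have "u \<in> side T w u" using pcas_rtrancl[OF es(1)] by (simp add: side_def)
    moreover have "(w, u) \<in> T" using es(3) conn_spanD(3)[OF cT] by blast
    ultimately show False using not_in_side[OF T] by blast
  qed
  ultimately show "undirected_tree ?T" using pg by (auto simp: undirected_tree_def)
qed

end

theorem theorem1p5:
  fixes G :: "'a pair_pre_digraph" and n :: nat
  assumes "pair_graph G"
    and "connected (with_proj G)"
    and "claw_free G"
    and "card (pverts G) = n"
    and "sigma 6 G + 5 \<ge> enat n"
  shows "\<exists>T. undirected_spanning_tree T G \<and> card (branch_vertices T) \<le> 2"
proof -
  interpret pair_graph G by fact
  interpret cf: claw_free_graph "pverts G" "parcs G"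
    using claw_free_graph_pair assms by blast
  have deg: "deg H v = val (parcs H) v" if "pair_graph H" for H :: "'a pair_pre_digraph" and v
    using pair_graph.deg_eq_card_neighbours[OF that, of v] by (simp add: val_def Image_def)
  have "cf.conn_span (parcs G)"
    using connected_pair_iff[OF assms(1)] assms(2) cf.symE by (auto simp: cf.conn_span_def)
  moreover have "card (pverts G) \<le> (\<Sum>x\<in>I. val (parcs G) x) + 5"
    if "I \<subseteq> pverts G" "card I = 6" "\<forall>x\<in>I. \<forall>y\<in>I. (x, y) \<notin> parcs G" for I
  proof -
    have "sigma 6 G \<le> enat (\<Sum>x\<in>I. deg G x)"
      unfolding sigma_def by (rule INF_lower) (use that in \<open>auto simp: independent_set_def\<close>)
    then have "sigma 6 G + 5 \<le> enat (\<Sum>x\<in>I. deg G x) + 5" by (rule add_right_mono)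
    also have "\<dots> = enat ((\<Sum>x\<in>I. deg G x) + 5)" by (simp add: numeral_eq_enat)
    finally have "enat n \<le> enat ((\<Sum>x\<in>I. deg G x) + 5)" using assms(5) by (rule order.trans[rotated])
    then show ?thesis using deg[OF assms(1)] assms(4) by simp
  qed
  ultimately obtain H where H: "cf.conn_span H" "card (cf.branches H) \<le> 2"
    using cf.two_branches by blast
  \<comment> \<open>A spanning tree inside \<open>H\<close> has smaller or equal valencies, so all
    its branch vertices are branch vertices of \<open>H\<close>.\<close>
  obtain T where T: "T \<subseteq> H" "cf.span_tree T" using cf.conn_span_contains_tree[OF H(1)] .
  let ?T = "\<lparr>pverts = pverts G, parcs = T\<rparr>"
  note t = cf.undirected_tree_pair[OF T(2)]
  interpret t: pair_graph ?T by (rule t(2))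
  have "spanning (with_proj ?T) (with_proj G)"
    using cf.conn_spanD(1)[OF cf.span_treeD(1)[OF T(2)]] wf_digraph t.wf_digraph
    by (auto simp: spanning_def subgraph_def)
  moreover have "branch_vertices ?T \<subseteq> cf.branches H"
  proof
    fix v assume "v \<in> branch_vertices ?T"
    then have "v \<in> pverts G" "3 \<le> val T v" by (simp_all add: branch_vertices_def deg[OF t(2)])
    then show "v \<in> cf.branches H"
      using cf.val_mono[OF H(1) T(1), of v] by (simp add: cf.branches_def)
  qed
  then have "card (branch_vertices ?T) \<le> card (cf.branches H)"
    by (intro card_mono) (auto simp: cf.branches_def pair_finite_verts)
  ultimately show ?thesis using t(1) H(2) by (auto simp: undirected_spanning_tree_def)
qed

end
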